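(* Let $n,d\ge 1$ be integers and consider a subset $I\subseteq \operatorname{os}_n^{d+1}$. The subcategory $\mathcal{U}_I=\operatorname{add}\{M_y\mid y\in I\}$ is a $d$-torsion class in $\mathcal{M}_n^d$ if and only if the following hold for any elements $x,z\in\operatorname{os}_n^{d+1}$: (1) If $x\le z$ and $x_d=z_d$, then $x\in I$ implies $z\in I$. (2) If $x\rightsquigarrow\tau_d(z)$ and $x,z\in I$, then any $y\in\operatorname{os}_n^{d+1}$ with $y_i\in\{x_i,z_i\}$ for each $i$ must be in $I$.
   Context: Let $\Bbbk$ be a field. All subcategories are full and closed under isomorphisms, finite direct sums and direct summands; $\operatorname{add}(\mathcal{X})$ is the smallest such subcategory containing $\mathcal{X}$. For a finite-dimensional algebra $A$, $\operatorname{mod}A$ is the category of finitely presented right $A$-modules. Combinatorics: $N_n=\{0,\dots,n-1\}$; $N_n^d$ is the poset of $d$-tuples $(x_0,\dots,x_{d-1})$ over $N_n$ with the product order ($x\le y$ iff $x_i\le y_i$ for all $i$), also viewed as a $\Bbbk$-linear category ($\Bbbk$-linearisation of the poset) and so as a finite-dimensional $\Bbbk$-algebra. $\operatorname{os}_n^d\subseteq N_n^d$ is the set of non-decreasing tuples. The higher Auslander algebra of type $\mathbb{A}$ is the idempotent quotient $A_n^d=N_n^d/(N_n^d\setminus\operatorname{os}_n^d)$ (quotient by the ideal generated by the idempotents at vertices in $N_n^d\setminus\operatorname{os}_n^d$); right modules are contravariant functors on the corresponding category. For $x\in\operatorname{os}_n^{d+1}$, $M_x$ is the indecomposable $A_n^d$-module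 with support in all $y\in\operatorname{os}_n^d$ satisfying $x_0\le y_0\le x_1\le\cdots\le x_{d-1}\le y_{d-1}\le x_d$ (the interval module: $\Bbbk$ at each such $y$, zero elsewhere, with identity structure maps inside the support). Set $\mathcal{M}_n^d=\operatorname{add}\{M_x\mid x\in\operatorname{os}_n^{d+1}\}\subseteq\operatorname{mod}A_n^d$; it is known to be a $d$-cluster tilting subcategory of $\operatorname{mod}A_n^d$, with the $M_x$ the pairwise non-isomorphic indecomposables. On $\mathbb{Z}^{d+1}$ write $x\rightsquigarrow y$ iff $x_0\le y_0\le x_1\le y_1\le\cdots\le x_d\le y_d$, and $\tau_d(x_0,\dots,x_d)=(x_0-1,\dots,x_d-1)$. $d$-torsion classes: put $\mathcal{M}=\mathcal{M}_n^d$. A $d$-cokernel of $f_0\colon X_0\to X_1$ in $\mathcal{M}$ is a sequence $X_1\xrightarrow{f_1}\cdots\xrightarrow{f_d}X_{d+1}\to0$ in $\mathcal{M}$ such that $0\to\operatorname{Hom}(X_{d+1},M)\to\cdots\to\operatorname{Hom}(X_1,M)\to\operatorname{Hom}(X_0,M)$ is exact for every $M\in\mathcal{M}$; $d$-kernels are dual. A sequence $0\to X_0\xrightarrow{f_0}\cdots\xrightarrow{f_d}X_{d+1}\to0$ in $\mathcal{M}$ is $d$-exact if $(f_1,\dots,f_d)$ is a $d$-cokernel of $f_0$ and $(f_0,\dots,f_{d-1})$ is a $d$-kernel of $f_d$. A subcategory $\mathcal{U}\subseteq\mathcal{M}$ is a $d$-torsion class in $\mathcal{M}$ if for every $M\in\mathcal{M}$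 there is a $d$-exact sequence $0\to U_M\to M\to V_1\to\cdots\to V_d\to0$ in $\mathcal{M}$ with $U_M\in\mathcal{U}$ such that $0\to\operatorname{Hom}(U,V_1)\to\cdots\to\operatorname{Hom}(U,V_d)\to0$ is exact for every $U\in\mathcal{U}$. *)

theory Defs
  imports Complex_Main "HOL-Library.Function_Algebras"
begin

section \<open>The posets\<close>

text \<open>A tuple \<open>(x\<^sub>0, \<dots>, x\<^sub>d\<^sub>-\<^sub>1)\<close> is the list with entries \<open>x ! 0, \<dots>, x ! (d - 1)\<close>.\<close>

definition tuples :: "nat \<Rightarrow> nat \<Rightarrow> nat list set" where
  "tuples n d = {x. length x = d \<and> set x \<subseteq> {..<n}}"

definition os :: "nat \<Rightarrow> nat \<Rightarrow> nat list set" where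
  "os n d = {x \<in> tuples n d. sorted x}"

definition ple :: "nat list \<Rightarrow> nat list \<Rightarrow> bool" (infix "\<preceq>" 50) where
  "x \<preceq> y \<longleftrightarrow> list_all2 (\<le>) x y"

definition squig :: "int list \<Rightarrow> int list \<Rightarrow> bool" (infix "\<leadsto>" 50) where
  "x \<leadsto> y \<longleftrightarrow> length x = length y \<and> (\<forall>i<length x. x ! i \<le> y ! i) \<and>
     (\<forall>i. Suc i < length x \<longrightarrow> y ! i \<le> x ! Suc i)"

definition tau :: "int list \<Rightarrow> int list" where
  "tau x = map (\<lambda>a. a - 1) x"


section \<open>The linear category $N_n^d$ and the ideal defining $A_n^d$\<close>

text \<open>
  In the linearisation of a poset every morphism space is either zero or spanned by the one
  morphism \<open>x \<le> y\<close> of the poset.  A morphism is represented by its coefficient with respect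
  to this basis element, so that composition is multiplication in the field and every identity
  is 1.
\<close>

definition lin_hom :: "nat list \<Rightarrow> nat list \<Rightarrow> 'k::field set" where
  "lin_hom x y = (if x \<preceq> y then UNIV else {0})"

text \<open>
  The two-sided ideal generated by the identities of the vertices outside \<open>os n d\<close>:
  \<open>idem_ideal n d x y a\<close> says that \<open>a : x \<rightarrow> y\<close> lies in it.
\<close>

inductive idem_ideal :: "nat \<Rightarrow> nat \<Rightarrow> nat list \<Rightarrow> nat list \<Rightarrow> 'k::field \<Rightarrow> bool" for n d where
  gen: "z \<in> tuples n d - os n d \<Longrightarrow> idem_ideal n d z z 1"
| zero: "x \<in> tuples n d \<Longrightarrow> y \<in> tuples n d \<Longrightarrow> idem_ideal n d x y 0"
| add: "idem_ideal n d x y a \<Longrightarrow> idem_ideal n d x y b \<Longrightarrow> idem_ideal n d x y (a + b)"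
| pre: "x \<in> tuples n d \<Longrightarrow> a \<in> lin_hom x y \<Longrightarrow> idem_ideal n d y z b \<Longrightarrow> idem_ideal n d x z (a * b)"
| post: "z \<in> tuples n d \<Longrightarrow> idem_ideal n d x y a \<Longrightarrow> b \<in> lin_hom y z \<Longrightarrow> idem_ideal n d x z (a * b)"


section \<open>The category of finite-dimensional right $A_n^d$-modules\<close>

text \<open>
  The vector spaces occurring in modules are finite-dimensional subspaces of the space of all
  sequences over the field.  Every finite-dimensional space is isomorphic to one of these, so
  the resulting category is equivalent to the category of all finite-dimensional modules.
\<close>

definition kscale :: "'k::field \<Rightarrow> (nat \<Rightarrow> 'k) \<Rightarrow> (nat \<Rightarrow> 'k)" where
  "kscale c v = (\<lambda>i. c * v i)"

interpretation kseq: vector_space kscale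
  by unfold_locales (simp_all add: kscale_def fun_eq_iff algebra_simps)

definition fin_dim :: "(nat \<Rightarrow> 'k::field) set \<Rightarrow> bool" where
  "fin_dim V \<longleftrightarrow> (\<exists>B. finite B \<and> V = kseq.span B)"

definition linear_on :: "(nat \<Rightarrow> 'k::field) set \<Rightarrow> ((nat \<Rightarrow> 'k) \<Rightarrow> (nat \<Rightarrow> 'k)) \<Rightarrow> bool" where
  "linear_on V f \<longleftrightarrow> (\<forall>u\<in>V. \<forall>v\<in>V. f (u + v) = f u + f v) \<and>
     (\<forall>c. \<forall>v\<in>V. f (kscale c v) = kscale c (f v))"

text \<open>
  \<open>sp M x\<close> is the value of a functor at \<open>x\<close>, and \<open>act M x y a\<close> is the map
  \<open>sp M y \<rightarrow> sp M x\<close> induced by the morphism \<open>a : x \<rightarrow> y\<close>.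
\<close>

record 'k kmod =
  sp :: "nat list \<Rightarrow> (nat \<Rightarrow> 'k) set"
  act :: "nat list \<Rightarrow> nat list \<Rightarrow> 'k \<Rightarrow> (nat \<Rightarrow> 'k) \<Rightarrow> (nat \<Rightarrow> 'k)"

text \<open>
  A linear functor on the quotient category $A_n^d$ is a linear functor on $N_n^d$ that maps
  the ideal to zero.  By finite-dimensionality of $A_n^d$, a module is finitely presented if and
  only if it is finite-dimensional.
\<close>

definition mod_A :: "nat \<Rightarrow> nat \<Rightarrow> 'k::field kmod set" where
  "mod_A n d = {M.
     (\<forall>x\<in>tuples n d. kseq.subspace (sp M x) \<and> fin_dim (sp M x)) \<and>
     (\<forall>x\<in>tuples n d. \<forall>y\<in>tuples n d. \<forall>a\<in>lin_hom x y.
        act M x y a ` sp M y \<subseteq> sp M x \<and> linear_on (sp M y) (act M x y a)) \<and>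
     (\<forall>x\<in>tuples n d. \<forall>y\<in>tuples n d. \<forall>a\<in>lin_hom x y. \<forall>v\<in>sp M y.
        (\<forall>b\<in>lin_hom x y. act M x y (a + b) v = act M x y a v + act M x y b v) \<and>
        (\<forall>c. act M x y (c * a) v = kscale c (act M x y a v))) \<and>
     (\<forall>x\<in>tuples n d. \<forall>v\<in>sp M x. act M x x 1 v = v) \<and>
     (\<forall>x\<in>tuples n d. \<forall>y\<in>tuples n d. \<forall>z\<in>tuples n d. \<forall>a\<in>lin_hom x y. \<forall>b\<in>lin_hom y z.
        \<forall>v\<in>sp M z. act M x z (a * b) v = act M x y a (act M y z b v)) \<and>
     (\<forall>x\<in>tuples n d. \<forall>y\<in>tuples n d. \<forall>a. idem_ideal n d x y a \<longrightarrow>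
        (\<forall>v\<in>sp M y. act M x y a v = 0))}"

type_synonym 'k mor = "nat list \<Rightarrow> (nat \<Rightarrow> 'k) \<Rightarrow> (nat \<Rightarrow> 'k)"

text \<open>
  Morphisms are natural transformations, extended by 0 outside the source, so that equality of
  morphisms with a given source is equality of HOL functions.
\<close>

definition mHom :: "nat \<Rightarrow> nat \<Rightarrow> 'k::field kmod \<Rightarrow> 'k kmod \<Rightarrow> 'k mor set" where
  "mHom n d M N = {f.
     (\<forall>x\<in>tuples n d. f x ` sp M x \<subseteq> sp N x \<and> linear_on (sp M x) (f x)) \<and>
     (\<forall>x\<in>tuples n d. \<forall>y\<in>tuples n d. \<forall>a\<in>lin_hom x y. \<forall>v\<in>sp M y.
        f x (act M x y a v) = act N x y a (f y v)) \<and>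
     (\<forall>x v. \<not> (x \<in> tuples n d \<and> v \<in> sp M x) \<longrightarrow> f x v = 0)}"

definition mcomp :: "'k mor \<Rightarrow> 'k mor \<Rightarrow> 'k mor" (infixl "\<odot>" 70) where
  "g \<odot> f = (\<lambda>x v. g x (f x v))"

definition mid :: "nat \<Rightarrow> nat \<Rightarrow> 'k::field kmod \<Rightarrow> 'k mor" where
  "mid n d M = (\<lambda>x v. if x \<in> tuples n d \<and> v \<in> sp M x then v else 0)"


section \<open>Subcategories\<close>

definition miso :: "nat \<Rightarrow> nat \<Rightarrow> 'k::field kmod \<Rightarrow> 'k kmod \<Rightarrow> bool" where
  "miso n d M N \<longleftrightarrow> (\<exists>f\<in>mHom n d M N. \<exists>g\<in>mHom n d N M. g \<odot> f = mid n d M \<and> f \<odot> g = mid n d N)"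

definition mzero :: "nat \<Rightarrow> nat \<Rightarrow> 'k::field kmod \<Rightarrow> bool" where
  "mzero n d Z \<longleftrightarrow> (\<forall>x\<in>tuples n d. sp Z x = {0})"

definition mbiproduct :: "nat \<Rightarrow> nat \<Rightarrow> 'k::field kmod \<Rightarrow> 'k kmod \<Rightarrow> 'k kmod \<Rightarrow> bool" where
  "mbiproduct n d Z X Y \<longleftrightarrow>
     (\<exists>i\<in>mHom n d X Z. \<exists>j\<in>mHom n d Y Z. \<exists>p\<in>mHom n d Z X. \<exists>q\<in>mHom n d Z Y.
        p \<odot> i = mid n d X \<and> q \<odot> j = mid n d Y \<and> p \<odot> j = 0 \<and> q \<odot> i = 0 \<and>
        i \<odot> p + j \<odot> q = mid n d Z)"

text \<open>Subcategories are full, hence given by their objects.\<close>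

definition subcat :: "nat \<Rightarrow> nat \<Rightarrow> 'k::field kmod set \<Rightarrow> bool" where
  "subcat n d C \<longleftrightarrow> C \<subseteq> mod_A n d \<and>
     (\<forall>M\<in>C. \<forall>N\<in>mod_A n d. miso n d M N \<longrightarrow> N \<in> C) \<and>
     (\<forall>Z\<in>mod_A n d. mzero n d Z \<longrightarrow> Z \<in> C) \<and>
     (\<forall>X\<in>C. \<forall>Y\<in>C. \<forall>Z\<in>mod_A n d. mbiproduct n d Z X Y \<longrightarrow> Z \<in> C) \<and>
     (\<forall>Z\<in>C. \<forall>X\<in>mod_A n d. \<forall>Y\<in>mod_A n d. mbiproduct n d Z X Y \<longrightarrow> X \<in> C)"

definition madd :: "nat \<Rightarrow> nat \<Rightarrow> 'k::field kmod set \<Rightarrow> 'k kmod set" where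
  "madd n d X = \<Inter>{C. subcat n d C \<and> X \<subseteq> C}"


section \<open>Interval modules and $\mathcal{M}_n^d$\<close>

definition msupp :: "nat \<Rightarrow> nat \<Rightarrow> nat list \<Rightarrow> nat list set" where
  "msupp n d x = {y \<in> os n d. \<forall>i<d. x ! i \<le> y ! i \<and> y ! i \<le> x ! Suc i}"

text \<open>The sequences vanishing after position 0 serve as the field itself.\<close>

definition kline :: "(nat \<Rightarrow> 'k::field) set" where
  "kline = {v. \<forall>i>0. v i = 0}"

definition Mint :: "nat \<Rightarrow> nat \<Rightarrow> nat list \<Rightarrow> 'k::field kmod" where
  "Mint n d x =
     \<lparr>sp = (\<lambda>y. if y \<in> msupp n d x then kline else {0}),
      act = (\<lambda>y z a v. if y \<in> msupp n d x \<and> z \<in> msupp n d x then kscale a v else 0)\<rparr>"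

definition Mcat :: "nat \<Rightarrow> nat \<Rightarrow> 'k::field kmod set" where
  "Mcat n d = madd n d (Mint n d ` os n (d + 1))"


section \<open>Torsion classes in higher homological algebra\<close>

definition exact_at :: "'a set \<Rightarrow> ('a \<Rightarrow> 'b) \<Rightarrow> 'b set \<Rightarrow> ('b \<Rightarrow> 'c::zero) \<Rightarrow> bool" where
  "exact_at A f B g \<longleftrightarrow> f ` A = {b \<in> B. g b = 0}"

text \<open>
  A sequence \<open>X\<^sub>0 \<rightarrow> X\<^sub>1 \<rightarrow> \<dots> \<rightarrow> X\<^sub>d\<^sub>+\<^sub>1\<close> is given by functions \<open>X\<close> and \<open>f\<close> with
  \<open>f i : X i \<rightarrow> X (i + 1)\<close>; values of \<open>X\<close> and \<open>f\<close> at larger indices are irrelevant.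
\<close>

definition dseq :: "nat \<Rightarrow> nat \<Rightarrow> 'k::field kmod set \<Rightarrow> (nat \<Rightarrow> 'k kmod) \<Rightarrow> (nat \<Rightarrow> 'k mor) \<Rightarrow> bool" where
  "dseq n d \<M> X f \<longleftrightarrow> (\<forall>i\<le>d + 1. X i \<in> \<M>) \<and> (\<forall>i\<le>d. f i \<in> mHom n d (X i) (X (i + 1)))"

text \<open>
  \<open>d_cokernel n d \<M> X f\<close>: \<open>(f\<^sub>1, \<dots>, f\<^sub>d)\<close> is a \<open>d\<close>-cokernel of \<open>f\<^sub>0\<close>;
  \<open>d_kernel n d \<M> X f\<close>: \<open>(f\<^sub>0, \<dots>, f\<^sub>d\<^sub>-\<^sub>1)\<close> is a \<open>d\<close>-kernel of \<open>f\<^sub>d\<close>.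
\<close>

definition d_cokernel :: "nat \<Rightarrow> nat \<Rightarrow> 'k::field kmod set \<Rightarrow> (nat \<Rightarrow> 'k kmod) \<Rightarrow> (nat \<Rightarrow> 'k mor) \<Rightarrow> bool" where
  "d_cokernel n d \<M> X f \<longleftrightarrow> dseq n d \<M> X f \<and> (\<forall>M\<in>\<M>.
     exact_at {0 :: 'k mor} (\<lambda>_. 0) (mHom n d (X (d + 1)) M) (\<lambda>g. g \<odot> f d) \<and>
     (\<forall>i\<in>{1..d}. exact_at (mHom n d (X (i + 1)) M) (\<lambda>g. g \<odot> f i)
                          (mHom n d (X i) M) (\<lambda>g. g \<odot> f (i - 1))))"

definition d_kernel :: "nat \<Rightarrow> nat \<Rightarrow> 'k::field kmod set \<Rightarrow> (nat \<Rightarrow> 'k kmod) \<Rightarrow> (nat \<Rightarrow> 'k mor) \<Rightarrow> bool" where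
  "d_kernel n d \<M> X f \<longleftrightarrow> dseq n d \<M> X f \<and> (\<forall>M\<in>\<M>.
     exact_at {0 :: 'k mor} (\<lambda>_. 0) (mHom n d M (X 0)) (\<lambda>g. f 0 \<odot> g) \<and>
     (\<forall>i\<in>{1..d}. exact_at (mHom n d M (X (i - 1))) (\<lambda>g. f (i - 1) \<odot> g)
                          (mHom n d M (X i)) (\<lambda>g. f i \<odot> g)))"

definition d_exact :: "nat \<Rightarrow> nat \<Rightarrow> 'k::field kmod set \<Rightarrow> (nat \<Rightarrow> 'k kmod) \<Rightarrow> (nat \<Rightarrow> 'k mor) \<Rightarrow> bool" where
  "d_exact n d \<M> X f \<longleftrightarrow> d_cokernel n d \<M> X f \<and> d_kernel n d \<M> X f"

text \<open>
  In the sequence \<open>0 \<rightarrow> U\<^sub>M \<rightarrow> M \<rightarrow> V\<^sub>1 \<rightarrow> \<dots> \<rightarrow> V\<^sub>d \<rightarrow> 0\<close> we have \<open>X 0 = U\<^sub>M\<close>, \<open>X 1 = M\<close> and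
  \<open>X (i + 1) = V\<^sub>i\<close>.  The last condition is exactness at \<open>Hom(U, V\<^sub>i)\<close> of
  \<open>0 \<rightarrow> Hom(U, V\<^sub>1) \<rightarrow> \<dots> \<rightarrow> Hom(U, V\<^sub>d) \<rightarrow> 0\<close>, where the maps next to the two
  outer zeros are zero (for \<open>d = 1\<close> it says \<open>Hom(U, V\<^sub>1) = 0\<close>).
\<close>

definition d_torsion_class :: "nat \<Rightarrow> nat \<Rightarrow> 'k::field kmod set \<Rightarrow> 'k kmod set \<Rightarrow> bool" where
  "d_torsion_class n d \<M> \<U> \<longleftrightarrow> subcat n d \<U> \<and> \<U> \<subseteq> \<M> \<and>
     (\<forall>M\<in>\<M>. \<exists>X f. d_exact n d \<M> X f \<and> X 0 \<in> \<U> \<and> X 1 = M \<and>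
        (\<forall>U\<in>\<U>. \<forall>i\<in>{1..d}.
           exact_at (if i = 1 then {0} else mHom n d U (X i))
                    (\<lambda>g. if i = 1 then 0 else f i \<odot> g)
                    (mHom n d U (X (i + 1)))
                    (\<lambda>g. if i = d then 0 else f (i + 1) \<odot> g)))"

end

theory Submission
  imports Defs
begin

text \<open>
  A morphism \<open>M\<^sub>x \<rightarrow> M\<^sub>y\<close> is a multiple of one canonical map if \<open>x \<leadsto> y\<close>, and zero otherwise
  (\<open>hom_Mint\<close>); a composite of canonical maps is canonical or zero (\<open>can_comp\<close>).  Hence, for a
  sequence of canonical maps, exactness of \<open>Hom(M\<^sub>w, -)\<close> or \<open>Hom(-, M\<^sub>w)\<close> only asks which terms are
  related to \<open>w\<close>.  Testing on the modules \<open>M\<^sub>w\<close> suffices, because the modules for which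
  such a Hom sequence is exact are closed under sums and retracts (\<open>lifts_subcat\<close>,
  \<open>colifts_subcat\<close>).

  The $d$-exact sequences come from one construction.  Let \<open>x\<^sub>d\<^sub>-\<^sub>1 \<le> t < x\<^sub>d\<close>, let \<open>a = (x\<^sub>0, \<dots>, x\<^sub>d\<^sub>-\<^sub>1, t)\<close> be a
  truncation of \<open>x\<close> and \<open>b = (x\<^sub>1 + 1, \<dots>, x\<^sub>d\<^sub>-\<^sub>1 + 1, t + 1, x\<^sub>d)\<close>.  Replacing the entries of \<open>a\<close> by
  those of \<open>b\<close>, from the last one to the first, gives \<open>d + 2\<close> tuples, and the canonical maps
  \<open>M\<^sub>a \<rightarrow> M\<^sub>x \<rightarrow> \<dots> \<rightarrow> M\<^sub>b\<close> between them form a $d$-exact sequence (\<open>mixed_lifts\<close>, \<open>mixed_colifts\<close>).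

  Suppose that \<open>I\<close> satisfies the two conditions, and let \<open>t\<close> be the largest number for which the
  truncation \<open>a\<close> lies in \<open>I\<close>.  By the first condition every map from some \<open>M\<^sub>w\<close> with \<open>w \<in> I\<close> to \<open>M\<^sub>x\<close>
  factors through \<open>M\<^sub>a\<close>.  Exactness of \<open>Hom(M\<^sub>w, -)\<close> on the rest of the sequence could then fail
  only at \<open>M\<^sub>b\<close>, and there a failure would imply \<open>a \<leadsto> \<tau>\<^sub>d(w)\<close>, so that the second condition would put
  a longer truncation into \<open>I\<close>.  This settles the modules \<open>M\<^sub>x\<close> (\<open>torsion_res_Mint\<close>).  The
  remaining modules are direct sums of these by Krull--Schmidt (\<open>madd_dsum\<close>), and sequences can
  be added (\<open>torsion_res_biprod\<close>).

  Conversely, let \<open>I\<close> give a torsion class.  For the first condition, it suffices to raise a single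
  coordinate of \<open>x \<in> I\<close>, giving \<open>z\<close>.  The map \<open>M\<^sub>x \<rightarrow> M\<^sub>z\<close> factors through the torsion part \<open>U \<rightarrow> M\<^sub>z\<close>,
  and the resulting map \<open>M\<^sub>x \<rightarrow> U\<close> factors through \<open>M\<^sub>x \<rightarrow> M\<^sub>z\<close>; so the identity of \<open>M\<^sub>z\<close> factors
  through \<open>U\<close>, which forces \<open>z \<in> I\<close> (\<open>raise_coordinate\<close>).  For the second condition, the first one
  reduces the claim to the tuple \<open>(x\<^sub>0, \<dots>, x\<^sub>d\<^sub>-\<^sub>1, z\<^sub>d)\<close>.  If it were not in \<open>I\<close>, then the torsion
  sequence of its module would contain the sequence \<open>M\<^sub>a \<rightarrow> \<dots> \<rightarrow> M\<^sub>b\<close> of a maximal truncation as a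
  retract, from the second term on (\<open>comparison_step\<close>); but \<open>M\<^sub>z \<rightarrow> M\<^sub>b\<close> does not lift to the term
  before \<open>M\<^sub>b\<close> (\<open>extension_last\<close>).
\<close>

section \<open>The category of modules as a preadditive category\<close>

lemma kscale_simps [simp]:
  "kscale 0 v = 0" "kscale c 0 = 0" "kscale 1 v = v" "kscale a (kscale b v) = kscale (a * b) v"
  by (simp_all add: kscale_def fun_eq_iff)

lemma
  assumes "M \<in> mod_A n d"
  shows mod_A_space: "\<forall>x\<in>tuples n d. kseq.subspace (sp M x) \<and> fin_dim (sp M x)"
    and mod_A_act: "\<forall>x\<in>tuples n d. \<forall>y\<in>tuples n d. \<forall>a\<in>lin_hom x y.
      act M x y a ` sp M y \<subseteq> sp M x \<and> linear_on (sp M y) (act M x y a)"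
    and mod_A_act_coeff: "\<forall>x\<in>tuples n d. \<forall>y\<in>tuples n d. \<forall>a\<in>lin_hom x y. \<forall>v\<in>sp M y.
      (\<forall>b\<in>lin_hom x y. act M x y (a + b) v = act M x y a v + act M x y b v) \<and>
      (\<forall>c. act M x y (c * a) v = kscale c (act M x y a v))"
    and mod_A_act_one: "\<forall>x\<in>tuples n d. \<forall>v\<in>sp M x. act M x x 1 v = v"
    and mod_A_act_mult: "\<forall>x\<in>tuples n d. \<forall>y\<in>tuples n d. \<forall>z\<in>tuples n d.
      \<forall>a\<in>lin_hom x y. \<forall>b\<in>lin_hom y z. \<forall>v\<in>sp M z. act M x z (a * b) v = act M x y a (act M y z b v)"
    and mod_A_act_ideal: "\<forall>x\<in>tuples n d. \<forall>y\<in>tuples n d. \<forall>a. idem_ideal n d x y a \<longrightarrow>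
      (\<forall>v\<in>sp M y. act M x y a v = 0)"
  using assms unfolding mod_A_def mem_Collect_eq by - ((elim conjE, assumption)+)

lemma mod_A_subspace: "M \<in> mod_A n d \<Longrightarrow> x \<in> tuples n d \<Longrightarrow> kseq.subspace (sp M x)"
  using mod_A_space by blast

lemma mod_A_fin_dim: "M \<in> mod_A n d \<Longrightarrow> x \<in> tuples n d \<Longrightarrow> fin_dim (sp M x)"
  using mod_A_space by blast

lemma mod_A_act_in:
  "M \<in> mod_A n d \<Longrightarrow> x \<in> tuples n d \<Longrightarrow> y \<in> tuples n d \<Longrightarrow> a \<in> lin_hom x y \<Longrightarrow> v \<in> sp M y
    \<Longrightarrow> act M x y a v \<in> sp M x"
  using mod_A_act by blast

lemma mod_A_act_linear:
  "M \<in> mod_A n d \<Longrightarrow> x \<in> tuples n d \<Longrightarrow> y \<in> tuples n d \<Longrightarrow> a \<in> lin_hom x y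
    \<Longrightarrow> linear_on (sp M y) (act M x y a)"
  using mod_A_act by blast

lemma mod_AI:
  fixes M :: "'k::field kmod"
  assumes "\<And>x. x \<in> tuples n d \<Longrightarrow> kseq.subspace (sp M x)"
    and "\<And>x. x \<in> tuples n d \<Longrightarrow> fin_dim (sp M x)"
    and "\<And>x y a v. x \<in> tuples n d \<Longrightarrow> y \<in> tuples n d \<Longrightarrow> a \<in> lin_hom x y \<Longrightarrow> v \<in> sp M y
      \<Longrightarrow> act M x y a v \<in> sp M x"
    and "\<And>x y a. x \<in> tuples n d \<Longrightarrow> y \<in> tuples n d \<Longrightarrow> a \<in> lin_hom x y
      \<Longrightarrow> linear_on (sp M y) (act M x y a)"
    and "\<And>x y a b v. x \<in> tuples n d \<Longrightarrow> y \<in> tuples n d \<Longrightarrow> a \<in> lin_hom x y \<Longrightarrow> b \<in> lin_hom x y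
      \<Longrightarrow> v \<in> sp M y \<Longrightarrow> act M x y (a + b) v = act M x y a v + act M x y b v"
    and "\<And>x y a c v. x \<in> tuples n d \<Longrightarrow> y \<in> tuples n d \<Longrightarrow> a \<in> lin_hom x y
      \<Longrightarrow> v \<in> sp M y \<Longrightarrow> act M x y (c * a) v = kscale c (act M x y a v)"
    and "\<And>x v. x \<in> tuples n d \<Longrightarrow> v \<in> sp M x \<Longrightarrow> act M x x 1 v = v"
    and "\<And>x y z a b v. x \<in> tuples n d \<Longrightarrow> y \<in> tuples n d \<Longrightarrow> z \<in> tuples n d \<Longrightarrow> a \<in> lin_hom x y
      \<Longrightarrow> b \<in> lin_hom y z \<Longrightarrow> v \<in> sp M z \<Longrightarrow> act M x z (a * b) v = act M x y a (act M y z b v)"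
    and "\<And>x y a v. x \<in> tuples n d \<Longrightarrow> y \<in> tuples n d \<Longrightarrow> idem_ideal n d x y a \<Longrightarrow> v \<in> sp M y
      \<Longrightarrow> act M x y a v = 0"
  shows "M \<in> mod_A n d"
  unfolding mod_A_def image_subset_iff
  by (rule CollectI, intro conjI ballI allI impI; (rule assms; assumption))

lemma mHom_sp: "f \<in> mHom n d M N \<Longrightarrow> x \<in> tuples n d \<Longrightarrow> v \<in> sp M x \<Longrightarrow> f x v \<in> sp N x"
  by (auto simp: mHom_def)

lemma mHom_linear: "f \<in> mHom n d M N \<Longrightarrow> x \<in> tuples n d \<Longrightarrow> linear_on (sp M x) (f x)"
  by (auto simp: mHom_def)

lemma mHom_natural:
  "f \<in> mHom n d M N \<Longrightarrow> x \<in> tuples n d \<Longrightarrow> y \<in> tuples n d \<Longrightarrow> a \<in> lin_hom x y \<Longrightarrow> v \<in> sp M y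
    \<Longrightarrow> f x (act M x y a v) = act N x y a (f y v)"
  by (auto simp: mHom_def)

lemma mHom_outside: "f \<in> mHom n d M N \<Longrightarrow> x \<notin> tuples n d \<or> v \<notin> sp M x \<Longrightarrow> f x v = 0"
  by (auto simp: mHom_def)

lemma mHom_apply_zero: assumes "f \<in> mHom n d M N" shows "f x 0 = 0"
proof (cases "x \<in> tuples n d \<and> 0 \<in> sp M x")
  case True
  then have "f x (kscale 0 0) = kscale 0 (f x 0)"
    using mHom_linear[OF assms] unfolding linear_on_def by blast
  then show ?thesis by simp
qed (use mHom_outside[OF assms] in blast)

lemma mHom_apply_add:
  "f \<in> mHom n d M N \<Longrightarrow> x \<in> tuples n d \<Longrightarrow> u \<in> sp M x \<Longrightarrow> v \<in> sp M x \<Longrightarrow> f x (u + v) = f x u + f x v"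
  using mHom_linear unfolding linear_on_def by blast

lemma mHom_apply_scale:
  "f \<in> mHom n d M N \<Longrightarrow> x \<in> tuples n d \<Longrightarrow> v \<in> sp M x \<Longrightarrow> f x (kscale c v) = kscale c (f x v)"
  using mHom_linear unfolding linear_on_def by blast

lemma mHomI:
  assumes "\<And>x v. x \<in> tuples n d \<Longrightarrow> v \<in> sp M x \<Longrightarrow> f x v \<in> sp N x"
    and "\<And>x u v. x \<in> tuples n d \<Longrightarrow> u \<in> sp M x \<Longrightarrow> v \<in> sp M x \<Longrightarrow> f x (u + v) = f x u + f x v"
    and "\<And>x c v. x \<in> tuples n d \<Longrightarrow> v \<in> sp M x \<Longrightarrow> f x (kscale c v) = kscale c (f x v)"
    and "\<And>x y a v. x \<in> tuples n d \<Longrightarrow> y \<in> tuples n d \<Longrightarrow> a \<in> lin_hom x y \<Longrightarrow> v \<in> sp M y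
      \<Longrightarrow> f x (act M x y a v) = act N x y a (f y v)"
    and "\<And>x v. x \<notin> tuples n d \<or> v \<notin> sp M x \<Longrightarrow> f x v = 0"
  shows "f \<in> mHom n d M N"
  using assms unfolding mHom_def linear_on_def by auto

lemma mcomp_in:
  assumes f: "f \<in> mHom n d M N" and g: "g \<in> mHom n d N P"
  shows "g \<odot> f \<in> mHom n d M P"
  by (rule mHomI)
    (auto simp: mcomp_def mHom_sp[OF f] mHom_sp[OF g] mHom_apply_add[OF f] mHom_apply_add[OF g]
      mHom_apply_scale[OF f] mHom_apply_scale[OF g] mHom_natural[OF f] mHom_natural[OF g]
      mHom_outside[OF f] mHom_outside[OF g] mHom_apply_zero[OF g])

lemma linear_on_zero: "linear_on V f \<Longrightarrow> 0 \<in> V \<Longrightarrow> f 0 = 0"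
  unfolding linear_on_def by (metis kscale_simps(1))

lemma mHom_zero: assumes N: "(N :: 'k::field kmod) \<in> mod_A n d" shows "0 \<in> mHom n d M N"
proof (rule mHomI)
  fix x y v and a :: 'k assume "x \<in> tuples n d" "y \<in> tuples n d" "a \<in> lin_hom x y"
  then have "act N x y a 0 = 0"
    by (meson N linear_on_zero mod_A_act_linear mod_A_subspace kseq.subspace_0)
  then show "0 x (act M x y a v) = act N x y a (0 y v)" by simp
qed (auto simp: kseq.subspace_0 mod_A_subspace[OF N])

lemma mHom_add:
  fixes f g :: "'k::field mor"
  assumes N: "N \<in> mod_A n d" and f: "f \<in> mHom n d M N" and g: "g \<in> mHom n d M N"
  shows "f + g \<in> mHom n d M N"
proof (rule mHomI)
  fix x y v and a :: 'k assume x: "x \<in> tuples n d" "y \<in> tuples n d" "a \<in> lin_hom x y" "v \<in> sp M y"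
  then have "act N x y a (f y v + g y v) = act N x y a (f y v) + act N x y a (g y v)"
    using mod_A_act_linear[OF N x(1-3)] mHom_sp[OF f x(2,4)] mHom_sp[OF g x(2,4)]
    unfolding linear_on_def by blast
  with x show "(f + g) x (act M x y a v) = act N x y a ((f + g) y v)"
    by (simp add: mHom_natural[OF f] mHom_natural[OF g])
qed (auto simp: mHom_sp[OF f] mHom_sp[OF g] mHom_apply_add[OF f] mHom_apply_add[OF g]
      mHom_apply_scale[OF f] mHom_apply_scale[OF g] kseq.scale_right_distrib
      mHom_outside[OF f] mHom_outside[OF g] kseq.subspace_add mod_A_subspace[OF N])

definition mscale :: "'k::field \<Rightarrow> 'k mor \<Rightarrow> 'k mor" where
  "mscale c f = (\<lambda>x v. kscale c (f x v))"

lemma mHom_scale: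
  fixes f :: "'k::field mor"
  assumes N: "N \<in> mod_A n d" and f: "f \<in> mHom n d M N"
  shows "mscale c f \<in> mHom n d M N"
proof (rule mHomI)
  fix x y v and a :: 'k assume x: "x \<in> tuples n d" "y \<in> tuples n d" "a \<in> lin_hom x y" "v \<in> sp M y"
  then have "act N x y a (kscale c (f y v)) = kscale c (act N x y a (f y v))"
    using mod_A_act_linear[OF N x(1-3)] mHom_sp[OF f x(2,4)]
    unfolding linear_on_def by blast
  with x show "mscale c f x (act M x y a v) = act N x y a (mscale c f y v)"
    by (simp add: mscale_def mHom_natural[OF f])
qed (auto simp: mscale_def mHom_sp[OF f] mHom_apply_add[OF f] mHom_apply_scale[OF f]
      kseq.scale_right_distrib mHom_outside[OF f] kseq.subspace_scale mod_A_subspace[OF N] mult.commute)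

lemma mscale_minus_one: "mscale (- 1) f = - f"
  by (simp add: mscale_def kscale_def fun_eq_iff)

lemma mHom_diff:
  assumes "N \<in> mod_A n d" "f \<in> mHom n d M N" "g \<in> mHom n d M N"
  shows "f - g \<in> mHom n d M N"
  using mHom_add[OF assms(1,2) mHom_scale[OF assms(1,3), of "- 1"]]
  by (simp add: mscale_minus_one)

lemma mid_in: "M \<in> mod_A n d \<Longrightarrow> mid n d M \<in> mHom n d M M"
  by (rule mHomI)
    (auto simp: mid_def mod_A_act_in kseq.subspace_add kseq.subspace_scale mod_A_subspace)

lemma mcomp_assoc [simp]: "(h \<odot> g) \<odot> f = h \<odot> (g \<odot> f)"
  by (simp add: mcomp_def)

lemma mcomp_left [simp]:
  "(g + g') \<odot> f = g \<odot> f + g' \<odot> f" "(g - g') \<odot> f = g \<odot> f - g' \<odot> f" "0 \<odot> f = 0"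
  "mscale c g \<odot> f = mscale c (g \<odot> f)" "(- g) \<odot> f = - (g \<odot> f)"
  by (simp_all add: mcomp_def mscale_def fun_eq_iff)

lemma mscale_simps [simp]:
  "mscale c (f + g) = mscale c f + mscale c g" "mscale c (f - g) = mscale c f - mscale c g"
  "mscale c (- f) = - mscale c f"
  "mscale 0 f = 0" "mscale c 0 = 0" "mscale 1 f = f" "mscale a (mscale b f) = mscale (a * b) f"
  by (simp_all add: mscale_def kscale_def fun_eq_iff algebra_simps)

text \<open>
  Composition on the left is additive only on morphisms that take values in the right module.
  Having this as a condition that mentions neither source makes distributivity usable as
  rewriting: all side conditions of the rules below concern a single, already known module.
\<close>

definition lands :: "nat \<Rightarrow> nat \<Rightarrow> 'k::field kmod \<Rightarrow> 'k mor \<Rightarrow> bool" where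
  "lands n d N f \<longleftrightarrow> (\<forall>x v. if x \<in> tuples n d then f x v \<in> sp N x else f x v = 0)"

lemma lands_mHom:
  assumes "N \<in> mod_A n d" "f \<in> mHom n d M N" shows "lands n d N f"
  using mHom_sp[OF assms(2)] mHom_outside[OF assms(2)] kseq.subspace_0[OF mod_A_subspace[OF assms(1)]]
  unfolding lands_def by metis

lemma lands_comp: "lands n d N f \<Longrightarrow> lands n d N (f \<odot> h)"
  by (auto simp: lands_def mcomp_def)

lemma lands_closed:
  assumes "N \<in> mod_A n d"
  shows "lands n d N 0"
    and "lands n d N f \<Longrightarrow> lands n d N g \<Longrightarrow> lands n d N (f + g)"
    and "lands n d N f \<Longrightarrow> lands n d N g \<Longrightarrow> lands n d N (f - g)"
    and "lands n d N f \<Longrightarrow> lands n d N (mscale c f)"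
    and "lands n d N f \<Longrightarrow> lands n d N (- f)"
    and "lands n d N (mid n d N)"
  using mod_A_subspace[OF assms]
  by (auto simp: lands_def mscale_def mid_def kseq.subspace_0 kseq.subspace_add kseq.subspace_diff kseq.subspace_neg
      kseq.subspace_scale)

lemma mcomp_right_zero: "g \<in> mHom n d N P \<Longrightarrow> g \<odot> 0 = 0"
  by (simp add: mcomp_def fun_eq_iff mHom_apply_zero)

lemma mcomp_right_add:
  assumes "g \<in> mHom n d N P" "lands n d N f" "lands n d N h"
  shows "g \<odot> (f + h) = g \<odot> f + g \<odot> h"
proof (rule ext, rule ext)
  fix x v show "(g \<odot> (f + h)) x v = (g \<odot> f + g \<odot> h) x v"
    using assms(2,3) mHom_apply_add[OF assms(1), of x] mHom_outside[OF assms(1), of x]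
    by (cases "x \<in> tuples n d") (auto simp: mcomp_def lands_def)
qed

lemma mcomp_right_scale:
  assumes "g \<in> mHom n d N P" "lands n d N f"
  shows "g \<odot> mscale c f = mscale c (g \<odot> f)"
proof (rule ext, rule ext)
  fix x v show "(g \<odot> mscale c f) x v = mscale c (g \<odot> f) x v"
    using assms(2) mHom_apply_scale[OF assms(1), of x] mHom_outside[OF assms(1), of x]
    by (cases "x \<in> tuples n d") (auto simp: mcomp_def lands_def mscale_def)
qed

lemma mcomp_right_diff:
  assumes "N \<in> mod_A n d" "g \<in> mHom n d N P" "lands n d N f" "lands n d N h"
  shows "g \<odot> (f - h) = g \<odot> f - g \<odot> h"
  using mcomp_right_add[OF assms(2,3) lands_closed(4)[OF assms(1,4), of "- 1"]]
    mcomp_right_scale[OF assms(2,4), of "- 1"]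
  by (simp add: mscale_minus_one)

lemma mid_left: "lands n d N f \<Longrightarrow> mid n d N \<odot> f = f"
  by (auto simp: lands_def mcomp_def mid_def fun_eq_iff)

lemma mid_right: "f \<in> mHom n d M N \<Longrightarrow> f \<odot> mid n d M = f"
  using mHom_outside[of f n d M N]
  by (auto simp: mcomp_def mid_def fun_eq_iff mHom_apply_zero)

text \<open>
  Composites are kept bracketed to the right, so an equation for a composite of two maps has a
  second form that applies in the middle of a longer composite.
\<close>

lemma mcomp_nest: "g \<odot> f = e \<Longrightarrow> g \<odot> (f \<odot> h) = e \<odot> h"
  by (simp flip: mcomp_assoc)

section \<open>Splitting idempotents\<close>

lemma fin_dim_subspace:
  assumes "fin_dim V" "kseq.subspace W" "W \<subseteq> V" shows "fin_dim W"
proof -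
  obtain B where B: "finite B" "V = kseq.span B" using assms(1) by (auto simp: fin_dim_def)
  obtain C where C: "C \<subseteq> W" "kseq.independent C" "W \<subseteq> kseq.span C"
    by (rule kseq.basis_exists[of W])
  have "C \<subseteq> kseq.span B" using C(1) assms(3) B(2) by auto
  then have "finite C" using kseq.independent_span_bound[OF B(1) C(2)] by simp
  moreover have "W = kseq.span C"
    using C(3) kseq.span_minimal[OF C(1) assms(2)] by auto
  ultimately show ?thesis by (auto simp: fin_dim_def)
qed

lemma mod_A_restrict:
  fixes M :: "'k::field kmod"
  assumes M: "M \<in> mod_A n d"
    and sub: "\<And>x. x \<in> tuples n d \<Longrightarrow> kseq.subspace (V x) \<and> V x \<subseteq> sp M x"
    and stable: "\<And>x y a v. x \<in> tuples n d \<Longrightarrow> y \<in> tuples n d \<Longrightarrow> a \<in> lin_hom x y \<Longrightarrow> v \<in> V y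
      \<Longrightarrow> act M x y a v \<in> V x"
  shows "\<lparr>sp = V, act = act M\<rparr> \<in> mod_A n d"
proof -
  note sub' = conjunct2[OF sub, THEN subsetD]
  have fin: "fin_dim (V x)" if "x \<in> tuples n d" for x
    using fin_dim_subspace mod_A_fin_dim[OF M that] sub[OF that] by blast
  have lin: "linear_on (V y) (act M x y a)"
    if "x \<in> tuples n d" "y \<in> tuples n d" "a \<in> lin_hom x y" for x y a
    using mod_A_act_linear[OF M that] sub[OF that(2)] unfolding linear_on_def by blast
  show ?thesis
    by (rule mod_AI; unfold kmod.simps) (use sub fin stable lin in blast,
      use sub fin stable lin in blast, use sub fin stable lin in blast, use sub fin stable lin in blast,
      use mod_A_act_coeff[OF M] sub' in blast, use mod_A_act_coeff[OF M] sub' in blast,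
      use mod_A_act_one[OF M] sub' in blast, use mod_A_act_mult[OF M] sub' in blast,
      use mod_A_act_ideal[OF M] sub' in blast)
qed

text \<open>
  The image of an idempotent consists of its fixed points, and these form a submodule.
\<close>

lemma idempotent_splits:
  assumes X: "X \<in> mod_A n d" and e: "e \<in> mHom n d X X" and ee: "e \<odot> e = e"
  shows "\<exists>K\<in>mod_A n d. \<exists>i\<in>mHom n d K X. \<exists>p\<in>mHom n d X K. p \<odot> i = mid n d K \<and> i \<odot> p = e"
proof -
  define K where "K = \<lparr>sp = (\<lambda>x. {v \<in> sp X x. e x v = v}), act = act X\<rparr>"
  define i where "i = (\<lambda>x v. if x \<in> tuples n d \<and> v \<in> sp K x then v else 0)"
  have ee': "e x (e x v) = e x v" for x v using ee by (simp add: mcomp_def fun_eq_iff)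
  have K: "K \<in> mod_A n d" unfolding K_def
  proof (rule mod_A_restrict[OF X])
    fix x assume x: "x \<in> tuples n d"
    show "kseq.subspace {v \<in> sp X x. e x v = v} \<and> {v \<in> sp X x. e x v = v} \<subseteq> sp X x"
      using mod_A_subspace[OF X x] x mHom_apply_zero[OF e]
      by (auto simp: kseq.subspace_def mHom_apply_add[OF e] mHom_apply_scale[OF e])
  qed (auto simp: mod_A_act_in[OF X] mHom_natural[OF e])
  have i: "i \<in> mHom n d K X"
    by (rule mHomI) (auto simp: i_def K_def mHom_apply_add[OF e] mHom_apply_scale[OF e]
        mod_A_act_in[OF X] mHom_natural[OF e] kseq.subspace_add[OF mod_A_subspace[OF X]]
        kseq.subspace_scale[OF mod_A_subspace[OF X]])
  have p: "e \<in> mHom n d X K"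
    by (rule mHomI) (auto simp: K_def mHom_sp[OF e] ee' mHom_apply_add[OF e] mHom_apply_scale[OF e]
        mHom_natural[OF e] mHom_outside[OF e])
  have "e \<odot> i = mid n d K"
    by (rule ext, rule ext) (simp add: mcomp_def mid_def i_def K_def mHom_apply_zero[OF e])
  moreover have "i \<odot> e = e"
  proof (rule ext, rule ext)
    fix x v show "(i \<odot> e) x v = e x v"
      using mHom_sp[OF e, of x v] mHom_outside[OF e, of x v] ee'[of x v]
      by (cases "x \<in> tuples n d \<and> v \<in> sp X x") (auto simp: mcomp_def i_def K_def)
  qed
  ultimately show ?thesis using K i p by blast
qed

text \<open>
  Instantiated with the morphisms at hand, these rules let the simplifier decide identities
  between sums of composites.  Stating them for one morphism between known modules is
  necessary, since the modules cannot be recovered from a term like \<open>g \<odot> (f + h)\<close>.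
\<close>

lemma arrow:
  assumes M: "M \<in> mod_A n d" and N: "N \<in> mod_A n d" and g: "g \<in> mHom n d M N"
  shows "lands n d N g" and "lands n d N (g \<odot> h)" and "g \<odot> 0 = 0"
    and "lands n d M f \<Longrightarrow> lands n d M f' \<Longrightarrow> g \<odot> (f + f') = g \<odot> f + g \<odot> f'"
    and "lands n d M f \<Longrightarrow> lands n d M f' \<Longrightarrow> g \<odot> (f - f') = g \<odot> f - g \<odot> f'"
    and "lands n d M f \<Longrightarrow> g \<odot> mscale c f = mscale c (g \<odot> f)"
    and "lands n d M f \<Longrightarrow> g \<odot> (- f) = - (g \<odot> f)"
    and "g \<odot> mid n d M = g" and "mid n d N \<odot> g = g" and "mid n d N \<odot> (g \<odot> h) = g \<odot> h"
    and "g \<odot> (mid n d M \<odot> h) = g \<odot> h"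
proof -
  show *: "lands n d N g" using lands_mHom[OF N g] .
  then show "lands n d N (g \<odot> h)" "mid n d N \<odot> g = g" "mid n d N \<odot> (g \<odot> h) = g \<odot> h"
    by (auto simp: lands_comp mid_left)
  show "g \<odot> mid n d M = g" using mid_right[OF g] .
  then show "g \<odot> (mid n d M \<odot> h) = g \<odot> h" by (rule mcomp_nest)
qed (simp_all add: mcomp_right_zero[OF g] mcomp_right_add[OF g] mcomp_right_scale[OF g]
    mcomp_right_diff[OF M g] mcomp_right_scale[OF g, of _ "- 1", unfolded mscale_minus_one])

section \<open>Biproducts and retracts\<close>

definition biprod ::
  "nat \<Rightarrow> nat \<Rightarrow> 'k::field kmod \<Rightarrow> 'k kmod \<Rightarrow> 'k kmod \<Rightarrow> 'k mor \<Rightarrow> 'k mor \<Rightarrow> 'k mor \<Rightarrow> 'k mor \<Rightarrow> bool"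
  where "biprod n d Z X Y i j p q \<longleftrightarrow>
    i \<in> mHom n d X Z \<and> j \<in> mHom n d Y Z \<and> p \<in> mHom n d Z X \<and> q \<in> mHom n d Z Y \<and>
    p \<odot> i = mid n d X \<and> q \<odot> j = mid n d Y \<and> p \<odot> j = 0 \<and> q \<odot> i = 0 \<and> i \<odot> p + j \<odot> q = mid n d Z"

lemma mbiproduct_iff: "mbiproduct n d Z X Y \<longleftrightarrow> (\<exists>i j p q. biprod n d Z X Y i j p q)"
  by (auto simp: mbiproduct_def biprod_def)

lemma biprod_swap: "biprod n d Z X Y i j p q \<Longrightarrow> biprod n d Z Y X j i q p"
  by (auto simp: biprod_def add.commute)

lemma mbiproduct_swap: "mbiproduct n d Z X Y \<Longrightarrow> mbiproduct n d Z Y X"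
  unfolding mbiproduct_iff by (meson biprod_swap)

text \<open>
  The relation \<open>i \<odot> p + j \<odot> q = 1\<close> is oriented so as to eliminate \<open>j \<odot> q\<close>.
\<close>

lemma biprod_simps:
  assumes "biprod n d Z X Y i j p q" and "X \<in> mod_A n d" "Y \<in> mod_A n d" "Z \<in> mod_A n d"
  shows "p \<odot> i = mid n d X" "q \<odot> j = mid n d Y" "p \<odot> j = 0" "q \<odot> i = 0"
    "p \<odot> (i \<odot> h) = mid n d X \<odot> h" "q \<odot> (j \<odot> h) = mid n d Y \<odot> h" "p \<odot> (j \<odot> h) = 0" "q \<odot> (i \<odot> h) = 0"
    "j \<odot> q = mid n d Z - i \<odot> p" "j \<odot> (q \<odot> h) = mid n d Z \<odot> h - i \<odot> (p \<odot> h)"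
proof -
  show *: "p \<odot> i = mid n d X" "q \<odot> j = mid n d Y" "p \<odot> j = 0" "q \<odot> i = 0" 
    using assms by (auto simp: biprod_def)
  show "p \<odot> (i \<odot> h) = mid n d X \<odot> h" "q \<odot> (j \<odot> h) = mid n d Y \<odot> h" "p \<odot> (j \<odot> h) = 0" "q \<odot> (i \<odot> h) = 0"
    using *[THEN mcomp_nest] by auto
  show **: "j \<odot> q = mid n d Z - i \<odot> p" 
    using assms(1) by (auto simp: biprod_def algebra_simps)
  show "j \<odot> (q \<odot> h) = mid n d Z \<odot> h - i \<odot> (p \<odot> h)" 
    using mcomp_nest[OF **] by simp
qed

lemma biprod_arrows:
  assumes "biprod n d Z X Y i j p q"
  shows "i \<in> mHom n d X Z" "j \<in> mHom n d Y Z" "p \<in> mHom n d Z X" "q \<in> mHom n d Z Y"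
  using assms by (auto simp: biprod_def)

text \<open>
  The complement is the image of the idempotent \<open>1 - a \<odot> b\<close>.
\<close>

lemma retract_complement:
  assumes M: "M \<in> mod_A n d" and X: "X \<in> mod_A n d"
    and a: "a \<in> mHom n d M X" and b: "b \<in> mHom n d X M" and ba: "b \<odot> a = mid n d M"
  shows "\<exists>K\<in>mod_A n d. \<exists>k r. biprod n d X M K a k b r"
proof -
  define e where "e = mid n d X - a \<odot> b"
  note S = arrow[OF M X a] arrow[OF X M b] ba mcomp_nest[OF ba] lands_closed[OF X] lands_closed[OF M]
    arrow[OF X X mid_in[OF X]]
  have e: "e \<in> mHom n d X X" unfolding e_def
    using mHom_diff mid_in mcomp_in a b X by blast
  have "e \<odot> e = e" by (simp add: e_def S)
  then obtain K k r where K: "K \<in> mod_A n d" and k: "k \<in> mHom n d K X" and r: "r \<in> mHom n d X K"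
    and rk: "r \<odot> k = mid n d K" and kr: "k \<odot> r = e"
    using idempotent_splits[OF X e] by blast
  note S = S arrow[OF K X k] arrow[OF X K r] lands_closed[OF K]
  have "b \<odot> k = b \<odot> (k \<odot> (r \<odot> k))" by (simp add: S rk)
  also have "\<dots> = 0" by (simp add: mcomp_nest[OF kr] e_def S)
  finally have bk: "b \<odot> k = 0" .
  have "r \<odot> a = r \<odot> (k \<odot> (r \<odot> a))" by (simp add: S mcomp_nest[OF rk])
  also have "\<dots> = 0" by (simp add: mcomp_nest[OF kr] e_def S)
  finally have ra: "r \<odot> a = 0" .
  have "biprod n d X M K a k b r"
    using a b k r ba rk bk ra kr by (simp add: biprod_def e_def)
  then show ?thesis using K by blast
qed

text \<open>
  The complement \<open>K\<close> of \<open>M\<close> in \<open>Z\<close> exists because \<open>M\<close> is a retract of \<open>Z\<close>, and the structure maps of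
  \<open>X'\<close> and \<open>Y\<close>, composed with those of \<open>K\<close>, make it their direct sum.  The maps belonging to \<open>M\<close> are
  kept explicit because \<open>exchange\<close> compares them with another decomposition of \<open>Z\<close>.
\<close>

lemma biprod_assoc:
  assumes Z: "biprod n d Z X Y i j p q" and X: "biprod n d X M X' a i' b p'"
    and obj: "Z \<in> mod_A n d" "X \<in> mod_A n d" "Y \<in> mod_A n d" "M \<in> mod_A n d" "X' \<in> mod_A n d"
  shows "\<exists>K\<in>mod_A n d. \<exists>k r. biprod n d Z M K (i \<odot> a) k (b \<odot> p) r \<and> mbiproduct n d K X' Y"
proof -
  note arrows = biprod_arrows[OF Z] biprod_arrows[OF X]
  note S = arrow[OF obj(2,1) arrows(1)] arrow[OF obj(3,1) arrows(2)] arrow[OF obj(1,2) arrows(3)]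
    arrow[OF obj(1,3) arrows(4)] arrow[OF obj(4,2) arrows(5)] arrow[OF obj(5,2) arrows(6)]
    arrow[OF obj(2,4) arrows(7)] arrow[OF obj(2,5) arrows(8)] obj[THEN lands_closed(1)]
    lands_closed[OF obj(1)] lands_closed[OF obj(2)] lands_closed[OF obj(3)] lands_closed[OF obj(4)]
    lands_closed[OF obj(5)] biprod_simps[OF Z obj(2,3,1)] biprod_simps[OF X obj(4,5,2)]
  have "(b \<odot> p) \<odot> (i \<odot> a) = mid n d M" by (simp add: S)
  then obtain K k r where K: "K \<in> mod_A n d" and bip: "biprod n d Z M K (i \<odot> a) k (b \<odot> p) r"
    using retract_complement[OF obj(4,1) mcomp_in[OF arrows(5,1)] mcomp_in[OF arrows(3,7)]] by blast
  note karr = biprod_arrows(2,4)[OF bip]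
  have kr: "k \<odot> (r \<odot> h) = mid n d Z \<odot> h - i \<odot> (a \<odot> (b \<odot> (p \<odot> h)))" for h
    using biprod_simps(10)[OF bip obj(4) K obj(1)] by simp
  note S = S kr arrow[OF K obj(1) karr(1)] arrow[OF obj(1) K karr(2)] lands_closed[OF K]
  have rk: "r \<odot> k = mid n d K" using bip by (simp add: biprod_def)
  have ria: "r \<odot> (i \<odot> (a \<odot> h)) = 0" for h
    using biprod_simps(8)[OF bip obj(4) K obj(1)] by simp
  have "biprod n d K X' Y (r \<odot> (i \<odot> i')) (r \<odot> j) (p' \<odot> (p \<odot> k)) (q \<odot> k)"
    unfolding biprod_def
  proof (intro conjI)
    show "r \<odot> (i \<odot> i') \<in> mHom n d X' K" by (rule mcomp_in[OF mcomp_in[OF arrows(6,1)] karr(2)])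
    show "r \<odot> j \<in> mHom n d Y K" by (rule mcomp_in[OF arrows(2) karr(2)])
    show "p' \<odot> (p \<odot> k) \<in> mHom n d K X'" by (rule mcomp_in[OF mcomp_in[OF karr(1) arrows(3)] arrows(8)])
    show "q \<odot> k \<in> mHom n d K Y" by (rule mcomp_in[OF karr(1) arrows(4)])
    have "r \<odot> (i \<odot> (i' \<odot> (p' \<odot> (p \<odot> k)))) + r \<odot> (j \<odot> (q \<odot> k)) = r \<odot> k"
      by (simp add: S ria)
    then show "(r \<odot> (i \<odot> i')) \<odot> (p' \<odot> (p \<odot> k)) + (r \<odot> j) \<odot> (q \<odot> k) = mid n d K" by (simp add: rk)
  qed (simp_all add: S)
  then have "mbiproduct n d K X' Y" unfolding mbiproduct_iff by blast
  then show ?thesis using K bip by blast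
qed

text \<open>
  Isomorphic copies and direct summands are both retracts; closure under retracts therefore
  covers two of the closure properties of a subcategory.
\<close>

definition retract :: "nat \<Rightarrow> nat \<Rightarrow> 'k::field kmod \<Rightarrow> 'k kmod \<Rightarrow> bool" where
  "retract n d X Z \<longleftrightarrow> (\<exists>i\<in>mHom n d X Z. \<exists>p\<in>mHom n d Z X. p \<odot> i = mid n d X)"

lemma miso_sym: "miso n d M N \<Longrightarrow> miso n d N M"
  by (auto simp: miso_def)

lemma miso_retract: "miso n d M N \<Longrightarrow> retract n d M N"
  by (auto simp: miso_def retract_def)

lemma mbiproduct_retract: "mbiproduct n d Z X Y \<Longrightarrow> retract n d X Z"
  by (auto simp: mbiproduct_iff biprod_def retract_def)

lemma mbiproduct_iso:
  assumes "biprod n d B X Y i j p q" "f \<in> mHom n d B Z" "g \<in> mHom n d Z B"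
    and gf: "g \<odot> f = mid n d B" and fg: "f \<odot> g = mid n d Z"
    and obj: "X \<in> mod_A n d" "Y \<in> mod_A n d" "B \<in> mod_A n d" "Z \<in> mod_A n d"
  shows "mbiproduct n d Z X Y"
proof -
  note arrows = biprod_arrows[OF assms(1)]
  note S = arrow[OF obj(1,3) arrows(1)] arrow[OF obj(2,3) arrows(2)] arrow[OF obj(3,1) arrows(3)]
    arrow[OF obj(3,2) arrows(4)] arrow[OF obj(3,4) assms(2)] arrow[OF obj(4,3) assms(3)]
    biprod_simps[OF assms(1) obj(1-3)] gf fg gf[THEN mcomp_nest] fg[THEN mcomp_nest]
    lands_closed[OF obj(3)] lands_closed[OF obj(4)]
  have "biprod n d Z X Y (f \<odot> i) (f \<odot> j) (p \<odot> g) (q \<odot> g)"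
    using mcomp_in[OF arrows(1) assms(2)] mcomp_in[OF arrows(2) assms(2)]
      mcomp_in[OF assms(3) arrows(3)] mcomp_in[OF assms(3) arrows(4)]
    by (simp add: biprod_def S)
  then show ?thesis by (auto simp: mbiproduct_iff)
qed

text \<open>
  Both \<open>A\<close> and \<open>B\<close> are complements of copies of \<open>M\<close> in \<open>Z\<close>, but of different copies.  The map \<open>A \<rightarrow> B\<close>
  is the obvious one; for its inverse, \<open>B\<close> has to be moved into the kernel of \<open>p\<close> first, by
  subtracting a multiple of its component along \<open>k\<close>.  This is where \<open>c \<noteq> 0\<close> enters.
\<close>

lemma biprod_cancel:
  assumes A: "biprod n d Z M A i iA p pA" and B: "biprod n d Z M B k kB r rB"
    and c: "c \<noteq> 0" "p \<odot> k = mscale c (mid n d M)"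
    and obj: "Z \<in> mod_A n d" "M \<in> mod_A n d" "A \<in> mod_A n d" "B \<in> mod_A n d"
  shows "\<exists>f\<in>mHom n d A B. \<exists>g\<in>mHom n d B A. g \<odot> f = mid n d A \<and> f \<odot> g = mid n d B"
proof -
  note arrows = biprod_arrows[OF A] biprod_arrows[OF B]
  define g where "g = pA \<odot> (kB - mscale (inverse c) (k \<odot> (p \<odot> kB)))"
  note S = arrow[OF obj(2,1) arrows(1)] arrow[OF obj(3,1) arrows(2)] arrow[OF obj(1,2) arrows(3)]
    arrow[OF obj(1,3) arrows(4)] arrow[OF obj(2,1) arrows(5)] arrow[OF obj(4,1) arrows(6)]
    arrow[OF obj(1,2) arrows(7)] arrow[OF obj(1,4) arrows(8)] lands_closed[OF obj(1)]
    lands_closed[OF obj(2)] lands_closed[OF obj(3)] lands_closed[OF obj(4)]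
    biprod_simps[OF A obj(2,3,1)] biprod_simps[OF B obj(2,4,1)] c(2) mcomp_nest[OF c(2)] c(1)
  have "rB \<odot> iA \<in> mHom n d A B" "g \<in> mHom n d B A"
    unfolding g_def using arrows obj by (blast intro: mcomp_in mHom_diff mHom_scale)+
  moreover have "g \<odot> (rB \<odot> iA) = mid n d A" by (simp add: g_def S)
  moreover have "(rB \<odot> iA) \<odot> g = mid n d B" by (simp add: g_def S)
  ultimately show ?thesis by blast
qed

section \<open>Additive closures\<close>

lemma mzero_iff: "M \<in> mod_A n d \<Longrightarrow> mzero n d M \<longleftrightarrow> mid n d M = 0"
proof
  assume M: "M \<in> mod_A n d" and mid: "mid n d M = 0"
  have "v = 0" if "x \<in> tuples n d" "v \<in> sp M x" for x v
    using fun_cong[OF fun_cong[OF mid, of x], of v] that by (simp add: mid_def)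
  then show "mzero n d M"
    using kseq.subspace_0[OF mod_A_subspace[OF M]] by (auto simp: mzero_def)
qed (rule ext, rule ext, auto simp add: mid_def mzero_def)

lemma mzero_mHom:
  assumes "mzero n d M" "M \<in> mod_A n d" "N \<in> mod_A n d"
  shows "f \<in> mHom n d M N \<Longrightarrow> f = 0" and "f \<in> mHom n d N M \<Longrightarrow> f = 0"
  using arrow(3,8)[OF assms(2,3), of f] arrow(9)[OF assms(3,2), of f] assms(1)
  by (auto simp: mzero_iff[OF assms(2)])

lemma mzero_retract:
  assumes "mzero n d Z" "Z \<in> mod_A n d" "X \<in> mod_A n d" "retract n d X Z"
  shows "mzero n d X"
proof -
  obtain i p where i: "i \<in> mHom n d X Z" and p: "p \<in> mHom n d Z X" and pi: "p \<odot> i = mid n d X"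
    using assms(4) by (auto simp: retract_def)
  have "p = 0" using mzero_mHom(1)[OF assms(1-3) p] .
  then show ?thesis using pi by (simp add: mzero_iff[OF assms(3)])
qed

lemma subcatI:
  assumes zero: "\<And>Z. Z \<in> mod_A n d \<Longrightarrow> mzero n d Z \<Longrightarrow> P Z"
    and retract: "\<And>X Z. X \<in> mod_A n d \<Longrightarrow> Z \<in> mod_A n d \<Longrightarrow> retract n d X Z \<Longrightarrow> P Z \<Longrightarrow> P X"
    and sum: "\<And>X Y Z i j p q. X \<in> mod_A n d \<Longrightarrow> Y \<in> mod_A n d \<Longrightarrow> Z \<in> mod_A n d
      \<Longrightarrow> biprod n d Z X Y i j p q \<Longrightarrow> P X \<Longrightarrow> P Y \<Longrightarrow> P Z"
  shows "subcat n d {M \<in> mod_A n d. P M}"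
  unfolding subcat_def
proof (intro conjI ballI impI)
  fix M N assume "M \<in> {M \<in> mod_A n d. P M}" "N \<in> mod_A n d" "miso n d M N"
  then show "N \<in> {M \<in> mod_A n d. P M}" using retract miso_retract miso_sym by blast
next
  fix Z X Y assume "Z \<in> {M \<in> mod_A n d. P M}" "X \<in> mod_A n d" "mbiproduct n d Z X Y"
  then show "X \<in> {M \<in> mod_A n d. P M}" using retract mbiproduct_retract by blast
next
  fix X Y Z assume "X \<in> {M \<in> mod_A n d. P M}" "Y \<in> {M \<in> mod_A n d. P M}" "Z \<in> mod_A n d"
    "mbiproduct n d Z X Y"
  then show "Z \<in> {M \<in> mod_A n d. P M}" using sum unfolding mbiproduct_iff by blast
qed (use zero in auto)

lemma subcat_sum:
  "subcat n d C \<Longrightarrow> X \<in> C \<Longrightarrow> Y \<in> C \<Longrightarrow> Z \<in> mod_A n d \<Longrightarrow> mbiproduct n d Z X Y \<Longrightarrow> Z \<in> C"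
  unfolding subcat_def by (elim conjE) blast

lemma subcat_zero: "subcat n d C \<Longrightarrow> Z \<in> mod_A n d \<Longrightarrow> mzero n d Z \<Longrightarrow> Z \<in> C"
  unfolding subcat_def by (elim conjE) blast

lemma subcat_mod_A: "subcat n d C \<Longrightarrow> Z \<in> C \<Longrightarrow> Z \<in> mod_A n d"
  unfolding subcat_def by (elim conjE) blast

lemma madd_superset: "S \<subseteq> madd n d S"
  by (auto simp: madd_def)

lemma madd_least: "subcat n d C \<Longrightarrow> S \<subseteq> C \<Longrightarrow> madd n d S \<subseteq> C"
  by (auto simp: madd_def)

lemma madd_mono: "S \<subseteq> T \<Longrightarrow> madd n d S \<subseteq> madd n d T"
  unfolding madd_def by blast

lemma subcat_madd: assumes "(S :: 'k::field kmod set) \<subseteq> mod_A n d" shows "subcat n d (madd n d S)"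
proof -
  have all: "subcat n d (mod_A n d)" by (auto simp: subcat_def)
  have sub: "madd n d S \<subseteq> mod_A n d" using madd_least[OF all assms] .
  note mem = madd_def Inter_iff mem_Collect_eq
  show ?thesis
    unfolding subcat_def
  proof (intro conjI ballI impI)
    fix M N :: "'k kmod" assume *: "M \<in> madd n d S" "N \<in> mod_A n d" "miso n d M N"
    show "N \<in> madd n d S" unfolding mem
    proof (intro ballI)
      fix C assume "C \<in> {C. subcat n d C \<and> S \<subseteq> C}"
      then show "N \<in> C" using * madd_least[of n d C S] unfolding subcat_def by blast
    qed
  next
    fix Z :: "'k kmod" assume *: "Z \<in> mod_A n d" "mzero n d Z"
    show "Z \<in> madd n d S" unfolding mem
    proof (intro ballI)
      fix C assume "C \<in> {C. subcat n d C \<and> S \<subseteq> C}"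
      then show "Z \<in> C" using * unfolding subcat_def by blast
    qed
  next
    fix X Y Z :: "'k kmod" assume *: "X \<in> madd n d S" "Y \<in> madd n d S" "Z \<in> mod_A n d" "mbiproduct n d Z X Y"
    show "Z \<in> madd n d S" unfolding mem
    proof (intro ballI)
      fix C assume "C \<in> {C. subcat n d C \<and> S \<subseteq> C}"
      then show "Z \<in> C" using * madd_least[of n d C S] unfolding subcat_def by blast
    qed
  next
    fix X Y Z :: "'k kmod" assume *: "Z \<in> madd n d S" "X \<in> mod_A n d" "Y \<in> mod_A n d" "mbiproduct n d Z X Y"
    show "X \<in> madd n d S" unfolding mem
    proof (intro ballI)
      fix C assume "C \<in> {C. subcat n d C \<and> S \<subseteq> C}"
      then show "X \<in> C" using * madd_least[of n d C S] unfolding subcat_def by blast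
    qed
  qed (rule sub)
qed

section \<open>Existence of zero modules and biproducts\<close>

lemma fin_dim_trivial: "fin_dim {0}"
  unfolding fin_dim_def by (intro exI[of _ "{}"]) simp

lemma zero_module: "\<exists>Z\<in>mod_A n d. mzero n d (Z :: 'k::field kmod)"
proof -
  have "\<lparr>sp = \<lambda>x. {0 :: nat \<Rightarrow> 'k}, act = \<lambda>x y a v. 0\<rparr> \<in> mod_A n d"
    by (auto simp: mod_A_def linear_on_def fin_dim_trivial)
  then show ?thesis by (force simp: mzero_def)
qed

text \<open>
  Interleaving stores two sequences in one, which realises the direct sum of two spaces of
  sequences inside the same ambient space.
\<close>

definition infst :: "(nat \<Rightarrow> 'k::field) \<Rightarrow> (nat \<Rightarrow> 'k)" where
  "infst v = (\<lambda>k. if even k then v (k div 2) else 0)"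

definition insnd :: "(nat \<Rightarrow> 'k::field) \<Rightarrow> (nat \<Rightarrow> 'k)" where
  "insnd v = (\<lambda>k. if odd k then v (k div 2) else 0)"

definition fstpart :: "(nat \<Rightarrow> 'k::field) \<Rightarrow> (nat \<Rightarrow> 'k)" where
  "fstpart w = (\<lambda>k. w (2 * k))"

definition sndpart :: "(nat \<Rightarrow> 'k::field) \<Rightarrow> (nat \<Rightarrow> 'k)" where
  "sndpart w = (\<lambda>k. w (Suc (2 * k)))"

lemma pair_simps [simp]:
  "fstpart (infst v) = v" "sndpart (insnd v) = v" "fstpart (insnd v) = 0" "sndpart (infst v) = 0"
  "infst (fstpart w) + insnd (sndpart w) = w"
  "infst (u + v) = infst u + infst v" "insnd (u + v) = insnd u + insnd v"
  "fstpart (u + v) = fstpart u + fstpart v" "sndpart (u + v) = sndpart u + sndpart v"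
  "infst (kscale c v) = kscale c (infst v)" "insnd (kscale c v) = kscale c (insnd v)"
  "fstpart (kscale c v) = kscale c (fstpart v)" "sndpart (kscale c v) = kscale c (sndpart v)"
  "infst 0 = 0" "insnd 0 = 0" "fstpart 0 = 0" "sndpart 0 = 0"
  by (auto simp: infst_def insnd_def fstpart_def sndpart_def kscale_def fun_eq_iff)

lemma fin_dim_pair:
  assumes "fin_dim V" "fin_dim W"
  shows "fin_dim {w. fstpart w \<in> V \<and> sndpart w \<in> W}"
proof -
  obtain B C where B: "finite B" "V = kseq.span B" and C: "finite C" "W = kseq.span C"
    using assms by (auto simp: fin_dim_def)
  interpret l: Vector_Spaces.linear kscale kscale infst by unfold_locales simp_all
  interpret r: Vector_Spaces.linear kscale kscale insnd by unfold_locales simp_all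
  have "kseq.span (infst ` B \<union> insnd ` C) = {u + v |u v. u \<in> infst ` V \<and> v \<in> insnd ` W}"
    unfolding kseq.span_Un l.span_image r.span_image B(2) C(2) by auto
  also have "\<dots> = {w. fstpart w \<in> V \<and> sndpart w \<in> W}"
  proof (intro set_eqI iffI)
    fix w assume "w \<in> {w. fstpart w \<in> V \<and> sndpart w \<in> W}"
    moreover have "w = infst (fstpart w) + insnd (sndpart w)" by simp
    ultimately show "w \<in> {u + v |u v. u \<in> infst ` V \<and> v \<in> insnd ` W}" by blast
  qed auto
  finally show ?thesis using B(1) C(1) unfolding fin_dim_def by (metis finite_UnI finite_imageI)
qed

lemma biproduct_exists:
  fixes X Y :: "'k::field kmod"
  assumes X: "X \<in> mod_A n d" and Y: "Y \<in> mod_A n d"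
  shows "\<exists>Z\<in>mod_A n d. mbiproduct n d Z X Y"
proof -
  define Z where "Z = \<lparr>sp = (\<lambda>x. {w. fstpart w \<in> sp X x \<and> sndpart w \<in> sp Y x}),
    act = (\<lambda>x y a w. infst (act X x y a (fstpart w)) + insnd (act Y x y a (sndpart w)))\<rparr>"
  note sub = mod_A_subspace[OF X] mod_A_subspace[OF Y]
  have act_zero: "act N x y a 0 = 0" if "N \<in> mod_A n d" "x \<in> tuples n d" "y \<in> tuples n d" "a \<in> lin_hom x y"
    for N :: "'k kmod" and x y a
    using linear_on_zero[OF mod_A_act_linear[OF that]] mod_A_subspace[OF that(1,3)] kseq.subspace_0 by blast
  have act_add: "act N x y a (u + v) = act N x y a u + act N x y a v"
    if "N \<in> mod_A n d" "x \<in> tuples n d" "y \<in> tuples n d" "a \<in> lin_hom x y" "u \<in> sp N y" "v \<in> sp N y"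
    for N :: "'k kmod" and x y a u v
    using mod_A_act_linear[OF that(1-4)] that(5,6) unfolding linear_on_def by blast
  have act_scale: "act N x y a (kscale c v) = kscale c (act N x y a v)"
    if "N \<in> mod_A n d" "x \<in> tuples n d" "y \<in> tuples n d" "a \<in> lin_hom x y" "v \<in> sp N y"
    for N :: "'k kmod" and x y a c v
    using mod_A_act_linear[OF that(1-4)] that(5) unfolding linear_on_def by blast
  have Z: "Z \<in> mod_A n d"
  proof (rule mod_AI)
    fix x assume x: "x \<in> tuples n d"
    show "kseq.subspace (sp Z x)"
      using sub[OF x] by (auto simp: Z_def kseq.subspace_def)
    show "fin_dim (sp Z x)"
      using fin_dim_pair mod_A_fin_dim[OF X x] mod_A_fin_dim[OF Y x] by (simp add: Z_def)
    show "act Z x x 1 v = v" if "v \<in> sp Z x" for v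
      using mod_A_act_one[OF X] mod_A_act_one[OF Y] x that by (simp add: Z_def)
  next
    fix x y and a :: 'k assume xya: "x \<in> tuples n d" "y \<in> tuples n d" "a \<in> lin_hom x y"
    show "linear_on (sp Z y) (act Z x y a)"
      by (simp add: Z_def linear_on_def act_add[OF X xya] act_add[OF Y xya] act_scale[OF X xya]
          act_scale[OF Y xya] kseq.scale_right_distrib)
    fix v assume v: "v \<in> sp Z y"
    then show "act Z x y a v \<in> sp Z x"
      by (simp add: Z_def mod_A_act_in[OF X xya] mod_A_act_in[OF Y xya])
    note cX = mod_A_act_coeff[OF X, rule_format, OF xya, of "fstpart v"]
    note cY = mod_A_act_coeff[OF Y, rule_format, OF xya, of "sndpart v"]
    show "act Z x y (c * a) v = kscale c (act Z x y a v)" for c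
      using cX cY v by (simp add: Z_def kseq.scale_right_distrib)
    show "act Z x y (a + b) v = act Z x y a v + act Z x y b v" if "b \<in> lin_hom x y" for b
      using cX cY v that by (simp add: Z_def)
  next
    fix x y z and a b :: 'k and v
    assume xyz: "x \<in> tuples n d" "y \<in> tuples n d" "z \<in> tuples n d" "a \<in> lin_hom x y" "b \<in> lin_hom y z"
      and v: "v \<in> sp Z z"
    show "act Z x z (a * b) v = act Z x y a (act Z y z b v)"
      using mod_A_act_mult[OF X, rule_format, OF xyz, of "fstpart v"]
        mod_A_act_mult[OF Y, rule_format, OF xyz, of "sndpart v"] v by (simp add: Z_def)
  next
    fix x y and a :: 'k and v
    assume xya: "x \<in> tuples n d" "y \<in> tuples n d" "idem_ideal n d x y a" and v: "v \<in> sp Z y"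
    then show "act Z x y a v = 0"
      using mod_A_act_ideal[OF X, rule_format, OF xya, of "fstpart v"]
        mod_A_act_ideal[OF Y, rule_format, OF xya, of "sndpart v"] by (simp add: Z_def)
  qed
  let ?in = "\<lambda>g V x v. if x \<in> tuples n d \<and> v \<in> V x then g v else 0"
  have in1: "?in infst (sp X) \<in> mHom n d X Z"
    by (rule mHomI) (auto simp: Z_def kseq.subspace_0 kseq.subspace_add kseq.subspace_scale sub
        mod_A_act_in[OF X] act_zero[OF Y])
  have in2: "?in insnd (sp Y) \<in> mHom n d Y Z"
    by (rule mHomI) (auto simp: Z_def kseq.subspace_0 kseq.subspace_add kseq.subspace_scale sub
        mod_A_act_in[OF Y] act_zero[OF X])
  have in3: "?in fstpart (sp Z) \<in> mHom n d Z X"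
    by (rule mHomI) (auto simp: Z_def kseq.subspace_0 kseq.subspace_add kseq.subspace_scale sub
        mod_A_act_in[OF X] mod_A_act_in[OF Y])
  have in4: "?in sndpart (sp Z) \<in> mHom n d Z Y"
    by (rule mHomI) (auto simp: Z_def kseq.subspace_0 kseq.subspace_add kseq.subspace_scale sub
        mod_A_act_in[OF X] mod_A_act_in[OF Y])
  have "biprod n d Z X Y (?in infst (sp X)) (?in insnd (sp Y)) (?in fstpart (sp Z)) (?in sndpart (sp Z))"
    unfolding biprod_def
    by (intro conjI in1 in2 in3 in4; rule ext, rule ext)
      (simp_all add: mcomp_def mid_def Z_def kseq.subspace_0 sub)
  then show ?thesis using Z mbiproduct_iff by blast
qed

section \<open>Krull--Schmidt for modules with scalar endomorphisms\<close>

text \<open>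
  Biproducts are determined only up to isomorphism, hence a relation and not a function.
\<close>

fun dsum :: "nat \<Rightarrow> nat \<Rightarrow> 'k::field kmod list \<Rightarrow> 'k kmod \<Rightarrow> bool" where
  "dsum n d [] Z \<longleftrightarrow> mzero n d Z"
| "dsum n d (M # Ms) Z \<longleftrightarrow> (\<exists>Y\<in>mod_A n d. mbiproduct n d Z M Y \<and> dsum n d Ms Y)"

text \<open>
  The form in which a local endomorphism ring enters the Krull--Schmidt argument.
\<close>

definition scalar_end :: "nat \<Rightarrow> nat \<Rightarrow> 'k::field kmod \<Rightarrow> bool" where
  "scalar_end n d M \<longleftrightarrow> M \<in> mod_A n d \<and> (\<forall>f\<in>mHom n d M M. \<exists>c. f = mscale c (mid n d M))"

lemma dsum_iso:
  assumes "miso n d Y Z" "dsum n d Ms Y" "set Ms \<subseteq> mod_A n d" "Y \<in> mod_A n d" "Z \<in> mod_A n d"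
  shows "dsum n d Ms Z"
proof (cases Ms)
  case Nil
  then show ?thesis using assms mzero_retract miso_retract miso_sym by fastforce
next
  case (Cons M Ns)
  then obtain W where W: "W \<in> mod_A n d" "mbiproduct n d Y M W" "dsum n d Ns W" using assms(2) by auto
  obtain f g where "f \<in> mHom n d Y Z" "g \<in> mHom n d Z Y" "g \<odot> f = mid n d Y" "f \<odot> g = mid n d Z"
    using assms(1) by (auto simp: miso_def)
  then have "mbiproduct n d Z M W"
    using W(1,2) mbiproduct_iso assms(3-5) Cons unfolding mbiproduct_iff[of n d Y] by auto
  then show ?thesis using W Cons by auto
qed

lemma dsum_append:
  assumes "set Ms \<subseteq> mod_A n d" "set Ns \<subseteq> mod_A n d" "dsum n d Ms X" "dsum n d Ns Y"
    "mbiproduct n d Z X Y" "X \<in> mod_A n d" "Y \<in> mod_A n d" "Z \<in> mod_A n d"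
  shows "dsum n d (Ms @ Ns) Z"
  using assms
proof (induction Ms arbitrary: X Z)
  case Nil
  obtain i j p q where bip: "biprod n d Z X Y i j p q" using Nil.prems(5) by (auto simp: mbiproduct_iff)
  have "i = 0" using mzero_mHom(1) Nil.prems biprod_arrows[OF bip] by simp
  then have "miso n d Y Z"
    using bip unfolding miso_def biprod_def by (intro bexI[of _ j] bexI[of _ q]) auto
  then show ?case using dsum_iso Nil.prems by auto
next
  case (Cons M Ms)
  obtain X' where X': "X' \<in> mod_A n d" "mbiproduct n d X M X'" "dsum n d Ms X'" using Cons.prems by auto
  obtain i j p q a i' b p' where bips: "biprod n d Z X Y i j p q" "biprod n d X M X' a i' b p'"
    using X'(2) Cons.prems(5) by (auto simp: mbiproduct_iff)
  obtain K k r where K: "K \<in> mod_A n d" "biprod n d Z M K (i \<odot> a) k (b \<odot> p) r"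
    "mbiproduct n d K X' Y"
    using biprod_assoc[OF bips Cons.prems(8,6,7) _ X'(1)] Cons.prems(1) by auto
  then have ZMK: "mbiproduct n d Z M K" unfolding mbiproduct_iff by blast
  have "dsum n d (Ms @ Ns) K" using Cons.IH[OF _ _ X'(3) _ K(3) X'(1) _ K(1)] Cons.prems by simp
  then show ?case using K(1) ZMK by auto
qed

text \<open>
  A nonzero \<open>c\<close> says that \<open>M\<close> survives the passage through \<open>X\<close>, so \<open>M\<close> splits off from \<open>X\<close>.
  Cancelling \<open>M\<close> from the two resulting decompositions of \<open>Z\<close> compares their complements.
\<close>

lemma exchange:
  assumes M: "M \<in> mod_A n d"
    and MZ: "biprod n d Z M Z' i j p q" and XY: "biprod n d Z X Y iX iY pX pY"
    and c: "c \<noteq> 0" "p \<odot> (iX \<odot> (pX \<odot> i)) = mscale c (mid n d M)"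
    and obj: "Z \<in> mod_A n d" "Z' \<in> mod_A n d" "X \<in> mod_A n d" "Y \<in> mod_A n d"
  shows "\<exists>X'\<in>mod_A n d. mbiproduct n d X M X' \<and> mbiproduct n d Z' X' Y"
proof -
  note arrows = biprod_arrows[OF MZ] biprod_arrows[OF XY]
  define a where "a = pX \<odot> i"
  define b where "b = mscale (inverse c) (p \<odot> iX)"
  have a: "a \<in> mHom n d M X" unfolding a_def using mcomp_in arrows by blast
  have b: "b \<in> mHom n d X M" unfolding b_def using mcomp_in mHom_scale M arrows by blast
  have "b \<odot> a = mid n d M" using c by (simp add: a_def b_def)
  then obtain X' k r where X': "X' \<in> mod_A n d" "biprod n d X M X' a k b r"
    using retract_complement[OF M obj(3) a b] by blast
  then obtain K kk rr where K: "K \<in> mod_A n d" "biprod n d Z M K (iX \<odot> a) kk (b \<odot> pX) rr"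
    "mbiproduct n d K X' Y"
    using biprod_assoc[OF XY X'(2) obj(1,3,4) M X'(1)] by blast
  have "p \<odot> (iX \<odot> a) = mscale c (mid n d M)" using c by (simp add: a_def)
  then obtain f g where "f \<in> mHom n d Z' K" "g \<in> mHom n d K Z'" "g \<odot> f = mid n d Z'" "f \<odot> g = mid n d K"
    using biprod_cancel[OF MZ K(2) c(1) _ obj(1) M obj(2) K(1)] by blast
  then have "mbiproduct n d Z' X' Y"
    using K(3) mbiproduct_iso[of n d K X' Y _ _ _ _ g Z' f] X'(1) obj K(1) unfolding mbiproduct_iff[of n d K]
    by blast
  then show ?thesis using X' mbiproduct_iff by blast
qed

text \<open>
  The projections of \<open>Z\<close> onto \<open>X\<close> and \<open>Y\<close> add up to the identity.  Restricted to the first summand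
  \<open>M\<close> of \<open>Z\<close> they are scalars with sum 1, and so one of them is nonzero; by \<open>exchange\<close>, \<open>M\<close> is then a
  summand of \<open>X\<close> or of \<open>Y\<close> and can be removed from \<open>Z\<close>.
\<close>

lemma dsum_summand:
  assumes "\<And>M. M \<in> set Ms \<Longrightarrow> scalar_end n d M" "dsum n d Ms Z" "mbiproduct n d Z X Y"
    "Z \<in> mod_A n d" "X \<in> mod_A n d" "Y \<in> mod_A n d"
  shows "\<exists>Ns. set Ns \<subseteq> set Ms \<and> dsum n d Ns X"
  using assms
proof (induction Ms arbitrary: Z X Y)
  case Nil
  then have "mzero n d X" using mzero_retract mbiproduct_retract by fastforce
  then show ?case by (intro exI[of _ "[]"]) simp
next
  case (Cons M Ms)
  have M: "M \<in> mod_A n d" "\<And>f. f \<in> mHom n d M M \<Longrightarrow> \<exists>c. f = mscale c (mid n d M)"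
    using Cons.prems(1)[of M] by (auto simp: scalar_end_def)
  obtain Z' where Z': "Z' \<in> mod_A n d" "mbiproduct n d Z M Z'" "dsum n d Ms Z'" using Cons.prems(2) by auto
  obtain i j p q iX iY pX pY where
    MZ: "biprod n d Z M Z' i j p q" and XY: "biprod n d Z X Y iX iY pX pY"
    using Z'(2) Cons.prems(3) by (auto simp: mbiproduct_iff)
  note obj = Cons.prems(4) Z'(1) Cons.prems(5,6)
  note arrows = biprod_arrows[OF MZ] biprod_arrows[OF XY]
  have "p \<odot> (iX \<odot> (pX \<odot> i)) \<in> mHom n d M M"
    by (rule mcomp_in[OF mcomp_in[OF mcomp_in[OF arrows(1,7)] arrows(5)] arrows(3)])
  moreover have "p \<odot> (iY \<odot> (pY \<odot> i)) \<in> mHom n d M M"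
    by (rule mcomp_in[OF mcomp_in[OF mcomp_in[OF arrows(1,8)] arrows(6)] arrows(3)])
  ultimately obtain c c' where cc: "p \<odot> (iX \<odot> (pX \<odot> i)) = mscale c (mid n d M)"
    "p \<odot> (iY \<odot> (pY \<odot> i)) = mscale c' (mid n d M)" using M(2) by meson
  have "p \<odot> (iX \<odot> (pX \<odot> i)) + p \<odot> (iY \<odot> (pY \<odot> i)) = mid n d M"
    by (simp add: biprod_simps[OF XY obj(3,4,1)] biprod_simps(1)[OF MZ M(1) obj(2,1)]
        arrow[OF obj(1) M(1) arrows(3)] arrow[OF obj(3,1) arrows(5)] arrow[OF M(1) obj(1) arrows(1)])
  then have sum: "mscale c (mid n d M) + mscale c' (mid n d M) = mid n d M" by (simp add: cc)
  \<comment> \<open>If both scalars are 0, then \<open>M\<close> is zero, and 0 and 1 are the same scalar on it.\<close>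
  consider (X) e where "e \<noteq> 0" "p \<odot> (iX \<odot> (pX \<odot> i)) = mscale e (mid n d M)"
    | (Y) e where "e \<noteq> 0" "p \<odot> (iY \<odot> (pY \<odot> i)) = mscale e (mid n d M)"
  proof (cases "c = 0 \<and> c' = 0")
    case True
    then have "mid n d M = 0" using sum by simp
    then show ?thesis using that(1)[of 1] cc True by simp
  qed (use cc that in blast)
  then show ?case
  proof cases
    case X
    then obtain X' where X': "X' \<in> mod_A n d" "mbiproduct n d X M X'" "mbiproduct n d Z' X' Y"
      using exchange[OF M(1) MZ XY _ _ obj] by blast
    obtain Ns where "set Ns \<subseteq> set Ms" "dsum n d Ns X'"
      using Cons.IH[OF _ Z'(3) X'(3) Z'(1) X'(1) obj(4)] Cons.prems(1) by auto
    then show ?thesis using X' by (intro exI[of _ "M # Ns"]) auto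
  next
    case Y
    then obtain Y' where Y': "Y' \<in> mod_A n d" "mbiproduct n d Z' Y' X"
      using exchange[OF M(1) MZ biprod_swap[OF XY] _ _ obj(1,2,4,3)] by blast
    then obtain Ns where "set Ns \<subseteq> set Ms" "dsum n d Ns X"
      using Cons.IH[OF _ Z'(3) mbiproduct_swap[OF Y'(2)] Z'(1) obj(3) Y'(1)] Cons.prems(1) by auto
    then show ?thesis by (intro exI[of _ Ns]) auto
  qed
qed

text \<open>
  Closure of the direct sums under summands, the only closure property of \<open>subcat\<close> that is not
  formal, is \<open>dsum_summand\<close>.
\<close>

lemma madd_dsum:
  fixes S :: "'k::field kmod set"
  assumes S: "\<And>M. M \<in> S \<Longrightarrow> scalar_end n d M" and M: "M \<in> madd n d S"
  shows "M \<in> mod_A n d \<and> (\<exists>Ms. set Ms \<subseteq> S \<and> dsum n d Ms M)"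
proof -
  have S': "set Ms \<subseteq> S \<Longrightarrow> set Ms \<subseteq> mod_A n d" for Ms using S by (auto simp: scalar_end_def)
  have "subcat n d {M \<in> mod_A n d. \<exists>Ms. set Ms \<subseteq> S \<and> dsum n d Ms M}" (is "subcat n d ?C")
    unfolding subcat_def
  proof (intro conjI ballI impI)
    fix M N :: "'k kmod" assume "M \<in> ?C" "N \<in> mod_A n d" "miso n d M N"
    then show "N \<in> ?C" using dsum_iso S' by blast
  next
    fix Z :: "'k kmod" assume "Z \<in> mod_A n d" "mzero n d Z"
    then show "Z \<in> ?C" by (auto intro!: exI[of _ "[]"])
  next
    fix X Y Z :: "'k kmod" assume *: "X \<in> ?C" "Y \<in> ?C" "Z \<in> mod_A n d" "mbiproduct n d Z X Y"
    then obtain Ms Ns where "set Ms \<subseteq> S" "dsum n d Ms X" "set Ns \<subseteq> S" "dsum n d Ns Y" by auto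
    then show "Z \<in> ?C" using dsum_append[of Ms n d Ns X Y Z] * S' by (auto intro!: exI[of _ "Ms @ Ns"])
  next
    fix Z X Y :: "'k kmod" assume *: "Z \<in> ?C" "X \<in> mod_A n d" "Y \<in> mod_A n d" "mbiproduct n d Z X Y"
    then obtain Ms where "set Ms \<subseteq> S" "dsum n d Ms Z" by auto
    then obtain Ns where "set Ns \<subseteq> set Ms" "dsum n d Ns X" 
      using dsum_summand[of Ms n d Z X Y] * S by auto
    then show "X \<in> ?C" using * \<open>set Ms \<subseteq> S\<close> by auto
  qed auto
  moreover have "S \<subseteq> ?C"
  proof
    fix N assume N: "N \<in> S"
    then have N': "N \<in> mod_A n d" using S by (auto simp: scalar_end_def)
    obtain Z :: "'k kmod" where Z: "Z \<in> mod_A n d" "mzero n d Z" using zero_module by blast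
    have "biprod n d N N Z (mid n d N) 0 (mid n d N) 0"
      using Z mid_in[OF N'] mHom_zero[OF N'] mHom_zero[OF Z(1)] arrow[OF N' N' mid_in[OF N']]
      by (simp add: biprod_def mzero_iff)
    then have "mbiproduct n d N N Z" unfolding mbiproduct_iff by blast
    then have "dsum n d [N] N" using Z by auto
    then show "N \<in> ?C" using N N' by (auto intro!: exI[of _ "[N]"])
  qed
  ultimately show ?thesis using madd_least[of n d ?C S] M by blast
qed

section \<open>Morphisms between interval modules\<close>

text \<open>
  The relation \<open>\<leadsto>\<close> for tuples of natural numbers of length \<open>d + 1\<close>.
\<close>

definition interlaced :: "nat \<Rightarrow> nat list \<Rightarrow> nat list \<Rightarrow> bool" where
  "interlaced d x y \<longleftrightarrow> (\<forall>i\<le>d. x ! i \<le> y ! i) \<and> (\<forall>i<d. y ! i \<le> x ! Suc i)"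

lemma tuples_iff: "x \<in> tuples n m \<longleftrightarrow> length x = m \<and> (\<forall>i<m. x ! i < n)"
  by (auto simp: tuples_def set_conv_nth)

lemma os_iff: "x \<in> os n m \<longleftrightarrow> length x = m \<and> (\<forall>i<m. x ! i < n) \<and> (\<forall>i j. i \<le> j \<longrightarrow> j < m \<longrightarrow> x ! i \<le> x ! j)"
  by (auto simp: os_def tuples_iff sorted_iff_nth_mono)

lemma ple_iff: "x \<preceq> y \<longleftrightarrow> length x = length y \<and> (\<forall>i<length x. x ! i \<le> y ! i)"
  by (auto simp: ple_def list_all2_conv_all_nth)

lemma ple_trans: "x \<preceq> y \<Longrightarrow> y \<preceq> z \<Longrightarrow> x \<preceq> z"
  unfolding ple_iff by (metis le_trans)

lemma msupp_tuples: "w \<in> msupp n d x \<Longrightarrow> w \<in> tuples n d"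
  by (auto simp: msupp_def os_def)

text \<open>
  The point \<open>z\<close> is non-decreasing because \<open>x\<^sub>i\<^sub>+\<^sub>1\<close> separates its entries number \<open>i\<close> and \<open>i + 1\<close>.
\<close>

lemma msupp_convex:
  assumes "u \<in> msupp n d x" "w \<in> msupp n d x" "u \<preceq> z" "z \<preceq> w" "z \<in> tuples n d"
  shows "z \<in> msupp n d x"
proof -
  have *: "x ! i \<le> z ! i \<and> z ! i \<le> x ! Suc i" if "i < d" for i
    using assms that unfolding msupp_def ple_iff tuples_iff by (auto, (meson le_trans)+)
  have "z ! i \<le> z ! j" if "i \<le> j" "j < d" for i j
  proof (cases "i = j")
    case False
    then have "z ! i \<le> x ! Suc i" "x ! Suc i \<le> u ! Suc i" "u ! Suc i \<le> u ! j" "u ! j \<le> z ! j"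
      using * that assms unfolding msupp_def os_iff ple_iff by auto
    then show ?thesis by linarith
  qed simp
  then show ?thesis using * assms(5) by (auto simp: msupp_def os_iff tuples_iff)
qed

text \<open>
  Together with convexity of supports, this is why interval modules are annihilated by the ideal.
\<close>

lemma idem_ideal_between:
  assumes "idem_ideal n d x y a" "a \<noteq> 0"
  shows "\<exists>z\<in>tuples n d - os n d. x \<preceq> z \<and> z \<preceq> y"
proof -
  have "a = 0 \<or> (\<exists>z\<in>tuples n d - os n d. x \<preceq> z \<and> z \<preceq> y)"
    using assms(1)
  proof induction
    case (gen z)
    then show ?case by (auto simp: ple_iff intro!: bexI[of _ z])
  next
    case (pre x a y z b)
    show ?case
    proof (cases "a = 0 \<or> b = 0")
      case False
      then have "x \<preceq> y" using pre(2) by (simp add: lin_hom_def split: if_splits)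
      then show ?thesis using pre(4) False ple_trans by blast
    qed auto
  next
    case (post z x y a b)
    show ?case
    proof (cases "a = 0 \<or> b = 0")
      case False
      then have "y \<preceq> z" using post(3) by (simp add: lin_hom_def split: if_splits)
      then show ?thesis using post(4) False ple_trans by blast
    qed auto
  next
    case (add x y a b)
    then show ?case by (metis add_0)
  next
    case zero
    show ?case by simp
  qed
  then show ?thesis using assms(2) by blast
qed

definition kunit :: "nat \<Rightarrow> 'k::field" where "kunit = (\<lambda>i. if i = 0 then 1 else 0)"

lemma kline_simps: "kunit \<in> kline" "0 \<in> kline" "u \<in> kline \<Longrightarrow> v \<in> kline \<Longrightarrow> u + v \<in> kline"
  "v \<in> kline \<Longrightarrow> kscale c v \<in> kline" "kunit \<noteq> (0 :: nat \<Rightarrow> 'k::field)"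
  by (auto simp: kunit_def kline_def kscale_def fun_eq_iff)

lemma kline_eq: "v \<in> kline \<Longrightarrow> v = kscale (v 0) kunit"
  by (auto simp: kunit_def kline_def kscale_def fun_eq_iff)

lemma Mint_simps:
  "sp (Mint n d x) w = (if w \<in> msupp n d x then kline else {0})"
  "act (Mint n d x) u w a v = (if u \<in> msupp n d x \<and> w \<in> msupp n d x then kscale a v else 0)"
  by (auto simp: Mint_def)

lemma fin_dim_kline: "fin_dim (kline :: (nat \<Rightarrow> 'k::field) set)"
proof -
  have "range (\<lambda>c. kscale c (kunit :: nat \<Rightarrow> 'k)) = kline"
  proof (intro set_eqI iffI)
    fix v :: "nat \<Rightarrow> 'k" assume "v \<in> kline"
    then show "v \<in> range (\<lambda>c. kscale c kunit)" using kline_eq by blast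
  qed (auto simp: kline_simps)
  then have "kline = kseq.span {kunit :: nat \<Rightarrow> 'k}" by (simp add: kseq.span_singleton)
  then show ?thesis unfolding fin_dim_def by (intro exI[of _ "{kunit}"]) simp
qed

lemma Mint_in_mod_A: "(Mint n d x :: 'k::field kmod) \<in> mod_A n d"
proof (rule mod_AI)
  fix w
  show "kseq.subspace (sp (Mint n d x :: 'k kmod) w)"
    by (simp add: Mint_simps kseq.subspace_def kline_simps)
  show "fin_dim (sp (Mint n d x :: 'k kmod) w)"
    by (simp add: Mint_simps fin_dim_kline fin_dim_trivial)
next
  fix u w z and a b :: 'k and v
  assume *: "u \<in> tuples n d" "w \<in> tuples n d" "z \<in> tuples n d" "a \<in> lin_hom u w" "b \<in> lin_hom w z"
  have "w \<in> msupp n d x" if "u \<in> msupp n d x" "z \<in> msupp n d x" "a \<noteq> 0" "b \<noteq> 0"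
  proof (rule msupp_convex[OF that(1,2) _ _ *(2)])
    show "u \<preceq> w" "w \<preceq> z" using *(4,5) that(3,4) by (simp_all add: lin_hom_def split: if_splits)
  qed
  then show "act (Mint n d x) u z (a * b) v = act (Mint n d x) u w a (act (Mint n d x) w z b v)"
    by (cases "a = 0 \<or> b = 0") (auto simp: Mint_simps)
next
  fix u w and a :: 'k and v
  assume *: "idem_ideal n d u w a"
  have "\<not> (u \<in> msupp n d x \<and> w \<in> msupp n d x)" if "a \<noteq> 0"
  proof
    note between = idem_ideal_between[OF * that]
    assume uw: "u \<in> msupp n d x \<and> w \<in> msupp n d x"
    obtain z where z: "z \<in> tuples n d - os n d" "u \<preceq> z" "z \<preceq> w"
      using between by blast
    then have "z \<in> msupp n d x" using msupp_convex uw by blast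
    then show False using z(1) by (simp add: msupp_def)
  qed
  then show "act (Mint n d x) u w a v = 0"
    by (auto simp: Mint_simps)
next
  fix u w and a :: 'k
  show "linear_on (sp (Mint n d x) w) (act (Mint n d x) u w a)"
    by (simp add: Mint_simps linear_on_def kseq.scale_right_distrib mult.commute)
qed (simp_all add: Mint_simps kline_simps kseq.scale_left_distrib split: if_splits)

text \<open>
  The identity wherever both modules are nonzero.
\<close>

definition can :: "nat \<Rightarrow> nat \<Rightarrow> nat list \<Rightarrow> nat list \<Rightarrow> 'k::field mor" where
  "can n d x y = (\<lambda>w v. if w \<in> msupp n d x \<and> w \<in> msupp n d y \<and> v \<in> kline then v else 0)"

lemma can_in_mHom:
  assumes xy: "interlaced d x y"
  shows "can n d x y \<in> mHom n d (Mint n d x) (Mint n d y :: 'k::field kmod)"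
proof (rule mHomI)
  fix u w and v :: "nat \<Rightarrow> 'k" and a :: 'k
  assume *: "u \<in> tuples n d" "w \<in> tuples n d" "a \<in> lin_hom u w" "v \<in> sp (Mint n d x) w"
  have "w \<in> msupp n d y \<and> u \<in> msupp n d x" if "u \<in> msupp n d y" "w \<in> msupp n d x" "u \<preceq> w"
  proof -
    have "y ! i \<le> w ! i \<and> w ! i \<le> y ! Suc i \<and> x ! i \<le> u ! i \<and> u ! i \<le> x ! Suc i" if "i < d" for i
    proof -
      have "u ! i \<le> w ! i" "y ! i \<le> u ! i" "w ! i \<le> x ! Suc i" "x ! Suc i \<le> y ! Suc i" "x ! i \<le> y ! i"
        using xy \<open>u \<in> msupp n d y\<close> \<open>w \<in> msupp n d x\<close> \<open>u \<preceq> w\<close> that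
        by (auto simp: interlaced_def msupp_def ple_iff os_iff)
      then show ?thesis by linarith
    qed
    then show ?thesis using that by (auto simp: msupp_def)
  qed
  then show "can n d x y u (act (Mint n d x) u w a v) = act (Mint n d y) u w a (can n d x y w v)"
    using *(3,4) by (cases "a = 0") (auto simp: Mint_simps can_def kline_simps lin_hom_def split: if_splits)
qed (auto simp: Mint_simps can_def kline_simps msupp_tuples split: if_splits)

text \<open>
  At each common point of the two supports, \<open>f\<close> is multiplication by a scalar.  Naturality along a
  relation \<open>u \<preceq> w\<close> identifies the scalars at \<open>u\<close> and \<open>w\<close>, or makes the one that exists vanish if
  \<open>u\<close> leaves the support of \<open>M\<^sub>x\<close> or \<open>w\<close> leaves that of \<open>M\<^sub>y\<close>.  If \<open>x \<leadsto> y\<close>, the largest point \<open>tl x\<close> of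
  the support of \<open>M\<^sub>x\<close> is common, and it determines all other scalars.  Otherwise, provided that there
  is a common point, \<open>x\<^sub>i > y\<^sub>i\<close> for some \<open>i\<close>.  For \<open>i < d\<close> the smallest point \<open>butlast y\<close> of the
  support of \<open>M\<^sub>y\<close> lies outside the support of \<open>M\<^sub>x\<close>, and for \<open>i = d\<close> the point \<open>tl x\<close> lies outside the
  support of \<open>M\<^sub>y\<close>; in both cases all scalars vanish.
\<close>

lemma hom_Mint:
  assumes d: "d \<ge> 1" and x: "x \<in> os n (d + 1)" and y: "y \<in> os n (d + 1)"
    and f: "f \<in> mHom n d (Mint n d x) (Mint n d y :: 'k::field kmod)"
  shows "if interlaced d x y then \<exists>c. f = mscale c (can n d x y) else f = 0"
proof -
  define X where "X = msupp n d x"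
  define Y where "Y = msupp n d y"
  have tup: "w \<in> X \<Longrightarrow> w \<in> tuples n d" "w \<in> Y \<Longrightarrow> w \<in> tuples n d" for w
    using msupp_tuples by (auto simp: X_def Y_def)
  have off: "f w v = 0" if "\<not> (w \<in> X \<and> w \<in> Y \<and> v \<in> kline)" for w v
  proof (cases "w \<in> tuples n d \<and> v \<in> sp (Mint n d x) w")
    case True
    then show ?thesis using mHom_sp[OF f, of w v] mHom_apply_zero[OF f, of w] that
      by (auto simp: Mint_simps X_def Y_def split: if_splits)
  qed (use mHom_outside[OF f] in blast)
  have up: "f u v = (if w \<in> Y then f w v else 0)"
    if "u \<in> X" "w \<in> X" "u \<in> Y" "u \<preceq> w" "v \<in> kline" for u w v
    using mHom_natural[OF f tup(1)[OF that(1)] tup(1)[OF that(2)], of 1 v] that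
    by (simp add: lin_hom_def Mint_simps X_def Y_def)
  have down: "f w v = (if u \<in> X then f u v else 0)"
    if "w \<in> X" "w \<in> Y" "u \<in> Y" "u \<preceq> w" "v \<in> kline" for u w v
    using mHom_natural[OF f tup(2)[OF that(3)] tup(1)[OF that(1)], of 1 v] that mHom_apply_zero[OF f, of u]
    by (auto simp add: lin_hom_def Mint_simps X_def Y_def split: if_splits)
  have line: "\<exists>c. \<forall>v\<in>kline. f w v = kscale c v" if w: "w \<in> X" "w \<in> Y" for w
  proof (intro exI ballI)
    fix v :: "nat \<Rightarrow> 'k" assume v: "v \<in> kline"
    have "f w (kscale (v 0) kunit) = kscale (v 0) (f w kunit)"
      by (rule mHom_apply_scale[OF f tup(1)[OF w(1)]]) (use w in \<open>simp add: Mint_simps X_def kline_simps\<close>)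
    moreover have "f w kunit \<in> kline"
      using mHom_sp[OF f tup(1)[OF w(1)], of kunit] w by (simp add: Mint_simps X_def Y_def kline_simps)
    ultimately show "f w v = kscale (f w kunit 0) v"
      using kline_eq[OF v] kline_eq[of "f w kunit"] by (metis kscale_simps(4) mult.commute)
  qed
  have top: "tl x \<in> X" "\<And>w. w \<in> X \<Longrightarrow> w \<preceq> tl x"
    using x by (auto simp: X_def msupp_def os_iff nth_tl ple_iff)
  have bot: "butlast y \<in> Y" "\<And>w. w \<in> Y \<Longrightarrow> butlast y \<preceq> w"
    using y by (auto simp: Y_def msupp_def os_iff nth_butlast ple_iff)
  show ?thesis
  proof (cases "interlaced d x y")
    case True
    then have topY: "tl x \<in> Y"
      using x by (auto simp: Y_def msupp_def os_iff nth_tl interlaced_def)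
    obtain c where c: "\<forall>v\<in>kline. f (tl x) v = kscale c v" using line[OF top(1) topY] by blast
    have "f = mscale c (can n d x y)"
    proof (rule ext, rule ext)
      fix w v show "f w v = mscale c (can n d x y) w v"
        using off[of w v] up[OF _ top(1) _ top(2)] topY c
        by (cases "w \<in> X \<and> w \<in> Y \<and> v \<in> kline") (auto simp: mscale_def can_def X_def Y_def)
    qed
    then show ?thesis using True by auto
  next
    case False
    have "f w v = 0" for w v
    proof (cases "w \<in> X \<and> w \<in> Y \<and> v \<in> kline")
      case True
      have "y ! i \<le> x ! Suc i" if "i < d" for i
        using True that unfolding X_def Y_def msupp_def by (blast intro: le_trans)
      then obtain i where i: "i \<le> d" "y ! i < x ! i"
        using False by (auto simp: interlaced_def not_le)
      show ?thesis
      proof (cases "i < d")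
        case i_less: True
        then have "butlast y \<notin> X" using i y by (auto simp: X_def msupp_def nth_butlast os_iff)
        then show ?thesis using down[OF _ _ bot(1) bot(2)] True by simp
      next
        case False
        then have "i = d" using i by simp
        then have "tl x \<notin> Y" using i d x
          by (auto simp: Y_def msupp_def nth_tl os_iff intro!: exI[of _ "d - 1"])
        then show ?thesis using up[OF _ top(1) _ top(2)] True by simp
      qed
    qed (rule off)
    then show ?thesis using False by (auto simp: fun_eq_iff)
  qed
qed

lemma can_nonzero:
  assumes "x \<in> os n (d + 1)" "interlaced d x y"
  shows "can n d x y \<noteq> (0 :: 'k::field mor)"
proof
  assume "can n d x y = (0 :: 'k mor)"
  then have "can n d x y (tl x) (kunit :: nat \<Rightarrow> 'k) = 0" by simp
  moreover have "tl x \<in> msupp n d x" "tl x \<in> msupp n d y"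
    using assms by (auto simp: msupp_def os_iff nth_tl interlaced_def)
  moreover have "(kunit :: nat \<Rightarrow> 'k) \<in> kline" "kunit \<noteq> (0 :: nat \<Rightarrow> 'k)" by (simp_all add: kline_simps)
  ultimately show False by (simp add: can_def)
qed

lemma mscale_zero_iff: "mscale c f = 0 \<longleftrightarrow> c = 0 \<or> f = 0"
  by (auto simp: mscale_def kscale_def fun_eq_iff)

lemma can_refl: "x \<in> os n (d + 1) \<Longrightarrow> interlaced d x x"
  by (auto simp: interlaced_def os_iff)

lemma can_id: "can n d x x = mid n d (Mint n d x)"
  by (rule ext, rule ext) (auto simp: can_def mid_def Mint_simps msupp_tuples)

lemma can_comp:
  assumes d: "d \<ge> 1" and x: "x \<in> os n (d + 1)" and z: "z \<in> os n (d + 1)"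
    and xy: "interlaced d x y" and yz: "interlaced d y z"
  shows "can n d y z \<odot> can n d x y = (if interlaced d x z then can n d x z else (0 :: 'k::field mor))"
proof (cases "interlaced d x z")
  case True
  have "w \<in> msupp n d y" if "w \<in> msupp n d x" "w \<in> msupp n d z" for w
  proof -
    have "y ! i \<le> w ! i \<and> w ! i \<le> y ! Suc i" if "i < d" for i
    proof -
      have "y ! i \<le> z ! i" "z ! i \<le> w ! i" "w ! i \<le> x ! Suc i" "x ! Suc i \<le> y ! Suc i"
        using xy yz \<open>w \<in> msupp n d x\<close> \<open>w \<in> msupp n d z\<close> that by (auto simp: interlaced_def msupp_def)
      then show ?thesis by linarith
    qed
    then show ?thesis using that by (auto simp: msupp_def)
  qed
  then show ?thesis using True
    by (auto simp: mcomp_def can_def fun_eq_iff kline_simps)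
next
  case False
  have "can n d y z \<odot> can n d x y \<in> mHom n d (Mint n d x) (Mint n d z :: 'k kmod)"
    by (rule mcomp_in[OF can_in_mHom[OF xy] can_in_mHom[OF yz]])
  then show ?thesis using False hom_Mint[OF d x z] by auto
qed

lemma scalar_end_Mint:
  assumes "d \<ge> 1" "x \<in> os n (d + 1)"
  shows "scalar_end n d (Mint n d x)"
  using hom_Mint[OF assms(1,2,2)] can_refl[OF assms(2)] Mint_in_mod_A
  by (auto simp: scalar_end_def can_id)

section \<open>Exactness after applying Hom\<close>

text \<open>
  For maps \<open>A \<rightarrow> B \<rightarrow> C\<close> with composite zero, \<open>lifts\<close> is exactness of \<open>Hom(N, -)\<close> at \<open>B\<close>, and \<open>colifts\<close> is
  exactness of \<open>Hom(-, N)\<close> at \<open>B\<close>.  Taking one of the maps to be zero covers the two ends of a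
  sequence: for \<open>f = 0\<close>, \<open>lifts\<close> is injectivity of composition with \<open>g\<close>, and for \<open>g = 0\<close>, it is
  surjectivity of composition with \<open>f\<close>.
\<close>

definition lifts ::
  "nat \<Rightarrow> nat \<Rightarrow> 'k::field kmod \<Rightarrow> 'k kmod \<Rightarrow> 'k mor \<Rightarrow> 'k kmod \<Rightarrow> 'k mor \<Rightarrow> bool" where
  "lifts n d N A f B g \<longleftrightarrow> (\<forall>h\<in>mHom n d N B. g \<odot> h = 0 \<longrightarrow> (\<exists>h'\<in>mHom n d N A. h = f \<odot> h'))"

definition colifts ::
  "nat \<Rightarrow> nat \<Rightarrow> 'k::field kmod \<Rightarrow> 'k mor \<Rightarrow> 'k kmod \<Rightarrow> 'k mor \<Rightarrow> 'k kmod \<Rightarrow> bool" where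
  "colifts n d N f B g C \<longleftrightarrow> (\<forall>h\<in>mHom n d B N. h \<odot> f = 0 \<longrightarrow> (\<exists>h'\<in>mHom n d C N. h = h' \<odot> g))"

lemma biprod_decompose:
  assumes "biprod n d Z X Y i j p q" "Z \<in> mod_A n d" "h \<in> mHom n d N Z"
  shows "h = i \<odot> (p \<odot> h) + j \<odot> (q \<odot> h)"
proof -
  have "h = (i \<odot> p + j \<odot> q) \<odot> h"
    using assms mid_left[OF lands_mHom[OF assms(2,3)]] by (simp add: biprod_def)
  then show ?thesis by simp
qed

lemma biprod_codecompose:
  assumes "biprod n d Z X Y i j p q" "X \<in> mod_A n d" "Y \<in> mod_A n d" "Z \<in> mod_A n d"
    "h \<in> mHom n d Z N"
  shows "h = (h \<odot> i) \<odot> p + (h \<odot> j) \<odot> q"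
proof -
  note arrows = biprod_arrows[OF assms(1)]
  have "h = h \<odot> (i \<odot> p + j \<odot> q)"
    using assms(1) mid_right[OF assms(5)] by (simp add: biprod_def)
  also have "\<dots> = h \<odot> (i \<odot> p) + h \<odot> (j \<odot> q)"
    using mcomp_right_add[OF assms(5)] lands_comp lands_mHom arrows assms(4) by blast
  finally show ?thesis by simp
qed

text \<open>
  Exactness thus passes from a set of test modules to its additive closure.
\<close>

lemma lifts_subcat:
  assumes obj: "A \<in> mod_A n d" "B \<in> mod_A n d" and f: "f \<in> mHom n d A B"
  shows "subcat n d {N \<in> mod_A n d. lifts n d N A f B g}"
proof (rule subcatI)
  fix Z :: "'a kmod" assume "Z \<in> mod_A n d" "mzero n d Z"
  then show "lifts n d Z A f B g"
    using mzero_mHom(1)[of n d Z B] obj mHom_zero[OF obj(1), of Z] mcomp_right_zero[OF f]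
    unfolding lifts_def by metis
next
  fix X Z assume *: "X \<in> mod_A n d" "Z \<in> mod_A n d" "retract n d X Z" "lifts n d Z A f B g"
  then obtain i p where i: "i \<in> mHom n d X Z" and p: "p \<in> mHom n d Z X" and pi: "p \<odot> i = mid n d X"
    by (auto simp: retract_def)
  show "lifts n d X A f B g"
    unfolding lifts_def
  proof (intro ballI impI)
    fix h assume h: "h \<in> mHom n d X B" and gh: "g \<odot> h = 0"
    have "g \<odot> (h \<odot> p) = 0" using mcomp_nest[OF gh] by simp
    then obtain h' where h': "h' \<in> mHom n d Z A" "h \<odot> p = f \<odot> h'"
      using *(4) mcomp_in[OF p h] unfolding lifts_def by blast
    have "h = h \<odot> (p \<odot> i)" using mid_right[OF h] pi by simp
    also have "\<dots> = f \<odot> (h' \<odot> i)" using mcomp_nest[OF h'(2)] by simp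
    finally show "\<exists>h'\<in>mHom n d X A. h = f \<odot> h'" using mcomp_in[OF i h'(1)] by blast
  qed
next
  fix X Y Z i j p q
  assume *: "X \<in> mod_A n d" "Y \<in> mod_A n d" "Z \<in> mod_A n d" and bip: "biprod n d Z X Y i j p q"
    and XY: "lifts n d X A f B g" "lifts n d Y A f B g"
  note arrows = biprod_arrows[OF bip]
  show "lifts n d Z A f B g"
    unfolding lifts_def
  proof (intro ballI impI)
    fix h assume h: "h \<in> mHom n d Z B" and gh: "g \<odot> h = 0"
    have "g \<odot> (h \<odot> i) = 0" "g \<odot> (h \<odot> j) = 0" using mcomp_nest[OF gh] by simp_all
    then obtain a b where a: "a \<in> mHom n d X A" "h \<odot> i = f \<odot> a" and b: "b \<in> mHom n d Y A" "h \<odot> j = f \<odot> b"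
      using XY mcomp_in[OF arrows(1) h] mcomp_in[OF arrows(2) h] unfolding lifts_def by meson
    have ab: "a \<odot> p \<in> mHom n d Z A" "b \<odot> q \<in> mHom n d Z A"
      using mcomp_in[OF arrows(3) a(1)] mcomp_in[OF arrows(4) b(1)] by blast+
    have "h = f \<odot> (a \<odot> p + b \<odot> q)"
      using biprod_codecompose[OF bip * h] a(2) b(2) mcomp_right_add[OF f] ab[THEN lands_mHom[OF obj(1)]]
      by (simp add: mcomp_nest[OF a(2)] mcomp_nest[OF b(2)])
    then show "\<exists>h'\<in>mHom n d Z A. h = f \<odot> h'" using mHom_add[OF obj(1) ab] by blast
  qed
qed

lemma colifts_subcat:
  assumes obj: "B \<in> mod_A n d" "C \<in> mod_A n d" and g: "g \<in> mHom n d B C"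
  shows "subcat n d {N \<in> mod_A n d. colifts n d N f B g C}"
proof (rule subcatI)
  fix Z :: "'a kmod" assume "Z \<in> mod_A n d" "mzero n d Z"
  then show "colifts n d Z f B g C"
    using mzero_mHom(2)[of n d Z B] obj mHom_zero[of Z n d C] mcomp_left(3)[of g]
    unfolding colifts_def by metis
next
  fix X Z assume *: "X \<in> mod_A n d" "Z \<in> mod_A n d" "retract n d X Z" "colifts n d Z f B g C"
  then obtain i p where i: "i \<in> mHom n d X Z" and p: "p \<in> mHom n d Z X" and pi: "p \<odot> i = mid n d X"
    by (auto simp: retract_def)
  show "colifts n d X f B g C"
    unfolding colifts_def
  proof (intro ballI impI)
    fix h assume h: "h \<in> mHom n d B X" and hf: "h \<odot> f = 0"
    have "(i \<odot> h) \<odot> f = 0" using hf mcomp_right_zero[OF i] by simp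
    then obtain h' where h': "h' \<in> mHom n d C Z" "i \<odot> h = h' \<odot> g"
      using *(4) mcomp_in[OF h i] unfolding colifts_def by blast
    have "h = p \<odot> (i \<odot> h)" using mcomp_nest[OF pi] mid_left[OF lands_mHom[OF *(1) h]] by simp
    also have "\<dots> = (p \<odot> h') \<odot> g" using h'(2) by simp
    finally show "\<exists>h'\<in>mHom n d C X. h = h' \<odot> g" using mcomp_in[OF h'(1) p] by blast
  qed
next
  fix X Y Z i j p q
  assume *: "X \<in> mod_A n d" "Y \<in> mod_A n d" "Z \<in> mod_A n d" and bip: "biprod n d Z X Y i j p q"
    and XY: "colifts n d X f B g C" "colifts n d Y f B g C"
  note arrows = biprod_arrows[OF bip]
  show "colifts n d Z f B g C"
    unfolding colifts_def
  proof (intro ballI impI)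
    fix h assume h: "h \<in> mHom n d B Z" and hf: "h \<odot> f = 0"
    have "(p \<odot> h) \<odot> f = 0" "(q \<odot> h) \<odot> f = 0"
      using hf mcomp_right_zero[OF arrows(3)] mcomp_right_zero[OF arrows(4)] by simp_all
    then obtain a b where a: "a \<in> mHom n d C X" "p \<odot> h = a \<odot> g" and b: "b \<in> mHom n d C Y" "q \<odot> h = b \<odot> g"
      using XY mcomp_in[OF h arrows(3)] mcomp_in[OF h arrows(4)] unfolding colifts_def by meson
    have ab: "i \<odot> a \<in> mHom n d C Z" "j \<odot> b \<in> mHom n d C Z"
      using mcomp_in[OF a(1) arrows(1)] mcomp_in[OF b(1) arrows(2)] by blast+
    have "h = (i \<odot> a + j \<odot> b) \<odot> g"
      using biprod_decompose[OF bip *(3) h] a(2) b(2) by simp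
    then show "\<exists>h'\<in>mHom n d C Z. h = h' \<odot> g" using mHom_add[OF *(3) ab] by blast
  qed
qed

lemma lifts_madd:
  assumes "A \<in> mod_A n d" "B \<in> mod_A n d" "f \<in> mHom n d A B" "S \<subseteq> mod_A n d"
    "\<And>N. N \<in> S \<Longrightarrow> lifts n d N A f B g" "N \<in> madd n d S"
  shows "lifts n d N A f B g"
  using madd_least[OF lifts_subcat[OF assms(1-3), of g], of S] assms(4-6) by auto

lemma colifts_madd:
  assumes "B \<in> mod_A n d" "C \<in> mod_A n d" "g \<in> mHom n d B C" "S \<subseteq> mod_A n d"
    "\<And>N. N \<in> S \<Longrightarrow> colifts n d N f B g C" "N \<in> madd n d S"
  shows "colifts n d N f B g C"
  using madd_least[OF colifts_subcat[OF assms(1-3), of f], of S] assms(4-6) by auto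

lemma exact_at_lifts:
  assumes "f \<in> mHom n d A B" "g \<odot> f = 0"
  shows "exact_at (mHom n d N A) (\<lambda>h. f \<odot> h) (mHom n d N B) (\<lambda>h. g \<odot> h) \<longleftrightarrow> lifts n d N A f B g"
  using mcomp_in[OF _ assms(1)] mcomp_nest[OF assms(2)]
  unfolding exact_at_def lifts_def by (auto simp: image_iff) 

lemma exact_at_colifts:
  assumes "g \<in> mHom n d B C" "g \<odot> f = 0" "N \<in> mod_A n d"
  shows "exact_at (mHom n d C N) (\<lambda>h. h \<odot> g) (mHom n d B N) (\<lambda>h. h \<odot> f) \<longleftrightarrow> colifts n d N f B g C"
  using mcomp_in[OF assms(1)] mcomp_right_zero[of _ n d C N]
  unfolding exact_at_def colifts_def by (auto simp: image_iff assms(2))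

lemma exact_at_zero:
  assumes "0 \<in> H" "\<phi> 0 = 0"
  shows "exact_at {0} (\<lambda>_. 0) H \<phi> \<longleftrightarrow> (\<forall>h\<in>H. \<phi> h = 0 \<longrightarrow> h = 0)"
  using assms unfolding exact_at_def by auto

section \<open>Torsion resolutions\<close>

text \<open>
  The map that arrives at position \<open>i\<close>.  A zero map arrives at position 0, so that \<open>lifts\<close>
  expresses injectivity there.
\<close>

definition prev :: "(nat \<Rightarrow> 'k::field mor) \<Rightarrow> nat \<Rightarrow> 'k mor" where
  "prev f i = (if i = 0 then 0 else f (i - 1))"

text \<open>
  A $d$-exact sequence witnessing the torsion property of \<open>X 1\<close>, with exactness required only for
  test modules: \<open>S\<close> generates the ambient category and \<open>T\<close> the torsion class.  The sequence is
  prolonged by arbitrary modules and zero maps beyond position \<open>d + 1\<close>, which spares a case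
  distinction at its end.  In the last clause, the zero map at \<open>i = 2\<close> makes the sequence of the
  \<open>V\<^sub>i\<close> start at position 2.
\<close>

definition torsion_res ::
  "nat \<Rightarrow> nat \<Rightarrow> 'k::field kmod set \<Rightarrow> 'k kmod set \<Rightarrow> (nat \<Rightarrow> 'k kmod) \<Rightarrow> (nat \<Rightarrow> 'k mor) \<Rightarrow> bool" where
  "torsion_res n d S T X f \<longleftrightarrow>
     X 0 \<in> madd n d T \<and> (\<forall>i. X i \<in> madd n d S) \<and> (\<forall>i. f i \<in> mHom n d (X i) (X (Suc i))) \<and>
     (\<forall>i. f (Suc i) \<odot> f i = 0) \<and> (\<forall>i>d. f i = 0) \<and>
     (\<forall>N\<in>S. \<forall>i\<le>d. lifts n d N (X (i - 1)) (prev f i) (X i) (f i)) \<and>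
     (\<forall>N\<in>S. \<forall>i\<le>d. colifts n d N (f i) (X (Suc i)) (f (Suc i)) (X (Suc (Suc i)))) \<and>
     (\<forall>N\<in>T. \<forall>i\<in>{2..Suc d}. lifts n d N (X (i - 1)) (if i = 2 then 0 else f (i - 1)) (X i) (f i))"

lemma torsion_res_exact:
  fixes S :: "'k::field kmod set"
  assumes S: "S \<subseteq> mod_A n d" and T: "T \<subseteq> S" and R: "torsion_res n d S T X f"
  shows "d_exact n d (madd n d S) X f"
    and "U \<in> madd n d T \<Longrightarrow> i \<in> {1..d} \<Longrightarrow>
        exact_at (if i = 1 then {0} else mHom n d U (X i)) (\<lambda>g. if i = 1 then 0 else f i \<odot> g)
                 (mHom n d U (X (i + 1))) (\<lambda>g. if i = d then 0 else f (i + 1) \<odot> g)"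
proof -
  have X: "X i \<in> madd n d S" and f: "f i \<in> mHom n d (X i) (X (Suc i))"
    and ff: "f (Suc i) \<odot> f i = 0" and f0: "i > d \<Longrightarrow> f i = 0" for i
    using R by (auto simp: torsion_res_def)
  have sub: "madd n d S \<subseteq> mod_A n d" "madd n d T \<subseteq> mod_A n d"
    using subcat_madd[OF S] subcat_madd[of T n d] S T by (auto simp: subcat_def)
  have X': "X i \<in> mod_A n d" for i using X sub by blast
  have prev: "prev f i \<in> mHom n d (X (i - 1)) (X i)" for i
    using f[of "i - 1"] mHom_zero[OF X'] by (cases i) (simp_all add: prev_def)
  have lifts: "lifts n d N (X (i - 1)) (prev f i) (X i) (f i)" if "N \<in> madd n d S" "i \<le> d" for N i
    by (rule lifts_madd[OF X' X' prev S _ that(1)]) (use R that(2) in \<open>auto simp: torsion_res_def\<close>)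
  have colifts: "colifts n d N (f i) (X (Suc i)) (f (Suc i)) (X (Suc (Suc i)))"
    if "N \<in> madd n d S" "i \<le> d" for N i
    by (rule colifts_madd[OF X' X' f S _ that(1)]) (use R that(2) in \<open>auto simp: torsion_res_def\<close>)
  have dseq: "dseq n d (madd n d S) X f" using X f by (auto simp: dseq_def)
  have "d_kernel n d (madd n d S) X f"
    unfolding d_kernel_def
  proof (intro conjI ballI dseq)
    fix M assume M: "M \<in> madd n d S"
    show "exact_at {0} (\<lambda>_. 0) (mHom n d M (X 0)) (\<lambda>g. f 0 \<odot> g)"
      using lifts[OF M, of 0]
        exact_at_zero[where \<phi> = "\<lambda>g. f 0 \<odot> g", OF mHom_zero[OF X'] mcomp_right_zero[OF f]]
      by (auto simp: lifts_def prev_def)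
    fix i assume "i \<in> {1..d}"
    then show "exact_at (mHom n d M (X (i - 1))) (\<lambda>g. f (i - 1) \<odot> g) (mHom n d M (X i)) (\<lambda>g. f i \<odot> g)"
      using exact_at_lifts[OF f[of "i - 1"], of "f i" M] ff[of "i - 1"] lifts[OF M, of i]
      by (simp add: prev_def)
  qed
  moreover have "d_cokernel n d (madd n d S) X f"
    unfolding d_cokernel_def
  proof (intro conjI ballI dseq)
    fix M assume M: "M \<in> madd n d S"
    then have M': "M \<in> mod_A n d" using sub by blast
    have "g = 0" if "g \<in> mHom n d (X (d + 1)) M" "g \<odot> f d = 0" for g
      using colifts[OF M, of d] that f0[of "Suc d"] mcomp_right_zero
      unfolding colifts_def by fastforce
    then show "exact_at {0} (\<lambda>_. 0) (mHom n d (X (d + 1)) M) (\<lambda>g. g \<odot> f d)"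
      using exact_at_zero[OF mHom_zero[OF M'], where \<phi> = "\<lambda>g. g \<odot> f d"] by auto
    fix i assume "i \<in> {1..d}"
    then obtain j where j: "i = Suc j" "j \<le> d" by (cases i) auto
    show "exact_at (mHom n d (X (i + 1)) M) (\<lambda>g. g \<odot> f i) (mHom n d (X i) M) (\<lambda>g. g \<odot> f (i - 1))"
      using exact_at_colifts[OF f[of i], of "f j" M] ff[of j] colifts[OF M j(2)] M' by (simp add: j(1))
  qed
  ultimately show "d_exact n d (madd n d S) X f" by (simp add: d_exact_def)
  assume U: "U \<in> madd n d T" and i: "i \<in> {1..d}"
  let ?g = "if Suc i = 2 then 0 else f i"
  have g: "?g \<in> mHom n d (X i) (X (Suc i))" using f mHom_zero[OF X'] by simp
  have TS: "T \<subseteq> mod_A n d" using T S by blast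
  have "\<forall>N\<in>T. \<forall>i\<in>{2..Suc d}. lifts n d N (X (i - 1)) (if i = 2 then 0 else f (i - 1)) (X i) (f i)"
    using R unfolding torsion_res_def by (elim conjE)
  then have LT: "lifts n d N (X i) ?g (X (Suc i)) (f (Suc i))" if "N \<in> T" for N
    using that i by (auto dest!: bspec[of T _ N] bspec[of _ _ "Suc i"])
  have L: "lifts n d U (X i) ?g (X (Suc i)) (f (Suc i))"
    by (rule lifts_madd[OF X' X' g TS LT U])
  have last: "(if i = d then 0 else f (i + 1) \<odot> g) = f (Suc i) \<odot> g" for g using f0[of "Suc i"] by auto
  show "exact_at (if i = 1 then {0} else mHom n d U (X i)) (\<lambda>g. if i = 1 then 0 else f i \<odot> g)
      (mHom n d U (X (i + 1))) (\<lambda>g. if i = d then 0 else f (i + 1) \<odot> g)"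
  proof (cases "i = 1")
    case True
    then have "h = 0" if "h \<in> mHom n d U (X (Suc i))" "f (Suc i) \<odot> h = 0" for h
      using L that by (auto simp: lifts_def)
    then have "exact_at {0} (\<lambda>_ :: 'k mor. 0) (mHom n d U (X (Suc i))) (\<lambda>g. f (Suc i) \<odot> g)"
      using exact_at_zero[where \<phi> = "\<lambda>g. f (Suc i) \<odot> g", OF mHom_zero[OF X'] mcomp_right_zero[OF f]]
      by blast
    then show ?thesis unfolding last using True by simp
  next
    case False
    then show ?thesis unfolding last using exact_at_lifts[OF f ff, of U i] L by simp
  qed
qed

section \<open>Direct sums of torsion resolutions\<close>

lemma lifts_biprod:
  assumes A: "biprod n d A A1 A2 iA jA pA qA" and B: "biprod n d B B1 B2 iB jB pB qB"
    and C: "biprod n d C C1 C2 iC jC pC qC"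
    and f: "f1 \<in> mHom n d A1 B1" "f2 \<in> mHom n d A2 B2"
    and g: "g1 \<in> mHom n d B1 C1" "g2 \<in> mHom n d B2 C2"
    and obj: "A \<in> mod_A n d" "A1 \<in> mod_A n d" "A2 \<in> mod_A n d" "B \<in> mod_A n d" "B1 \<in> mod_A n d"
      "B2 \<in> mod_A n d" "C \<in> mod_A n d" "C1 \<in> mod_A n d" "C2 \<in> mod_A n d"
    and L: "lifts n d N A1 f1 B1 g1" "lifts n d N A2 f2 B2 g2"
  shows "lifts n d N A (iB \<odot> (f1 \<odot> pA) + jB \<odot> (f2 \<odot> qA)) B (iC \<odot> (g1 \<odot> pB) + jC \<odot> (g2 \<odot> qB))"
  unfolding lifts_def
proof (intro ballI impI)
  fix h assume h: "h \<in> mHom n d N B" and gh: "(iC \<odot> (g1 \<odot> pB) + jC \<odot> (g2 \<odot> qB)) \<odot> h = 0"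
  note aA = biprod_arrows[OF A] and aB = biprod_arrows[OF B] and aC = biprod_arrows[OF C]
  note S = arrow[OF obj(8,7) aC(1)] arrow[OF obj(9,7) aC(2)] arrow[OF obj(7,8) aC(3)]
    arrow[OF obj(7,9) aC(4)] biprod_simps[OF C obj(8,9,7)] arrow[OF obj(5,8) g(1)] arrow[OF obj(6,9) g(2)]
    arrow[OF obj(2,5) f(1)] arrow[OF obj(3,6) f(2)] lands_closed[OF obj(7)]
    arrow[OF obj(2,1) aA(1)] arrow[OF obj(3,1) aA(2)] biprod_simps[OF A obj(2,3,1)]
    arrow[OF obj(5,4) aB(1)] arrow[OF obj(6,4) aB(2)] arrow[OF obj(1,2) aA(3)] arrow[OF obj(1,3) aA(4)]
  have "pC \<odot> (iC \<odot> (g1 \<odot> (pB \<odot> h)) + jC \<odot> (g2 \<odot> (qB \<odot> h))) = 0"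
    "qC \<odot> (iC \<odot> (g1 \<odot> (pB \<odot> h)) + jC \<odot> (g2 \<odot> (qB \<odot> h))) = 0"
    using gh S(3) mcomp_right_zero[OF aC(3)] mcomp_right_zero[OF aC(4)] by simp_all
  then have "g1 \<odot> (pB \<odot> h) = 0" "g2 \<odot> (qB \<odot> h) = 0" by (simp_all add: S)
  then obtain a b where a: "a \<in> mHom n d N A1" "pB \<odot> h = f1 \<odot> a" and b: "b \<in> mHom n d N A2" "qB \<odot> h = f2 \<odot> b"
    using L mcomp_in[OF h aB(3)] mcomp_in[OF h aB(4)] unfolding lifts_def by meson
  have ab: "iA \<odot> a \<in> mHom n d N A" "jA \<odot> b \<in> mHom n d N A"
    using mcomp_in[OF a(1) aA(1)] mcomp_in[OF b(1) aA(2)] by blast+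
  have "h = iB \<odot> (f1 \<odot> a) + jB \<odot> (f2 \<odot> b)" using biprod_decompose[OF B obj(4) h] a b by simp
  also have "\<dots> = (iB \<odot> (f1 \<odot> pA) + jB \<odot> (f2 \<odot> qA)) \<odot> (iA \<odot> a + jA \<odot> b)"
    by (simp add: S lands_mHom[OF obj(2) a(1)] lands_mHom[OF obj(3) b(1)] mid_left)
  finally show "\<exists>h'\<in>mHom n d N A. h = (iB \<odot> (f1 \<odot> pA) + jB \<odot> (f2 \<odot> qA)) \<odot> h'"
    using mHom_add[OF obj(1) ab] by blast
qed

lemma colifts_biprod:
  assumes A: "biprod n d A A1 A2 iA jA pA qA" and B: "biprod n d B B1 B2 iB jB pB qB"
    and C: "biprod n d C C1 C2 iC jC pC qC"
    and f: "f1 \<in> mHom n d A1 B1" "f2 \<in> mHom n d A2 B2"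
    and g: "g1 \<in> mHom n d B1 C1" "g2 \<in> mHom n d B2 C2"
    and obj: "A \<in> mod_A n d" "A1 \<in> mod_A n d" "A2 \<in> mod_A n d" "B \<in> mod_A n d" "B1 \<in> mod_A n d"
      "B2 \<in> mod_A n d" "C \<in> mod_A n d" "C1 \<in> mod_A n d" "C2 \<in> mod_A n d" "N \<in> mod_A n d"
    and L: "colifts n d N f1 B1 g1 C1" "colifts n d N f2 B2 g2 C2"
  shows "colifts n d N (iB \<odot> (f1 \<odot> pA) + jB \<odot> (f2 \<odot> qA)) B (iC \<odot> (g1 \<odot> pB) + jC \<odot> (g2 \<odot> qB)) C"
  unfolding colifts_def
proof (intro ballI impI)
  fix h assume h: "h \<in> mHom n d B N" and hf: "h \<odot> (iB \<odot> (f1 \<odot> pA) + jB \<odot> (f2 \<odot> qA)) = 0"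
  note aA = biprod_arrows[OF A] and aB = biprod_arrows[OF B] and aC = biprod_arrows[OF C]
  note S = arrow[OF obj(5,4) aB(1)] arrow[OF obj(6,4) aB(2)] arrow[OF obj(1,2) aA(3)]
    arrow[OF obj(1,3) aA(4)] arrow[OF obj(2,1) aA(1)] arrow[OF obj(3,1) aA(2)]
    arrow[OF obj(2,5) f(1)] arrow[OF obj(3,6) f(2)]  arrow[OF obj(5,8) g(1)] arrow[OF obj(6,9) g(2)]
    arrow[OF obj(8,7) aC(1)] arrow[OF obj(9,7) aC(2)] arrow[OF obj(7,8) aC(3)] arrow[OF obj(7,9) aC(4)]
    biprod_simps[OF A obj(2,3,1)] biprod_simps[OF C obj(8,9,7)] arrow[OF obj(4,10) h]
    arrow[OF obj(4,5) aB(3)] arrow[OF obj(4,6) aB(4)]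
  have "h \<odot> (iB \<odot> (f1 \<odot> pA)) + h \<odot> (jB \<odot> (f2 \<odot> qA)) = 0" using hf by (simp add: S)
  then have "(h \<odot> (iB \<odot> (f1 \<odot> pA)) + h \<odot> (jB \<odot> (f2 \<odot> qA))) \<odot> iA = 0"
    "(h \<odot> (iB \<odot> (f1 \<odot> pA)) + h \<odot> (jB \<odot> (f2 \<odot> qA))) \<odot> jA = 0" by simp_all
  then have "(h \<odot> iB) \<odot> f1 = 0" "(h \<odot> jB) \<odot> f2 = 0" by (simp_all add: S)
  then obtain a b where a: "a \<in> mHom n d C1 N" "h \<odot> iB = a \<odot> g1" and b: "b \<in> mHom n d C2 N" "h \<odot> jB = b \<odot> g2"
    using L mcomp_in[OF aB(1) h] mcomp_in[OF aB(2) h] unfolding colifts_def by meson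
  have ab: "a \<odot> pC \<in> mHom n d C N" "b \<odot> qC \<in> mHom n d C N"
    using mcomp_in[OF aC(3) a(1)] mcomp_in[OF aC(4) b(1)] by blast+
  have "h = a \<odot> (g1 \<odot> pB) + b \<odot> (g2 \<odot> qB)"
    using biprod_codecompose[OF B obj(5,6,4) h] a(2) b(2) by simp
  also have "\<dots> = (a \<odot> pC + b \<odot> qC) \<odot> (iC \<odot> (g1 \<odot> pB) + jC \<odot> (g2 \<odot> qB))"
    by (simp add: S arrow[OF obj(8,10) a(1)] arrow[OF obj(9,10) b(1)])
  finally show "\<exists>h'\<in>mHom n d C N. h = h' \<odot> (iC \<odot> (g1 \<odot> pB) + jC \<odot> (g2 \<odot> qB))"
    using mHom_add[OF obj(10) ab] by blast
qed

lemma torsion_resD: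
  assumes "torsion_res n d S T X f"
  shows "X 0 \<in> madd n d T" "X i \<in> madd n d S" "f i \<in> mHom n d (X i) (X (Suc i))"
    "f (Suc i) \<odot> f i = 0" "i > d \<Longrightarrow> f i = 0"
    "N \<in> S \<Longrightarrow> i \<le> d \<Longrightarrow> lifts n d N (X (i - 1)) (prev f i) (X i) (f i)"
    "N \<in> S \<Longrightarrow> i \<le> d \<Longrightarrow> colifts n d N (f i) (X (Suc i)) (f (Suc i)) (X (Suc (Suc i)))"
    "N \<in> T \<Longrightarrow> i \<in> {2..Suc d} \<Longrightarrow> lifts n d N (X (i - 1)) (if i = 2 then 0 else f (i - 1)) (X i) (f i)"
  using assms unfolding torsion_res_def by ((elim conjE; blast))+

text \<open>
  Biproducts of the terms are chosen position by position, except at position 1, where \<open>Z\<close> is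
  prescribed.
\<close>

lemma torsion_res_biprod:
  assumes S: "S \<subseteq> mod_A n d" and T: "T \<subseteq> S" and Z: "Z \<in> mod_A n d" "mbiproduct n d Z (X 1) (Y 1)"
    and X: "torsion_res n d S T X f" and Y: "torsion_res n d S T Y g"
  shows "\<exists>W h. torsion_res n d S T W h \<and> W 1 = Z"
proof -
  note sc = subcat_madd[OF S] subcat_madd[OF order.trans[OF T S]]
  have Xm: "X i \<in> madd n d S" "Y i \<in> madd n d S" for i
    using torsion_resD(2)[OF X] torsion_resD(2)[OF Y] by blast+
  have XY: "X i \<in> mod_A n d" "Y i \<in> mod_A n d" for i
    using Xm subcat_mod_A[OF sc(1)] by blast+
  have f: "f i \<in> mHom n d (X i) (X (Suc i))" "g i \<in> mHom n d (Y i) (Y (Suc i))" for i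
    using torsion_resD(3)[OF X] torsion_resD(3)[OF Y] by blast+
  have "\<exists>V. V \<in> mod_A n d \<and> mbiproduct n d V (X i) (Y i) \<and> (i = 1 \<longrightarrow> V = Z)" for i
    using Z biproduct_exists[OF XY(1) XY(2), of i i] by (cases "i = 1") blast+
  then obtain W where W: "\<And>i. W i \<in> mod_A n d" "\<And>i. mbiproduct n d (W i) (X i) (Y i)" "W 1 = Z"
    by metis
  obtain I J P Q where bip: "biprod n d (W i) (X i) (Y i) (I i) (J i) (P i) (Q i)" for i
    using W(2) unfolding mbiproduct_iff by metis
  define h where "h i = I (Suc i) \<odot> (f i \<odot> P i) + J (Suc i) \<odot> (g i \<odot> Q i)" for i
  note bipa = biprod_arrows[OF bip]
  have h: "h i \<in> mHom n d (W i) (W (Suc i))" for i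
    unfolding h_def
    by (rule mHom_add[OF W(1) mcomp_in[OF mcomp_in[OF bipa(3) f(1)] bipa(1)]
          mcomp_in[OF mcomp_in[OF bipa(4) f(2)] bipa(2)]])
  have zero: "I i \<odot> (0 \<odot> P j) + J i \<odot> (0 \<odot> Q j) = 0" for i j
    using mcomp_right_zero[OF bipa(1)] mcomp_right_zero[OF bipa(2)] by simp
  have Wm: "W i \<in> madd n d S" for i
    by (rule subcat_sum[OF sc(1) Xm W(1,2)])
  have W0: "W 0 \<in> madd n d T"
    by (rule subcat_sum[OF sc(2) torsion_resD(1)[OF X] torsion_resD(1)[OF Y] W(1,2)])
  have hh: "h (Suc i) \<odot> h i = 0" for i
  proof -
    note ff = torsion_resD(4)[OF X] torsion_resD(4)[OF Y]
    note ff = ff ff[THEN mcomp_nest]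
    show ?thesis
      by (simp add: h_def ff biprod_simps[OF bip XY W(1)] arrow[OF XY(1) W(1) bipa(1)]
          arrow[OF XY(2) W(1) bipa(2)] arrow[OF W(1) XY(1) bipa(3)] arrow[OF W(1) XY(2) bipa(4)]
          arrow[OF XY(1) XY(1) f(1)] arrow[OF XY(2) XY(2) f(2)])
  qed
  have hd: "h i = 0" if "i > d" for i
    using zero that by (simp add: h_def torsion_resD(5)[OF X] torsion_resD(5)[OF Y])
  have L: "lifts n d N (W (i - 1)) (I i \<odot> (f' \<odot> P (i - 1)) + J i \<odot> (g' \<odot> Q (i - 1))) (W i) (h i)"
    if "lifts n d N (X (i - 1)) f' (X i) (f i)" "lifts n d N (Y (i - 1)) g' (Y i) (g i)"
      "f' \<in> mHom n d (X (i - 1)) (X i)" "g' \<in> mHom n d (Y (i - 1)) (Y i)" for N i f' g'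
    unfolding h_def
    by (rule lifts_biprod[OF bip bip bip that(3,4) f W(1) XY W(1) XY W(1) XY that(1,2)])
  have C: "colifts n d N (h i) (W (Suc i)) (h (Suc i)) (W (Suc (Suc i)))"
    if "colifts n d N (f i) (X (Suc i)) (f (Suc i)) (X (Suc (Suc i)))"
      "colifts n d N (g i) (Y (Suc i)) (g (Suc i)) (Y (Suc (Suc i)))" "N \<in> mod_A n d" for N i
    unfolding h_def
    by (rule colifts_biprod[OF bip bip bip f f W(1) XY W(1) XY W(1) XY that(3,1,2)])
  have "torsion_res n d S T W h"
    unfolding torsion_res_def
  proof (intro conjI allI ballI impI W0 Wm h hh hd)
    fix N i assume N: "N \<in> S" and i: "i \<le> d"
    have 1: "lifts n d N (X (i - 1)) (prev f i) (X i) (f i)" "lifts n d N (Y (i - 1)) (prev g i) (Y i) (g i)"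
      using torsion_resD(6)[OF X N i] torsion_resD(6)[OF Y N i] .
    have 2: "prev f i \<in> mHom n d (X (i - 1)) (X i)" "prev g i \<in> mHom n d (Y (i - 1)) (Y i)"
      using f[of "i - 1"] mHom_zero[OF XY(1)] mHom_zero[OF XY(2)] by (cases i; simp add: prev_def)+
    have "prev h i = I i \<odot> (prev f i \<odot> P (i - 1)) + J i \<odot> (prev g i \<odot> Q (i - 1))"
      using zero by (cases i) (simp_all add: prev_def h_def)
    then show "lifts n d N (W (i - 1)) (prev h i) (W i) (h i)" using L[OF 1 2] by simp
    show "colifts n d N (h i) (W (Suc i)) (h (Suc i)) (W (Suc (Suc i)))"
      using C[OF torsion_resD(7)[OF X N i] torsion_resD(7)[OF Y N i]] N S by blast
  next
    fix N i assume N: "N \<in> T" and i: "i \<in> {2..Suc d}"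
    let ?f = "if i = 2 then 0 else f (i - 1)" and ?g = "if i = 2 then 0 else g (i - 1)"
    have 1: "lifts n d N (X (i - 1)) ?f (X i) (f i)" "lifts n d N (Y (i - 1)) ?g (Y i) (g i)"
      using torsion_resD(8)[OF X N i] torsion_resD(8)[OF Y N i] .
    have 2: "?f \<in> mHom n d (X (i - 1)) (X i)" "?g \<in> mHom n d (Y (i - 1)) (Y i)"
      using f[of "i - 1"] mHom_zero[OF XY(1)] mHom_zero[OF XY(2)] i by simp_all
    have "(if i = 2 then 0 else h (i - 1)) = I i \<odot> (?f \<odot> P (i - 1)) + J i \<odot> (?g \<odot> Q (i - 1))"
      using zero i by (auto simp: h_def)
    then show "lifts n d N (W (i - 1)) (if i = 2 then 0 else h (i - 1)) (W i) (h i)"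
      using L[OF 1 2] by simp
  qed
  then show ?thesis using W(3) by blast
qed

lemma lifts_mid: "lifts n d N A 0 B (mid n d B)" if "A \<in> mod_A n d" "B \<in> mod_A n d"
  using mid_left[OF lands_mHom[OF that(2)]] mHom_zero[OF that(1)] by (auto simp: lifts_def)

lemma lifts_zero_middle:
  assumes "mzero n d B" "A \<in> mod_A n d" "B \<in> mod_A n d" "N \<in> mod_A n d" "f \<in> mHom n d A B"
  shows "lifts n d N A f B g"
  using mzero_mHom(2)[OF assms(1,3,4)] mHom_zero[OF assms(2)] mcomp_right_zero[OF assms(5)]
  unfolding lifts_def by metis

lemma colifts_zero_middle:
  assumes "mzero n d B" "B \<in> mod_A n d" "N \<in> mod_A n d"
  shows "colifts n d N f B g C"
  using mzero_mHom(1)[OF assms(1,2,3)] mHom_zero[OF assms(3)] mcomp_left(3)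
  unfolding colifts_def by metis

text \<open>
  The sequence is \<open>M \<rightarrow> M \<rightarrow> 0 \<rightarrow> \<dots>\<close> with the identity as its first map.
\<close>

lemma torsion_res_torsion:
  assumes S: "S \<subseteq> mod_A n d" and T: "T \<subseteq> S" and M: "M \<in> madd n d T"
  shows "\<exists>X f. torsion_res n d S T X f \<and> X 1 = M"
proof -
  obtain Z :: "'a kmod" where Z: "Z \<in> mod_A n d" "mzero n d Z" using zero_module by blast
  define X where "X i = (if i \<le> 1 then M else Z)" for i :: nat
  define f where "f i = (if i = 0 then mid n d M else 0)" for i :: nat
  have ZS: "Z \<in> madd n d S" using subcat_madd[OF S] Z by (auto dest: subcat_mod_A subcat_zero)
  have MS: "M \<in> madd n d S" using madd_mono[OF T] M by blast
  then have M': "M \<in> mod_A n d" using subcat_madd[OF S] by (auto dest: subcat_mod_A subcat_zero)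
  have X: "X i \<in> mod_A n d" for i using Z M' by (auto simp: X_def)
  have f: "f i \<in> mHom n d (X i) (X (Suc i))" for i
    using mid_in[OF M'] mHom_zero Z(1) by (auto simp: f_def X_def)
  have "torsion_res n d S T X f"
    unfolding torsion_res_def
  proof (intro conjI allI ballI impI f)
    fix N i assume "N \<in> S" "i \<le> d"
    then have N: "N \<in> mod_A n d" using S by blast
    have p: "prev f i \<in> mHom n d (X (i - 1)) (X i)" 
      using f[of "i - 1"] mHom_zero[OF X] by (cases i) (simp_all add: prev_def)
    consider "i = 0" | "i = 1" | "i > 1" by linarith
    then show "lifts n d N (X (i - 1)) (prev f i) (X i) (f i)"
    proof cases
      case 1
      then show ?thesis using lifts_mid[OF M' M'] by (simp add: X_def f_def prev_def)
    next
      case 2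
      then show ?thesis using mid_left[OF lands_mHom[OF M']] 
        by (auto simp add: X_def f_def prev_def lifts_def)
    next
      case 3
      then show ?thesis using lifts_zero_middle[OF Z(2) X Z(1) N, of "prev f i" "i - 1"] p by (simp add: X_def)
    qed
    show "colifts n d N (f i) (X (Suc i)) (f (Suc i)) (X (Suc (Suc i)))"
    proof (cases "i = 0")
      case True
      then show ?thesis using mid_right[of _ n d M N] mHom_zero[OF N]
        by (auto simp add: X_def f_def colifts_def intro!: bexI[of _ 0])
    next
      case False
      then show ?thesis using colifts_zero_middle[OF Z(2,1) N] by (simp add: X_def)
    qed
  next
    fix N i assume "N \<in> T" and i: "i \<in> {2..Suc d}"
    then have N: "N \<in> mod_A n d" using S T by blast
    show "lifts n d N (X (i - 1)) (if i = 2 then 0 else f (i - 1)) (X i) (f i)"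
      using lifts_zero_middle[OF Z(2) X[of "i - 1"] Z(1) N mHom_zero[OF Z(1)]] i
      by (cases "i = 2") (simp_all add: X_def f_def)
  qed (use M MS ZS in \<open>auto simp: X_def f_def mcomp_right_zero[OF mHom_zero[OF M']]\<close>)
  then show ?thesis by (intro exI[of _ X] exI[of _ f]) (simp add: X_def)
qed

text \<open>
  The sequence is \<open>0 \<rightarrow> M \<rightarrow> M \<rightarrow> 0 \<rightarrow> \<dots>\<close> with the identity as its second map.
\<close>

lemma torsion_res_torsion_free:
  assumes d: "d \<ge> 1" and S: "S \<subseteq> mod_A n d" and T: "T \<subseteq> S" and M: "M \<in> madd n d S"
    and free: "\<And>N h. N \<in> T \<Longrightarrow> h \<in> mHom n d N M \<Longrightarrow> h = 0"
  shows "\<exists>X f. torsion_res n d S T X f \<and> X 1 = M"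
proof -
  obtain Z :: "'a kmod" where Z: "Z \<in> mod_A n d" "mzero n d Z" using zero_module by blast
  define X where "X i = (if i = 1 \<or> i = 2 then M else Z)" for i :: nat
  define f where "f i = (if i = 1 then mid n d M else 0)" for i :: nat
  have ZS: "Z \<in> madd n d S" using subcat_madd[OF S] Z by (auto dest: subcat_mod_A subcat_zero)
  have ZT: "Z \<in> madd n d T" using subcat_madd[OF order.trans[OF T S]] Z by (auto dest: subcat_mod_A subcat_zero)
  have M': "M \<in> mod_A n d" using subcat_madd[OF S] M by (auto dest: subcat_mod_A subcat_zero)
  have X: "X i \<in> mod_A n d" for i using Z M' by (auto simp: X_def)
  have f: "f i \<in> mHom n d (X i) (X (Suc i))" for i
    using mid_in[OF M'] mHom_zero[OF M'] mHom_zero[OF Z(1)] by (auto simp: f_def X_def)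
  have "torsion_res n d S T X f"
    unfolding torsion_res_def
  proof (intro conjI allI ballI impI f)
    fix N i assume "N \<in> S" and i: "i \<le> d"
    then have N: "N \<in> mod_A n d" using S by blast
    have p: "prev f i \<in> mHom n d (X (i - 1)) (X i)" 
      using f[of "i - 1"] mHom_zero[OF X] by (cases i) (simp_all add: prev_def)
    consider "i = 1" | "i = 2" | "X i = Z" unfolding X_def by metis
    then show "lifts n d N (X (i - 1)) (prev f i) (X i) (f i)"
    proof cases
      case 1
      then show ?thesis using lifts_mid[OF Z(1) M'] i by (simp add: X_def f_def prev_def)
    next
      case 2
      then show ?thesis using mid_left[OF lands_mHom[OF M']] i
        by (auto simp add: X_def f_def prev_def lifts_def)
    next
      case 3
      then show ?thesis using lifts_zero_middle[OF Z(2) X Z(1) N, of "prev f i" "i - 1"] p by simp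
    qed
    consider "i = 0" | "i = 1" | "X (Suc i) = Z" unfolding X_def by (metis One_nat_def Suc_1 nat.inject)
    then show "colifts n d N (f i) (X (Suc i)) (f (Suc i)) (X (Suc (Suc i)))"
    proof cases
      case 1
      then show ?thesis using mid_right[of _ n d M N] d by (auto simp add: X_def f_def colifts_def)
    next
      case 2
      then show ?thesis using mid_right[of _ n d M N] mHom_zero[OF N] i
        by (auto simp add: X_def f_def colifts_def intro!: bexI[of _ 0])
    next
      case 3
      then show ?thesis using colifts_zero_middle[OF Z(2,1) N] by simp
    qed
  next
    fix N i assume NT: "N \<in> T" and i: "i \<in> {2..Suc d}"
    then have N: "N \<in> mod_A n d" using S T by blast
    show "lifts n d N (X (i - 1)) (if i = 2 then 0 else f (i - 1)) (X i) (f i)"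
    proof (cases "i = 2")
      case True
      then show ?thesis using free[OF NT] mHom_zero[OF M'] by (auto simp: lifts_def X_def)
    next
      case False
      then have Xi: "X i = Z" using i by (simp add: X_def)
      moreover have "Suc (i - 1) = i" using i by simp
      ultimately have "f (i - 1) \<in> mHom n d (X (i - 1)) Z" using f[of "i - 1"] by metis
      then show ?thesis
        using lifts_zero_middle[OF Z(2) X[of "i - 1"] Z(1) N] False Xi by simp
    qed
  qed (use d M ZS ZT in \<open>auto simp: X_def f_def mcomp_right_zero[OF mid_in[OF M']]\<close>)
  then show ?thesis by (intro exI[of _ X] exI[of _ f]) (simp add: X_def)
qed

section \<open>Exactness tested on interval modules\<close>

text \<open>
  For canonical maps \<open>M\<^sub>a \<rightarrow> M\<^sub>b \<rightarrow> M\<^sub>c\<close> and a test module \<open>M\<^sub>w\<close>, exactness at \<open>M\<^sub>b\<close> holds for one of three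
  reasons: there is no map between \<open>M\<^sub>w\<close> and \<open>M\<^sub>b\<close>; or no nonzero map becomes zero; or every map lifts.
\<close>

lemma lifts_none:
  fixes f :: "'k::field mor"
  assumes "d \<ge> 1" "w \<in> os n (d + 1)" "b \<in> os n (d + 1)" "\<not> interlaced d w b"
    "A \<in> mod_A n d" "f \<in> mHom n d A (Mint n d b)"
  shows "lifts n d (Mint n d w) A f (Mint n d b) g"
  unfolding lifts_def
proof (intro ballI impI)
  fix h :: "'k mor" assume "h \<in> mHom n d (Mint n d w) (Mint n d b)"
  then have "h = 0" using hom_Mint[OF assms(1-3)] assms(4) by auto
  then have "h = f \<odot> 0" using mcomp_right_zero[OF assms(6)] by simp
  then show "\<exists>h'\<in>mHom n d (Mint n d w) A. h = f \<odot> h'" using mHom_zero[OF assms(5)] by blast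
qed

lemma colifts_none:
  fixes g :: "'k::field mor"
  assumes "d \<ge> 1" "b \<in> os n (d + 1)" "w \<in> os n (d + 1)" "\<not> interlaced d b w"
  shows "colifts n d (Mint n d w) f (Mint n d b) g C"
  unfolding colifts_def
proof (intro ballI impI)
  fix h :: "'k mor" assume "h \<in> mHom n d (Mint n d b) (Mint n d w)"
  then have "h = 0 \<odot> g" using hom_Mint[OF assms(1-3)] assms(4) by auto
  then show "\<exists>h'\<in>mHom n d C (Mint n d w). h = h' \<odot> g" using mHom_zero[OF Mint_in_mod_A] by blast
qed

lemma can_comp_scale:
  fixes s :: "'k::field"
  assumes "d \<ge> 1" "x \<in> os n (d + 1)" "z \<in> os n (d + 1)"
    "interlaced d x y" "interlaced d y z" "interlaced d x z"
  shows "can n d y z \<odot> mscale s (can n d x y) = mscale s (can n d x z)"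
    and "mscale s (can n d y z) \<odot> can n d x y = mscale s (can n d x z)"
  by (simp_all add: can_comp[OF assms(1-5)] assms(6)
    mcomp_right_scale[OF can_in_mHom[OF assms(5)] lands_mHom[OF Mint_in_mod_A can_in_mHom[OF assms(4)]]])

lemma lifts_injective:
  fixes f :: "'k::field mor"
  assumes d: "d \<ge> 1" and os: "w \<in> os n (d + 1)" "b \<in> os n (d + 1)" "c \<in> os n (d + 1)"
    and bc: "interlaced d b c" and wc: "interlaced d w c"
    and A: "A \<in> mod_A n d" "f \<in> mHom n d A (Mint n d b)"
  shows "lifts n d (Mint n d w) A f (Mint n d b) (can n d b c)"
proof (cases "interlaced d w b")
  case True
  show ?thesis
    unfolding lifts_def
  proof (intro ballI impI)
    fix h :: "'k mor" assume "h \<in> mHom n d (Mint n d w) (Mint n d b)" and zero: "can n d b c \<odot> h = 0"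
    then obtain s where s: "h = mscale s (can n d w b)" using hom_Mint[OF d os(1,2)] True by auto
    then have "mscale s (can n d w c) = 0" using zero by (simp only: s can_comp_scale(1)[OF d os(1,3) True bc wc])
    then have "h = f \<odot> 0" by (simp add: s mscale_zero_iff can_nonzero[OF os(1) wc] mcomp_right_zero[OF A(2)])
    then show "\<exists>h'\<in>mHom n d (Mint n d w) A. h = f \<odot> h'" using mHom_zero[OF A(1)] by blast
  qed
qed (rule lifts_none[OF d os(1,2) _ A])

lemma lifts_surjective:
  fixes g :: "'k::field mor"
  assumes d: "d \<ge> 1" and os: "w \<in> os n (d + 1)" "b \<in> os n (d + 1)"
    and "interlaced d w a" "interlaced d a b" "interlaced d w b"
  shows "lifts n d (Mint n d w) (Mint n d a) (can n d a b) (Mint n d b) g"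
  unfolding lifts_def
proof (intro ballI impI)
  fix h :: "'k mor" assume "h \<in> mHom n d (Mint n d w) (Mint n d b)"
  then obtain s where "h = mscale s (can n d w b)" using hom_Mint[OF d os] assms(6) by auto
  then have "h = can n d a b \<odot> mscale s (can n d w a)"
    by (simp add: can_comp_scale(1)[OF d os assms(4-6)])
  then show "\<exists>h'\<in>mHom n d (Mint n d w) (Mint n d a). h = can n d a b \<odot> h'"
    using mHom_scale[OF Mint_in_mod_A can_in_mHom[OF assms(4)]] by blast
qed

lemma colifts_injective:
  fixes g :: "'k::field mor"
  assumes d: "d \<ge> 1" and os: "a \<in> os n (d + 1)" "b \<in> os n (d + 1)" "w \<in> os n (d + 1)"
    and ab: "interlaced d a b" and aw: "interlaced d a w"
  shows "colifts n d (Mint n d w) (can n d a b) (Mint n d b) g C"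
proof (cases "interlaced d b w")
  case True
  show ?thesis
    unfolding colifts_def
  proof (intro ballI impI)
    fix h :: "'k mor" assume "h \<in> mHom n d (Mint n d b) (Mint n d w)" and zero: "h \<odot> can n d a b = 0"
    then obtain s where s: "h = mscale s (can n d b w)" using hom_Mint[OF d os(2,3)] True by auto
    then have "mscale s (can n d a w) = 0" using zero by (simp only: s can_comp_scale(2)[OF d os(1,3) ab True aw])
    then have "h = 0 \<odot> g" by (simp add: s mscale_zero_iff can_nonzero[OF os(1) aw])
    then show "\<exists>h'\<in>mHom n d C (Mint n d w). h = h' \<odot> g" using mHom_zero[OF Mint_in_mod_A] by blast
  qed
qed (rule colifts_none[OF d os(2,3)])

lemma colifts_surjective:
  fixes f :: "'k::field mor"
  assumes d: "d \<ge> 1" and os: "b \<in> os n (d + 1)" "w \<in> os n (d + 1)"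
    and "interlaced d b c" "interlaced d c w" "interlaced d b w"
  shows "colifts n d (Mint n d w) f (Mint n d b) (can n d b c) (Mint n d c)"
  unfolding colifts_def
proof (intro ballI impI)
  fix h :: "'k mor" assume "h \<in> mHom n d (Mint n d b) (Mint n d w)"
  then obtain s where "h = mscale s (can n d b w)" using hom_Mint[OF d os] assms(6) by auto
  then have "h = mscale s (can n d c w) \<odot> can n d b c"
    by (simp only: can_comp_scale(2)[OF d os assms(4-6)])
  then show "\<exists>h'\<in>mHom n d (Mint n d c) (Mint n d w). h = h' \<odot> can n d b c"
    using mHom_scale[OF Mint_in_mod_A can_in_mHom[OF assms(5)]] by blast
qed

section \<open>The $d$-exact sequence of a truncation\<close>

text \<open>
  For given \<open>a\<close>, the tuple \<open>b\<close> is the largest one with \<open>a \<leadsto> \<tau>\<^sub>d(b)\<close> and its last entry.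
\<close>

definition staircase :: "nat \<Rightarrow> nat \<Rightarrow> nat list \<Rightarrow> nat list \<Rightarrow> bool" where
  "staircase n d a b \<longleftrightarrow> a \<in> os n (d + 1) \<and> b \<in> os n (d + 1) \<and>
    (\<forall>i<d. b ! i = Suc (a ! Suc i)) \<and> a ! d < b ! d"

text \<open>
  The last \<open>k\<close> entries of \<open>a\<close> are replaced by those of \<open>b\<close>.  Among all ways to choose one of \<open>a\<^sub>i\<close> and
  \<open>b\<^sub>i\<close> for each \<open>i\<close>, only these are non-decreasing, because \<open>b\<^sub>i > a\<^sub>i\<^sub>+\<^sub>1\<close>.
\<close>

definition mixed :: "nat \<Rightarrow> nat list \<Rightarrow> nat list \<Rightarrow> nat \<Rightarrow> nat list" where
  "mixed d a b k = take (Suc d - k) a @ drop (Suc d - k) b"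

lemma mixed_nth:
  assumes "staircase n d a b" "i \<le> d"
  shows "mixed d a b k ! i = (if i + k \<le> d then a ! i else b ! i)"
  using assms by (auto simp: mixed_def staircase_def os_iff nth_append)

lemma mixed_length: "staircase n d a b \<Longrightarrow> length (mixed d a b k) = Suc d"
  by (simp add: mixed_def staircase_def os_iff)

lemma staircaseD:
  assumes "staircase n d a b"
  shows "i \<le> j \<Longrightarrow> j \<le> d \<Longrightarrow> a ! i \<le> a ! j" "i \<le> j \<Longrightarrow> j \<le> d \<Longrightarrow> b ! i \<le> b ! j"
    "i \<le> d \<Longrightarrow> a ! i < b ! i" "i < d \<Longrightarrow> b ! i = Suc (a ! Suc i)" "i \<le> d \<Longrightarrow> b ! i < n"
proof -
  show *: "i \<le> j \<Longrightarrow> j \<le> d \<Longrightarrow> a ! i \<le> a ! j" "i \<le> j \<Longrightarrow> j \<le> d \<Longrightarrow> b ! i \<le> b ! j"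
    "i < d \<Longrightarrow> b ! i = Suc (a ! Suc i)" "i \<le> d \<Longrightarrow> b ! i < n" for i j
    using assms by (auto simp: staircase_def os_iff)
  assume "i \<le> d"
  then show "a ! i < b ! i"
    using *(1)[of i "Suc i"] *(3)[of i] assms by (cases "i = d") (auto simp: staircase_def)
qed

lemma mixed_os: assumes st: "staircase n d a b" shows "mixed d a b k \<in> os n (d + 1)"
  unfolding os_iff
proof (intro conjI allI impI)
  show "length (mixed d a b k) = d + 1" using mixed_length[OF st] by simp
  show "mixed d a b k ! i < n" if "i < d + 1" for i
    using staircaseD(3,5)[OF st, of i] that by (auto simp: mixed_nth[OF st])
  fix i j assume "i \<le> j" "j < d + 1"
  then show "mixed d a b k ! i \<le> mixed d a b k ! j"
    using staircaseD(1,2)[OF st, of i j] staircaseD(3)[OF st, of j] by (auto simp: mixed_nth[OF st])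
qed

lemma mixed_step:
  assumes st: "staircase n d a b"
  shows "interlaced d (mixed d a b k) (mixed d a b (Suc k))"
  unfolding interlaced_def
proof (intro conjI allI impI)
  fix i assume "i \<le> d"
  then show "mixed d a b k ! i \<le> mixed d a b (Suc k) ! i"
    using staircaseD(3)[OF st, of i] by (simp add: mixed_nth[OF st])
next
  fix i assume "i < d"
  then show "mixed d a b (Suc k) ! i \<le> mixed d a b k ! Suc i"
    using staircaseD(1,2)[OF st, of i "Suc i"] by (simp add: mixed_nth[OF st])
qed

lemma mixed_no_skip:
  assumes st: "staircase n d a b" and "k < d"
  shows "\<not> interlaced d (mixed d a b k) (mixed d a b (Suc (Suc k)))"
proof
  assume "interlaced d (mixed d a b k) (mixed d a b (Suc (Suc k)))"
  moreover have "d - Suc k < d" "Suc (d - Suc k) = d - k" using \<open>k < d\<close> by auto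
  ultimately have "mixed d a b (Suc (Suc k)) ! (d - Suc k) \<le> mixed d a b k ! (d - k)"
    unfolding interlaced_def by metis
  then show False
    using staircaseD(4)[OF st, of "d - Suc k"] \<open>k < d\<close> \<open>Suc (d - Suc k) = d - k\<close>
    by (simp add: mixed_nth[OF st])
qed

text \<open>
  The tuples number \<open>k\<close> and \<open>k + 1\<close> differ in at most one entry, say number \<open>i\<close>.  Raising it from \<open>a\<^sub>i\<close> to
  \<open>b\<^sub>i = a\<^sub>i\<^sub>+\<^sub>1 + 1\<close> destroys the relation to \<open>w\<close> only if \<open>w\<^sub>i\<^sub>+\<^sub>1 \<le> a\<^sub>i\<^sub>+\<^sub>1\<close>, and this is what the relation to
  the tuple number \<open>k - 1\<close> needs in addition.
\<close>

lemma mixed_lift: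
  assumes st: "staircase n d a b" and wk: "interlaced d w (mixed d a b k)"
    and not: "\<not> interlaced d w (mixed d a b (Suc k))"
  shows "k \<ge> 1" "interlaced d w (mixed d a b (k - 1))"
proof -
  have up: "mixed d a b l ! i \<le> mixed d a b (Suc l) ! i" if "i \<le> d" for i l
    using mixed_step[OF st] that by (simp add: interlaced_def)
  have "\<exists>i<d. w ! Suc i < mixed d a b (Suc k) ! i"
  proof (rule ccontr)
    assume "\<not> (\<exists>i<d. w ! Suc i < mixed d a b (Suc k) ! i)"
    moreover have "w ! i \<le> mixed d a b (Suc k) ! i" if "i \<le> d" for i
      using wk up[OF that, of k] that unfolding interlaced_def by (meson le_trans)
    ultimately show False using not unfolding interlaced_def not_less[symmetric] by blast
  qed
  then obtain i where i: "i < d" "w ! Suc i < mixed d a b (Suc k) ! i" by blast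
  have "mixed d a b k ! i \<le> w ! Suc i" using wk i(1) by (simp add: interlaced_def)
  then have ik: "i + k = d" using i by (auto simp: mixed_nth[OF st] split: if_splits)
  then show k: "k \<ge> 1" using i by simp
  have w: "w ! Suc i \<le> a ! Suc i"
    using i staircaseD(4)[OF st, of i] ik by (simp add: mixed_nth[OF st])
  show "interlaced d w (mixed d a b (k - 1))"
    unfolding interlaced_def
  proof (intro conjI allI impI)
    fix j assume j: "j \<le> d"
    then have "w ! j \<le> mixed d a b k ! j" using wk by (simp add: interlaced_def)
    then show "w ! j \<le> mixed d a b (k - 1) ! j"
      using w ik k j by (cases "j = Suc i") (auto simp: mixed_nth[OF st] split: if_splits)
  next
    fix j assume j: "j < d"
    then have "mixed d a b k ! j \<le> w ! Suc j" using wk by (simp add: interlaced_def)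
    then show "mixed d a b (k - 1) ! j \<le> w ! Suc j"
      using up[of j "k - 1"] k j by simp
  qed
qed

text \<open>
  As for \<open>mixed_lift\<close>: with \<open>i + 1\<close> the entry in which the tuples number \<open>k\<close> and \<open>k + 1\<close> differ, the
  relation fails for the former only if \<open>w\<^sub>i > a\<^sub>i\<^sub>+\<^sub>1\<close>, and then \<open>w\<^sub>i \<ge> b\<^sub>i\<close>.
\<close>

lemma mixed_colift:
  assumes st: "staircase n d a b" and kw: "interlaced d (mixed d a b (Suc k)) w"
    and not: "\<not> interlaced d (mixed d a b k) w"
  shows "k < d" "interlaced d (mixed d a b (Suc (Suc k))) w"
proof -
  have up: "mixed d a b l ! i \<le> mixed d a b (Suc l) ! i" if "i \<le> d" for i l
    using mixed_step[OF st] that by (simp add: interlaced_def)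
  have "\<exists>i<d. mixed d a b k ! Suc i < w ! i"
  proof (rule ccontr)
    assume "\<not> (\<exists>i<d. mixed d a b k ! Suc i < w ! i)"
    moreover have "mixed d a b k ! i \<le> w ! i" if "i \<le> d" for i
      using kw up[OF that, of k] that unfolding interlaced_def by (meson le_trans)
    ultimately show False using not unfolding interlaced_def not_less[symmetric] by blast
  qed
  then obtain i where i: "i < d" "mixed d a b k ! Suc i < w ! i" by blast
  have "w ! i \<le> mixed d a b (Suc k) ! Suc i" using kw i(1) by (simp add: interlaced_def)
  then have ik: "Suc i + k = d" using i by (auto simp: mixed_nth[OF st] split: if_splits)
  then show "k < d" by simp
  have w: "b ! i \<le> w ! i"
    using i staircaseD(4)[OF st, of i] ik by (simp add: mixed_nth[OF st])
  show "interlaced d (mixed d a b (Suc (Suc k))) w"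
    unfolding interlaced_def
  proof (intro conjI allI impI)
    fix j assume j: "j \<le> d"
    then have "mixed d a b (Suc k) ! j \<le> w ! j" using kw by (simp add: interlaced_def)
    then show "mixed d a b (Suc (Suc k)) ! j \<le> w ! j"
      using w ik j by (cases "j = i") (auto simp: mixed_nth[OF st] split: if_splits)
  next
    fix j assume j: "j < d"
    then have "w ! j \<le> mixed d a b (Suc k) ! Suc j" using kw by (simp add: interlaced_def)
    then show "w ! j \<le> mixed d a b (Suc (Suc k)) ! Suc j"
      using up[of "Suc j" "Suc k"] j by simp
  qed
qed

definition mixed_can :: "nat \<Rightarrow> nat \<Rightarrow> nat list \<Rightarrow> nat list \<Rightarrow> nat \<Rightarrow> 'k::field mor" where
  "mixed_can n d a b k = (if k \<le> d then can n d (mixed d a b k) (mixed d a b (Suc k)) else 0)"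

lemma mixed_can_in:
  "staircase n d a b \<Longrightarrow>
    mixed_can n d a b k \<in> mHom n d (Mint n d (mixed d a b k)) (Mint n d (mixed d a b (Suc k)))"
  by (simp add: mixed_can_def can_in_mHom mixed_step mHom_zero Mint_in_mod_A)

lemma mixed_can_comp:
  assumes d: "d \<ge> 1" and st: "staircase n d a b"
  shows "mixed_can n d a b (Suc k) \<odot> mixed_can n d a b k = (0 :: 'k::field mor)"
  by (simp add: mixed_can_def mixed_no_skip[OF st]
      can_comp[OF d mixed_os[OF st] mixed_os[OF st] mixed_step[OF st] mixed_step[OF st]])

lemma mixed_lifts:
  assumes d: "d \<ge> 1" and st: "staircase n d a b" and w: "w \<in> os n (d + 1)" and k: "k \<le> d"
  shows "lifts n d (Mint n d w) (Mint n d (mixed d a b (k - 1))) (prev (mixed_can n d a b) k)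
    (Mint n d (mixed d a b k)) (mixed_can n d a b k :: 'k::field mor)"
proof -
  note os = mixed_os[OF st]
  have f: "prev (mixed_can n d a b) k \<in>
      mHom n d (Mint n d (mixed d a b (k - 1))) (Mint n d (mixed d a b k) :: 'k kmod)"
    using mixed_can_in[OF st, of "k - 1"] by (cases k) (simp_all add: prev_def mHom_zero Mint_in_mod_A)
  consider "\<not> interlaced d w (mixed d a b k)" | "interlaced d w (mixed d a b (Suc k))"
    | "interlaced d w (mixed d a b k)" "k \<ge> 1" "interlaced d w (mixed d a b (k - 1))"
    using mixed_lift[OF st, of w k] by blast
  then show ?thesis
  proof cases
    case 1
    then show ?thesis using lifts_none[OF d w os _ Mint_in_mod_A f] by blast
  next
    case 2
    then show ?thesis
      using k by (simp only: mixed_can_def[of n d a b k] if_True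
          lifts_injective[OF d w os os mixed_step[OF st] 2 Mint_in_mod_A f])
  next
    case 3
    have "interlaced d (mixed d a b (k - 1)) (mixed d a b k)"
      using mixed_step[OF st, of "k - 1"] 3(2) by simp
    moreover have "prev (mixed_can n d a b) k = (can n d (mixed d a b (k - 1)) (mixed d a b k) :: 'k mor)"
      using 3(2) k by (cases k) (simp_all add: mixed_can_def prev_def)
    ultimately show ?thesis
      by (simp only: lifts_surjective[OF d w os 3(3) _ 3(1)])
  qed
qed

lemma mixed_colifts:
  assumes d: "d \<ge> 1" and st: "staircase n d a b" and w: "w \<in> os n (d + 1)" and k: "k \<le> d"
  shows "colifts n d (Mint n d w) (mixed_can n d a b k) (Mint n d (mixed d a b (Suc k)))
    (mixed_can n d a b (Suc k)) (Mint n d (mixed d a b (Suc (Suc k))) :: 'k::field kmod)"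
proof -
  note os = mixed_os[OF st]
  consider "\<not> interlaced d (mixed d a b (Suc k)) w" | "interlaced d (mixed d a b k) w"
    | "interlaced d (mixed d a b (Suc k)) w" "k < d" "interlaced d (mixed d a b (Suc (Suc k))) w"
    using mixed_colift[OF st, of k w] by blast
  then show ?thesis
  proof cases
    case 1
    then show ?thesis using colifts_none[OF d os w] by blast
  next
    case 2
    then show ?thesis
      using k by (simp only: mixed_can_def[of n d a b k] if_True colifts_injective[OF d os os w mixed_step[OF st] 2])
  next
    case 3
    then show ?thesis
      by (simp add: mixed_can_def colifts_surjective[OF d os w mixed_step[OF st] 3(3,1)])
  qed
qed

text \<open>
  Exactness under \<open>Hom(M\<^sub>w, -)\<close> of the part that starts at position 2 differs from exactness of the
  whole sequence only at its ends.  At position 2, a map that becomes zero at position 3 would have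
  to come from position 1, which \<open>approx\<close> excludes unless it is zero; at the last position every
  map has to lift, and it does by \<open>ext\<close>.
\<close>

lemma mixed_torsion_res:
  assumes d: "d \<ge> 1" and st: "staircase n d a b" and I: "I \<subseteq> os n (d + 1)" and a: "a \<in> I"
    and approx: "\<And>w. w \<in> I \<Longrightarrow> interlaced d w (mixed d a b 1) \<Longrightarrow> \<not> interlaced d w (mixed d a b 2)"
    and ext: "\<And>w. w \<in> I \<Longrightarrow> interlaced d w b \<Longrightarrow> interlaced d w (mixed d a b d)"
  shows "torsion_res n d (Mint n d ` os n (d + 1)) (Mint n d ` I)
    (\<lambda>k. Mint n d (mixed d a b k)) (mixed_can n d a b :: nat \<Rightarrow> 'k::field mor)"
  unfolding torsion_res_def
proof (intro conjI allI ballI impI)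
  note os = mixed_os[OF st]
  have "mixed d a b 0 = a" using st by (simp add: mixed_def staircase_def os_iff)
  then show "Mint n d (mixed d a b 0) \<in> madd n d (Mint n d ` I)"
    using subsetD[OF madd_superset imageI[OF a]] by simp
  show "Mint n d (mixed d a b i) \<in> madd n d (Mint n d ` os n (d + 1))" for i
    by (rule subsetD[OF madd_superset imageI[OF os]])
  show "mixed_can n d a b i = 0" if "i > d" for i using that by (simp add: mixed_can_def)
  fix N :: "'k kmod" and i assume "N \<in> Mint n d ` I" and i: "i \<in> {2..Suc d}"
  then obtain w where w: "w \<in> I" "N = Mint n d w" by blast
  then have wos: "w \<in> os n (d + 1)" using I by blast
  have b: "mixed d a b (Suc d) = b" by (simp add: mixed_def)
  obtain j where j: "i = Suc j" "1 \<le> j" "j \<le> d" using i by (cases i) auto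
  define f where "f = (if i = 2 then 0 else mixed_can n d a b j :: 'k mor)"
  have f: "f \<in> mHom n d (Mint n d (mixed d a b j)) (Mint n d (mixed d a b (Suc j)))"
    unfolding f_def using mixed_can_in[OF st, of j] mHom_zero[OF Mint_in_mod_A] by (cases "i = 2") auto
  consider "\<not> interlaced d w (mixed d a b (Suc j))" | "Suc j \<le> d" "interlaced d w (mixed d a b (Suc (Suc j)))"
    | "interlaced d w (mixed d a b (Suc j))" "interlaced d w (mixed d a b j)"
  proof (cases "Suc j \<le> d")
    case True
    then show ?thesis using that mixed_lift(2)[OF st, of w "Suc j"] by auto
  next
    case False
    then have "j = d" using j(3) by simp
    then show ?thesis using that(1,3) ext[OF w(1)] b by auto
  qed
  then have "lifts n d (Mint n d w) (Mint n d (mixed d a b j)) f (Mint n d (mixed d a b (Suc j)))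
      (mixed_can n d a b (Suc j))"
  proof cases
    case 1
    then show ?thesis using lifts_none[OF d wos os _ Mint_in_mod_A f] by blast
  next
    case 2
    then show ?thesis
      using lifts_injective[OF d wos os os mixed_step[OF st] 2(2) Mint_in_mod_A f]
      by (simp only: mixed_can_def[of n d a b "Suc j"] if_True)
  next
    case 3
    then have "j \<noteq> 1" using approx[OF w(1)] by (auto simp: numeral_2_eq_2)
    then have "f = can n d (mixed d a b j) (mixed d a b (Suc j))"
      using j by (simp add: f_def mixed_can_def)
    then show ?thesis using lifts_surjective[OF d wos os 3(2) mixed_step[OF st] 3(1)] by simp
  qed
  then show "lifts n d N (Mint n d (mixed d a b (i - 1))) (if i = 2 then 0 else mixed_can n d a b (i - 1))
      (Mint n d (mixed d a b i)) (mixed_can n d a b i)"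
    by (cases "j = 1") (simp_all add: w(2) f_def j(1) numeral_2_eq_2)
next
  fix N :: "'k kmod" and i assume "N \<in> Mint n d ` os n (d + 1)" and i: "i \<le> d"
  then obtain w where w: "w \<in> os n (d + 1)" "N = Mint n d w" by blast
  show "lifts n d N (Mint n d (mixed d a b (i - 1))) (prev (mixed_can n d a b) i)
      (Mint n d (mixed d a b i)) (mixed_can n d a b i)"
    unfolding w(2) by (rule mixed_lifts[OF d st w(1) i])
  show "colifts n d N (mixed_can n d a b i) (Mint n d (mixed d a b (Suc i)))
      (mixed_can n d a b (Suc i)) (Mint n d (mixed d a b (Suc (Suc i))))"
    unfolding w(2) by (rule mixed_colifts[OF d st w(1) i])
qed (rule mixed_can_in[OF st], rule mixed_can_comp[OF d st])

section \<open>The combinatorial conditions\<close>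

definition quotient_closed :: "nat \<Rightarrow> nat \<Rightarrow> nat list set \<Rightarrow> bool" where
  "quotient_closed n d I \<longleftrightarrow>
    (\<forall>x\<in>os n (d + 1). \<forall>z\<in>os n (d + 1). x \<preceq> z \<longrightarrow> x ! d = z ! d \<longrightarrow> x \<in> I \<longrightarrow> z \<in> I)"

definition extension_closed :: "nat \<Rightarrow> nat \<Rightarrow> nat list set \<Rightarrow> bool" where
  "extension_closed n d I \<longleftrightarrow>
    (\<forall>x\<in>os n (d + 1). \<forall>z\<in>os n (d + 1). map int x \<leadsto> tau (map int z) \<longrightarrow> x \<in> I \<longrightarrow> z \<in> I \<longrightarrow>
      (\<forall>y\<in>os n (d + 1). (\<forall>i\<le>d. y ! i \<in> {x ! i, z ! i}) \<longrightarrow> y \<in> I))"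

lemma squig_tau_iff:
  assumes "x \<in> os n (d + 1)" "z \<in> os n (d + 1)"
  shows "map int x \<leadsto> tau (map int z) \<longleftrightarrow> (\<forall>i\<le>d. x ! i < z ! i) \<and> (\<forall>i<d. z ! i \<le> Suc (x ! Suc i))"
proof -
  have len: "length x = Suc d" "length z = Suc d" using assms by (simp_all add: os_iff)
  have 1: "int (x ! i) \<le> int (z ! i) - 1 \<longleftrightarrow> x ! i < z ! i" for i by linarith
  have 2: "int (z ! i) - 1 \<le> int (x ! Suc i) \<longleftrightarrow> z ! i \<le> Suc (x ! Suc i)" for i by linarith
  show ?thesis
    using len by (simp add: squig_def tau_def 1 2 less_Suc_eq_le Suc_le_eq)
qed

lemma os_update_last:
  assumes x: "x \<in> os n (d + 1)" and "t < n" and "\<And>i. i < d \<Longrightarrow> x ! i \<le> t"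
  shows "x[d := t] \<in> os n (d + 1)"
  using assms by (auto simp: os_iff nth_list_update)

text \<open>
  All entries of \<open>w\<close> except the last one are raised to those of \<open>x\<close>.
\<close>

lemma quotient_closed_truncate:
  assumes d: "d \<ge> 1" and Q: "quotient_closed n d I" and I: "I \<subseteq> os n (d + 1)"
    and w: "w \<in> I" and x: "x \<in> os n (d + 1)" and wx: "interlaced d w x"
  shows "x[d := w ! d] \<in> I"
proof -
  have wos: "w \<in> os n (d + 1)" using w I by blast
  have "x ! i \<le> w ! d" if "i < d" for i
  proof -
    have "x ! i \<le> w ! Suc i" "w ! Suc i \<le> w ! d" using that wx wos by (auto simp: interlaced_def os_iff)
    then show ?thesis by simp
  qed
  then have os: "x[d := w ! d] \<in> os n (d + 1)"
    using os_update_last[OF x, of "w ! d"] wos by (simp add: os_iff)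
  have "w \<preceq> x[d := w ! d]" using wx wos x by (auto simp: ple_iff interlaced_def os_iff nth_list_update)
  then show ?thesis
    using Q w wos os x unfolding quotient_closed_def by (auto simp: os_iff)
qed

lemma staircase_exists:
  assumes d: "d \<ge> 1" and a: "a \<in> os n (d + 1)" and s: "a ! d < s" "s < n"
  shows "\<exists>b. staircase n d a b \<and> b ! d = s"
proof (intro exI conjI)
  let ?b = "map Suc (tl a) @ [s]"
  have len: "length a = Suc d" using a by (simp add: os_iff)
  then have nth: "?b ! i = (if i < d then Suc (a ! Suc i) else s)" if "i \<le> d" for i
    using that by (simp add: nth_append nth_tl)
  show "?b ! d = s" using nth by simp
  have le: "a ! i \<le> a ! j" if "i \<le> j" "j \<le> d" for i j using a that by (simp add: os_iff)
  have bound: "Suc (a ! Suc i) \<le> s" if "i < d" for i using le[of "Suc i" d] s that by simp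
  have "?b \<in> os n (d + 1)"
    unfolding os_iff
  proof (intro conjI allI impI)
    show "length ?b = d + 1" using len by simp
    show "?b ! i < n" if "i < d + 1" for i
      using nth[of i] bound[of i] s that by (cases "i < d") auto
    show "?b ! i \<le> ?b ! j" if "i \<le> j" "j < d + 1" for i j
      using nth[of i] nth[of j] bound[of i] le[of "Suc i" "Suc j"] that by (cases "j < d"; cases "i < d") auto
  qed
  then show "staircase n d a ?b" using a s nth by (simp add: staircase_def)
qed

text \<open>
  The hypothesis \<open>max\<close> makes \<open>a\<close> the longest truncation in \<open>I\<close> of the tuple \<open>x\<close> at position 1.  A nonzero
  map \<open>M\<^sub>w \<rightarrow> M\<^sub>x\<close> puts the truncation of \<open>x\<close> at \<open>w\<^sub>d\<close> into \<open>I\<close>, hence \<open>w\<^sub>d \<le> a\<^sub>d\<close>; but the tuple at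
  position 2 has the entry \<open>a\<^sub>d + 1\<close>, which would have to be at most \<open>w\<^sub>d\<close>.
\<close>

lemma truncation_approx:
  assumes d: "d \<ge> 1" and Q: "quotient_closed n d I" and I: "I \<subseteq> os n (d + 1)"
    and st: "staircase n d a b" and max: "\<And>t. a ! d < t \<Longrightarrow> t \<le> b ! d \<Longrightarrow> a[d := t] \<notin> I"
    and w: "w \<in> I" "interlaced d w (mixed d a b 1)"
  shows "\<not> interlaced d w (mixed d a b 2)"
proof
  assume "interlaced d w (mixed d a b 2)"
  moreover have "d - 1 < d" "Suc (d - 1) = d" using d by auto
  ultimately have "mixed d a b 2 ! (d - 1) \<le> w ! d" unfolding interlaced_def by metis
  then have gt: "a ! d < w ! d" using d staircaseD(4)[OF st, of "d - 1"] by (simp add: mixed_nth[OF st])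
  have "w ! d \<le> mixed d a b 1 ! d" using w(2) by (simp add: interlaced_def)
  then have le: "w ! d \<le> b ! d" by (simp add: mixed_nth[OF st])
  have "(mixed d a b 1)[d := w ! d] = a[d := w ! d]"
    using st mixed_length[OF st] by (intro nth_equalityI) (auto simp: mixed_nth[OF st] nth_list_update staircase_def os_iff)
  then show False
    using quotient_closed_truncate[OF d Q I w(1) mixed_os[OF st] w(2)] max[OF gt le] by simp
qed

text \<open>
  The tuple at position \<open>d\<close> differs from \<open>b\<close> only in its first entry \<open>a\<^sub>0\<close>.  Failure therefore means
  \<open>a\<^sub>0 < w\<^sub>0\<close>, which together with \<open>w \<leadsto> b\<close> gives \<open>a \<leadsto> \<tau>\<^sub>d(w)\<close>; then \<open>(a\<^sub>0, \<dots>, a\<^sub>d\<^sub>-\<^sub>1, w\<^sub>d)\<close> belongs to \<open>I\<close>,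
  against the maximality of \<open>a\<close>.
\<close>

lemma truncation_extend:
  assumes d: "d \<ge> 1" and E: "extension_closed n d I" and I: "I \<subseteq> os n (d + 1)"
    and st: "staircase n d a b" and max: "\<And>t. a ! d < t \<Longrightarrow> t \<le> b ! d \<Longrightarrow> a[d := t] \<notin> I"
    and a: "a \<in> I" and w: "w \<in> I" "interlaced d w b"
  shows "interlaced d w (mixed d a b d)"
proof (rule ccontr)
  assume not: "\<not> interlaced d w (mixed d a b d)"
  have wos: "w \<in> os n (d + 1)" and aos: "a \<in> os n (d + 1)" using w a I by auto
  have wb: "w ! i \<le> b ! i" if "i \<le> d" for i using w(2) that by (simp add: interlaced_def)
  have bw: "b ! i \<le> w ! Suc i" if "i < d" for i using w(2) that by (simp add: interlaced_def)
  have "a ! 0 < w ! 0"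
  proof (rule ccontr)
    assume "\<not> a ! 0 < w ! 0"
    moreover have "a ! 0 \<le> w ! Suc 0" using bw[of 0] staircaseD(3)[OF st, of 0] d by simp
    ultimately have "interlaced d w (mixed d a b d)"
      using wb bw unfolding interlaced_def by (auto simp: mixed_nth[OF st])
    then show False using not by blast
  qed
  moreover have "a ! Suc i < w ! Suc i" if "i < d" for i
    using bw[OF that] staircaseD(4)[OF st that] by simp
  ultimately have aw: "a ! i < w ! i" if "i \<le> d" for i using that by (cases i) auto
  have "map int a \<leadsto> tau (map int w)"
    unfolding squig_tau_iff[OF aos wos] using aw wb staircaseD(4)[OF st] by (metis less_imp_le)
  moreover have "a[d := w ! d] \<in> os n (d + 1)"
  proof (rule os_update_last[OF aos])
    show "w ! d < n" using wos by (simp add: os_iff)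
    show "a ! i \<le> w ! d" if "i < d" for i
      using staircaseD(1)[OF st, of i d] aw[of d] that by simp
  qed
  moreover have "a[d := w ! d] ! i \<in> {a ! i, w ! i}" if "i \<le> d" for i
    using aos that by (auto simp: nth_list_update os_iff)
  ultimately have "a[d := w ! d] \<in> I"
    using E aos wos a w(1) unfolding extension_closed_def by blast
  then show False using max[OF aw[of d] wb[of d]] by simp
qed

section \<open>Closed sets give torsion classes\<close>

text \<open>
  If no \<open>M\<^sub>w\<close> with \<open>w \<in> I\<close> maps to \<open>M\<^sub>x\<close>, then \<open>M\<^sub>x\<close> is torsion free.  Otherwise some truncation of \<open>x\<close>
  lies in \<open>I\<close>, and the longest one is either \<open>x\<close> itself or the start of a staircase.
\<close>

lemma torsion_res_Mint:
  assumes d: "d \<ge> 1" and Q: "quotient_closed n d I" and E: "extension_closed n d I"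
    and I: "I \<subseteq> os n (d + 1)" and x: "x \<in> os n (d + 1)"
  shows "\<exists>X f. torsion_res n d (Mint n d ` os n (d + 1)) (Mint n d ` I) X f \<and> X 1 = (Mint n d x :: 'k::field kmod)"
proof -
  let ?S = "Mint n d ` os n (d + 1) :: 'k kmod set" and ?T = "Mint n d ` I :: 'k kmod set"
  have S: "?S \<subseteq> mod_A n d" using Mint_in_mod_A by blast
  have T: "?T \<subseteq> ?S" using I by blast
  have xd: "x[d := x ! d] = x" by simp
  let ?D = "{t. t \<le> x ! d \<and> x[d := t] \<in> I}"
  have fin: "finite ?D" by simp
  show ?thesis
  proof (cases "\<exists>w\<in>I. interlaced d w x")
    case False
    have "h = 0" if N: "N \<in> ?T" and h: "h \<in> mHom n d N (Mint n d x)" for N :: "'k kmod" and h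
    proof -
      obtain w where w: "w \<in> I" "N = Mint n d w" using N by blast
      then show ?thesis using hom_Mint[OF d _ x, of w h] h False I by auto
    qed
    moreover have "Mint n d x \<in> madd n d ?S" by (rule subsetD[OF madd_superset imageI[OF x]])
    ultimately show ?thesis using torsion_res_torsion_free[OF d S T] by blast
  next
    case True
    then obtain w where w: "w \<in> I" "interlaced d w x" by blast
    then have "w ! d \<in> ?D" using quotient_closed_truncate[OF d Q I w(1) x w(2)] by (simp add: interlaced_def)
    define t where "t = Max ?D"
    have "t \<in> ?D" unfolding t_def using Max_in[OF fin] \<open>w ! d \<in> ?D\<close> by blast
    then have t: "t \<le> x ! d" "x[d := t] \<in> I" by simp_all
    have max: "s \<le> t" if "s \<le> x ! d" "x[d := s] \<in> I" for s using Max_ge[OF fin, of s] that by (simp add: t_def)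
    show ?thesis
    proof (cases "t = x ! d")
      case True
      then have "Mint n d x \<in> madd n d ?T" using t(2) xd subsetD[OF madd_superset, of _ ?T n d] by auto
      then show ?thesis using torsion_res_torsion[OF S T] by blast
    next
      case False
      define a where "a = x[d := t]"
      have len: "length x = Suc d" "x ! d < n" using x by (auto simp: os_iff)
      have ad: "a ! d = t" "a \<in> I" using len t by (auto simp: a_def)
      obtain b where st: "staircase n d a b" and bd: "b ! d = x ! d"
        using staircase_exists[OF d, of a n "x ! d"] ad I t False len by auto
      have a_max: "a[d := s] \<notin> I" if "a ! d < s" "s \<le> b ! d" for s
        using max[of s] that ad bd by (auto simp: a_def)
      have "mixed d a b 1 = x"
      proof (rule nth_equalityI)
        fix i assume "i < length (mixed d a b 1)"
        then have i: "i \<le> d" using mixed_length[OF st] by simp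
        show "mixed d a b 1 ! i = x ! i"
          using mixed_nth[OF st i, of 1] bd i len by (cases "i = d") (simp_all add: a_def)
      qed (simp add: mixed_length[OF st] len)
      then show ?thesis
        using mixed_torsion_res[OF d st I ad(2) truncation_approx[OF d Q I st a_max]
            truncation_extend[OF d E I st a_max ad(2)], where 'k = 'k] by blast
    qed
  qed
qed

lemma torsion_res_dsum:
  assumes d: "d \<ge> 1" and Q: "quotient_closed n d I" and E: "extension_closed n d I" and I: "I \<subseteq> os n (d + 1)"
    and Ms: "set Ms \<subseteq> Mint n d ` os n (d + 1)" and M: "M \<in> mod_A n d" "dsum n d Ms M"
  shows "\<exists>X f. torsion_res n d (Mint n d ` os n (d + 1)) (Mint n d ` I) X f \<and> X 1 = (M :: 'k::field kmod)"
  using Ms M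
proof (induction Ms arbitrary: M)
  let ?S = "Mint n d ` os n (d + 1) :: 'k kmod set" and ?T = "Mint n d ` I :: 'k kmod set"
  have S: "?S \<subseteq> mod_A n d" using Mint_in_mod_A by blast
  have T: "?T \<subseteq> ?S" using I by blast
  case Nil
  then have "M \<in> madd n d ?T" using subcat_zero[OF subcat_madd[OF order.trans[OF T S]]] by simp
  then show ?case using torsion_res_torsion[OF S T] by blast
next
  let ?S = "Mint n d ` os n (d + 1) :: 'k kmod set" and ?T = "Mint n d ` I :: 'k kmod set"
  have S: "?S \<subseteq> mod_A n d" using Mint_in_mod_A by blast
  have T: "?T \<subseteq> ?S" using I by blast
  case (Cons N Ns)
  then obtain x Y where x: "x \<in> os n (d + 1)" "N = Mint n d x"
    and Y: "Y \<in> mod_A n d" "mbiproduct n d M N Y" "dsum n d Ns Y" by auto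
  obtain X1 f1 where 1: "torsion_res n d ?S ?T X1 f1" "X1 1 = Mint n d x"
    using torsion_res_Mint[OF d Q E I x(1)] by blast
  obtain X2 f2 where 2: "torsion_res n d ?S ?T X2 f2" "X2 1 = Y"
    using Cons.IH[OF _ Y(1,3)] Cons.prems(1) by auto
  show ?case
    using torsion_res_biprod[OF S T Cons.prems(2) _ 1(1) 2(1)] Y(2) 1(2) 2(2) x(2) by auto
qed

lemma torsion_class_of_closed:
  assumes d: "d \<ge> 1" and Q: "quotient_closed n d I" and E: "extension_closed n d I" and I: "I \<subseteq> os n (d + 1)"
  shows "d_torsion_class n d (Mcat n d :: 'k::field kmod set) (madd n d (Mint n d ` I))"
proof -
  let ?S = "Mint n d ` os n (d + 1) :: 'k kmod set" and ?T = "Mint n d ` I :: 'k kmod set"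
  have S: "?S \<subseteq> mod_A n d" using Mint_in_mod_A by blast
  have T: "?T \<subseteq> ?S" using I by blast
  show ?thesis
    unfolding d_torsion_class_def
  proof (intro conjI ballI)
    show "subcat n d (madd n d ?T)" using subcat_madd T S by blast
    show "madd n d ?T \<subseteq> Mcat n d" unfolding Mcat_def by (rule madd_mono[OF T])
    fix M :: "'k kmod" assume "M \<in> Mcat n d"
    then have "M \<in> mod_A n d \<and> (\<exists>Ms. set Ms \<subseteq> ?S \<and> dsum n d Ms M)"
      unfolding Mcat_def using madd_dsum[of ?S n d M] scalar_end_Mint[OF d] by blast
    then obtain X f where R: "torsion_res n d ?S ?T X f" "X 1 = M"
      using torsion_res_dsum[OF d Q E I] by blast
    have "X 0 \<in> madd n d ?T" using torsion_resD(1)[OF R(1)] .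
    then show "\<exists>X f. d_exact n d (Mcat n d) X f \<and> X 0 \<in> madd n d ?T \<and> X 1 = M \<and>
        (\<forall>U\<in>madd n d ?T. \<forall>i\<in>{1..d}.
           exact_at (if i = 1 then {0} else mHom n d U (X i))
                    (\<lambda>g. if i = 1 then 0 else f i \<odot> g)
                    (mHom n d U (X (i + 1)))
                    (\<lambda>g. if i = d then 0 else f (i + 1) \<odot> g))"
      using torsion_res_exact[OF S T R(1)] R(2) unfolding Mcat_def[symmetric]
      by (intro exI[of _ X] exI[of _ f]) blast
  qed
qed

section \<open>Torsion classes give closed sets\<close>

lemma interlaced_antisym:
  assumes "x \<in> os n (d + 1)" "y \<in> os n (d + 1)" "interlaced d x y" "interlaced d y x"
  shows "x = y"
  using assms by (intro nth_equalityI) (auto simp: interlaced_def os_iff intro: le_antisym)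

lemma subcat_vanishing_composites:
  assumes M: "(M :: 'k::field kmod) \<in> mod_A n d"
  shows "subcat n d {N \<in> mod_A n d. \<forall>f\<in>mHom n d M N. \<forall>g\<in>mHom n d N M. g \<odot> f = 0}"
proof (rule subcatI)
  fix Z :: "'k kmod" assume "Z \<in> mod_A n d" "mzero n d Z"
  then show "\<forall>f\<in>mHom n d M Z. \<forall>g\<in>mHom n d Z M. g \<odot> f = 0"
    using mzero_mHom(1)[of n d Z M] M mcomp_left(3) by blast
next
  fix X Z :: "'k kmod" assume *: "X \<in> mod_A n d" "retract n d X Z"
    "\<forall>f\<in>mHom n d M Z. \<forall>g\<in>mHom n d Z M. g \<odot> f = 0"
  then obtain i p where i: "i \<in> mHom n d X Z" and p: "p \<in> mHom n d Z X" and pi: "p \<odot> i = mid n d X"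
    by (auto simp: retract_def)
  show "\<forall>f\<in>mHom n d M X. \<forall>g\<in>mHom n d X M. g \<odot> f = 0"
  proof (intro ballI)
    fix f g assume f: "f \<in> mHom n d M X" and g: "g \<in> mHom n d X M"
    have "(g \<odot> p) \<odot> (i \<odot> f) = 0" using *(3) mcomp_in[OF f i] mcomp_in[OF p g] by blast
    then show "g \<odot> f = 0" using mcomp_nest[OF pi] mid_left[OF lands_mHom[OF *(1) f]] by simp
  qed
next
  fix X Y Z :: "'k kmod" and i j p q
  assume *: "X \<in> mod_A n d" "Y \<in> mod_A n d" "Z \<in> mod_A n d" and bip: "biprod n d Z X Y i j p q"
    and X: "\<forall>f\<in>mHom n d M X. \<forall>g\<in>mHom n d X M. g \<odot> f = 0"
    and Y: "\<forall>f\<in>mHom n d M Y. \<forall>g\<in>mHom n d Y M. g \<odot> f = 0"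
  note arrows = biprod_arrows[OF bip]
  show "\<forall>f\<in>mHom n d M Z. \<forall>g\<in>mHom n d Z M. g \<odot> f = 0"
  proof (intro ballI)
    fix f g assume f: "f \<in> mHom n d M Z" and g: "g \<in> mHom n d Z M"
    have "(g \<odot> i) \<odot> (p \<odot> f) = 0" using X mcomp_in[OF f arrows(3)] mcomp_in[OF arrows(1) g] by blast
    moreover have "(g \<odot> j) \<odot> (q \<odot> f) = 0" using Y mcomp_in[OF f arrows(4)] mcomp_in[OF arrows(2) g] by blast
    moreover have "g \<odot> f = (g \<odot> i) \<odot> (p \<odot> f) + (g \<odot> j) \<odot> (q \<odot> f)"
      using arg_cong[OF biprod_codecompose[OF bip * g], of "\<lambda>h. h \<odot> f"] by simp
    ultimately show "g \<odot> f = 0" by simp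
  qed
qed

text \<open>
  In other words, \<open>M\<^sub>z\<close> is not a summand of a module in the additive closure unless \<open>z \<in> I\<close>.  For a
  generator \<open>M\<^sub>y\<close> the claim follows from antisymmetry of \<open>\<leadsto>\<close>, and the modules \<open>U\<close> for which it
  holds form a subcategory.
\<close>

lemma composites_through_madd:
  fixes f g :: "'k::field mor"
  assumes d: "d \<ge> 1" and I: "I \<subseteq> os n (d + 1)" and z: "z \<in> os n (d + 1)" "z \<notin> I"
    and U: "U \<in> madd n d (Mint n d ` I)" and f: "f \<in> mHom n d (Mint n d z) U"
    and g: "g \<in> mHom n d U (Mint n d z)"
  shows "g \<odot> f = 0"
proof -
  let ?C = "{N \<in> mod_A n d. \<forall>f\<in>mHom n d (Mint n d z) N. \<forall>g\<in>mHom n d N (Mint n d z). g \<odot> f = (0 :: 'k mor)}"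
  have "Mint n d y \<in> ?C" if "y \<in> I" for y
  proof -
    have y: "y \<in> os n (d + 1)" "y \<noteq> z" using that I z by auto
    have "g \<odot> f = 0" if fg: "f \<in> mHom n d (Mint n d z) (Mint n d y)" "g \<in> mHom n d (Mint n d y) (Mint n d z)"
      for f g :: "'k mor"
    proof (cases "interlaced d z y")
      case True
      then have "\<not> interlaced d y z" using interlaced_antisym z(1) y by blast
      then have "g = 0" using hom_Mint[OF d y(1) z(1) fg(2)] by simp
      then show ?thesis by simp
    next
      case False
      then have "f = 0" using hom_Mint[OF d z(1) y(1) fg(1)] by simp
      then show ?thesis using mcomp_right_zero[OF fg(2)] by simp
    qed
    then show ?thesis using Mint_in_mod_A by blast
  qed
  then have "madd n d (Mint n d ` I) \<subseteq> ?C"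
    by (intro madd_least[OF subcat_vanishing_composites[OF Mint_in_mod_A]]) blast
  then show ?thesis using U f g by blast
qed

definition torsion_exact ::
  "nat \<Rightarrow> nat \<Rightarrow> 'k::field kmod set \<Rightarrow> (nat \<Rightarrow> 'k kmod) \<Rightarrow> (nat \<Rightarrow> 'k mor) \<Rightarrow> bool" where
  "torsion_exact n d \<U> X f \<longleftrightarrow> (\<forall>U\<in>\<U>. \<forall>i\<in>{1..d}.
     exact_at (if i = 1 then {0} else mHom n d U (X i)) (\<lambda>g. if i = 1 then 0 else f i \<odot> g)
              (mHom n d U (X (i + 1))) (\<lambda>g. if i = d then 0 else f (i + 1) \<odot> g))"

lemma torsion_class_sequence:
  assumes "d_torsion_class n d \<M> \<U>" "M \<in> \<M>"
  obtains X f where "d_exact n d \<M> X f" "torsion_exact n d \<U> X f" "X 0 \<in> \<U>" "X 1 = M"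
  using assms unfolding d_torsion_class_def torsion_exact_def[symmetric] by blast

lemma torsion_sequence:
  fixes \<U> :: "'k::field kmod set"
  assumes E: "d_exact n d \<M> X f" and T: "torsion_exact n d \<U> X f"
    and \<M>: "subcat n d \<M>" and d: "d \<ge> 1"
  shows "i \<le> d + 1 \<Longrightarrow> X i \<in> \<M>"
    "i \<le> d \<Longrightarrow> f i \<in> mHom n d (X i) (X (Suc i))"
    "i < d \<Longrightarrow> f (Suc i) \<odot> f i = 0"
    "N \<in> \<M> \<Longrightarrow> h \<in> mHom n d N (X 0) \<Longrightarrow> f 0 \<odot> h = 0 \<Longrightarrow> h = 0"
    "N \<in> \<M> \<Longrightarrow> lifts n d N (X 0) (f 0) (X 1) (f 1)"
    "N \<in> \<M> \<Longrightarrow> i < d \<Longrightarrow> colifts n d N (f i) (X (Suc i)) (f (Suc i)) (X (Suc (Suc i)))"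
    "U \<in> \<U> \<Longrightarrow> h \<in> mHom n d U (X 1) \<Longrightarrow> f 1 \<odot> h = 0"
    "U \<in> \<U> \<Longrightarrow> h \<in> mHom n d U (X (d + 1)) \<Longrightarrow>
      if d = 1 then h = 0 else \<exists>h'\<in>mHom n d U (X d). h = f d \<odot> h'"
proof -
  note T = T[unfolded torsion_exact_def]
  have K: "d_kernel n d \<M> X f" and C: "d_cokernel n d \<M> X f" using E by (simp_all add: d_exact_def)
  show X: "X i \<in> \<M>" if "i \<le> d + 1" for i using K that by (simp add: d_kernel_def dseq_def)
  have X': "X i \<in> mod_A n d" if "i \<le> d + 1" for i using subcat_mod_A[OF \<M> X[OF that]] .
  show f: "f i \<in> mHom n d (X i) (X (Suc i))" if "i \<le> d" for i using K that by (simp add: d_kernel_def dseq_def)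
  have ker: "exact_at (mHom n d N (X i)) (\<lambda>g. f i \<odot> g) (mHom n d N (X (Suc i))) (\<lambda>g. f (Suc i) \<odot> g)"
    if "N \<in> \<M>" "i < d" for N i
  proof -
    have "Suc i \<in> {1..d}" using that by simp
    then show ?thesis using K that(1) unfolding d_kernel_def by (metis diff_Suc_1)
  qed
  have cok: "exact_at (mHom n d (X (Suc (Suc i))) N) (\<lambda>g. g \<odot> f (Suc i)) (mHom n d (X (Suc i)) N) (\<lambda>g. g \<odot> f i)"
    if "N \<in> \<M>" "i < d" for N i
  proof -
    have "Suc i \<in> {1..d}" using that by simp
    then show ?thesis using C that(1) unfolding d_cokernel_def by (metis diff_Suc_1 Suc_eq_plus1)
  qed
  show ff: "f (Suc i) \<odot> f i = 0" if "i < d" for i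
  proof -
    have "f i \<odot> mid n d (X i) \<in> {b \<in> mHom n d (X i) (X (Suc i)). f (Suc i) \<odot> b = 0}"
      using ker[OF X that, of i] mid_in[OF X'] that unfolding exact_at_def by auto
    then show ?thesis using mid_right[OF f, of i] that by simp
  qed
  show "h = 0" if N: "N \<in> \<M>" and h: "h \<in> mHom n d N (X 0)" "f 0 \<odot> h = 0" for N h
  proof -
    have "exact_at {0 :: 'k mor} (\<lambda>_. 0) (mHom n d N (X 0)) (\<lambda>g. f 0 \<odot> g)"
      using K N unfolding d_kernel_def by blast
    then show ?thesis using h unfolding exact_at_def by auto
  qed
  show "lifts n d N (X 0) (f 0) (X 1) (f 1)" if N: "N \<in> \<M>" for N
    using ker[OF N, of 0] exact_at_lifts[OF f ff, of 0 N] d by simp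
  show "colifts n d N (f i) (X (Suc i)) (f (Suc i)) (X (Suc (Suc i)))" if N: "N \<in> \<M>" "i < d" for N i
    using cok[OF N] exact_at_colifts[OF f ff subcat_mod_A[OF \<M> N(1)]] N(2) by simp
  show "f 1 \<odot> h = 0" if U: "U \<in> \<U>" and h: "h \<in> mHom n d U (X 1)" for U h
  proof -
    have f1h: "f 1 \<odot> h \<in> mHom n d U (X 2)"
      using mcomp_in[OF h f[of 1, folded One_nat_def]] d by (simp add: numeral_2_eq_2)
    have f21: "1 \<noteq> d \<Longrightarrow> f 2 \<odot> (f 1 \<odot> h) = 0"
      using mcomp_nest[OF ff[of 1]] d by (auto simp: numeral_2_eq_2)
    have "exact_at {0 :: 'k mor} (\<lambda>g. 0) (mHom n d U (X 2)) (\<lambda>g. if 1 = d then 0 else f 2 \<odot> g)"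
      using bspec[OF bspec[OF T U], of 1] d unfolding one_add_one by simp
    then have "(\<lambda>g. 0) ` {0 :: 'k mor} = {b \<in> mHom n d U (X 2). (if 1 = d then 0 else f 2 \<odot> b) = 0}"
      by (simp only: exact_at_def)
    moreover have "f 1 \<odot> h \<in> {b \<in> mHom n d U (X 2). (if 1 = d then 0 else f 2 \<odot> b) = 0}"
      using f1h f21 by simp
    ultimately show ?thesis by blast
  qed
  show "if d = 1 then h = 0 else \<exists>h'\<in>mHom n d U (X d). h = f d \<odot> h'"
    if U: "U \<in> \<U>" and h: "h \<in> mHom n d U (X (d + 1))" for U h
  proof -
    have "exact_at (if d = 1 then {0} else mHom n d U (X d)) (\<lambda>g. if d = 1 then 0 else f d \<odot> g)
        (mHom n d U (X (d + 1))) (\<lambda>g. if d = d then (0 :: 'k mor) else f (d + 1) \<odot> g)"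
      using bspec[OF bspec[OF T U], of d] d by simp
    then have "h \<in> (\<lambda>g. if d = 1 then 0 else f d \<odot> g) ` (if d = 1 then {0} else mHom n d U (X d))"
      using h unfolding exact_at_def by auto
    then show ?thesis
      by (auto split: if_splits)
  qed
qed

text \<open>
  Put \<open>z = x[i := s]\<close> and let \<open>a\<close> arise from \<open>x\<close> by lowering entry \<open>i + 1\<close> to \<open>s - 1\<close>.  Then
  \<open>M\<^sub>a \<rightarrow> M\<^sub>x \<rightarrow> M\<^sub>z\<close> is exact under \<open>Hom(-, N)\<close>, since a tuple \<open>w\<close> with \<open>x \<leadsto> w\<close> satisfies exactly one
  of \<open>a \<leadsto> w\<close> and \<open>z \<leadsto> w\<close>, according to whether \<open>w\<^sub>i < s\<close>.  Let \<open>U \<rightarrow> M\<^sub>z\<close> be the torsion part.  As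
  \<open>x \<in> I\<close>, the map \<open>M\<^sub>x \<rightarrow> M\<^sub>z\<close> factors through \<open>U\<close>.  The factor \<open>M\<^sub>x \<rightarrow> U\<close> vanishes on \<open>M\<^sub>a\<close>, because its
  composite with the monomorphism \<open>U \<rightarrow> M\<^sub>z\<close> does, and so it factors through \<open>M\<^sub>x \<rightarrow> M\<^sub>z\<close>.  The
  resulting map \<open>M\<^sub>z \<rightarrow> U \<rightarrow> M\<^sub>z\<close> is nonzero, as \<open>M\<^sub>x \<rightarrow> M\<^sub>z\<close> followed by it is the canonical map; hence
  \<open>z \<in> I\<close>.
\<close>

lemma raise_coordinate:
  assumes d: "d \<ge> 1" and I: "I \<subseteq> os n (d + 1)"
    and TC: "d_torsion_class n d (Mcat n d :: 'k::field kmod set) (madd n d (Mint n d ` I))"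
    and x: "x \<in> I" and i: "i < d" and s: "x ! i < s" "s \<le> x ! Suc i"
  shows "x[i := s] \<in> I"
proof (rule ccontr)
  assume notI: "x[i := s] \<notin> I"
  define z where "z = x[i := s]"
  define a where "a = x[Suc i := s - 1]"
  let ?S = "Mint n d ` os n (d + 1) :: 'k kmod set"
  have S: "?S \<subseteq> mod_A n d" using Mint_in_mod_A by blast
  have Mcat: "subcat n d (Mcat n d :: 'k kmod set)" unfolding Mcat_def by (rule subcat_madd[OF S])
  have xos: "x \<in> os n (d + 1)" using x I by blast
  have len: "length x = Suc d" and mono: "\<And>i j. i \<le> j \<Longrightarrow> j \<le> d \<Longrightarrow> x ! i \<le> x ! j"
    and bound: "\<And>i. i \<le> d \<Longrightarrow> x ! i < n" using xos by (auto simp: os_iff)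
  have z_nth: "z ! j = (if j = i then s else x ! j)" if "j \<le> d" for j
    using that len by (simp add: z_def nth_list_update)
  have a_nth: "a ! j = (if j = Suc i then s - 1 else x ! j)" if "j \<le> d" for j
    using that len by (simp add: a_def nth_list_update)
  have zos: "z \<in> os n (d + 1)"
    unfolding os_iff
  proof (intro conjI allI impI)
    show "length z = d + 1" using len by (simp add: z_def)
    show "z ! j < n" if "j < d + 1" for j using z_nth[of j] bound[of j] bound[of "Suc i"] s i that by auto
    show "z ! j \<le> z ! k" if "j \<le> k" "k < d + 1" for j k
      using z_nth[of j] z_nth[of k] mono[of j k] mono[of j i] mono[of "Suc i" k] s that by (cases "i < k") auto
  qed
  have aos: "a \<in> os n (d + 1)"
    unfolding os_iff
  proof (intro conjI allI impI)
    show "length a = d + 1" using len by (simp add: a_def)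
    show "a ! j < n" if "j < d + 1" for j using a_nth[of j] bound[of j] bound[of "Suc i"] s i that by auto
    show "a ! j \<le> a ! k" if "j \<le> k" "k < d + 1" for j k
      using a_nth[of j] a_nth[of k] mono[of j k] mono[of j i] mono[of "Suc i" k] s that
      by (cases "j \<le> i") auto
  qed
  have ax: "interlaced d a x"
    unfolding interlaced_def
  proof (intro conjI allI impI)
    show "a ! j \<le> x ! j" if "j \<le> d" for j using a_nth[OF that] s by auto
    show "x ! j \<le> a ! Suc j" if "j < d" for j using a_nth[of "Suc j"] s mono[of j "Suc j"] that by auto
  qed
  have xz: "interlaced d x z"
    unfolding interlaced_def
  proof (intro conjI allI impI)
    show "x ! j \<le> z ! j" if "j \<le> d" for j using z_nth[OF that] s by auto
    show "z ! j \<le> x ! Suc j" if "j < d" for j using z_nth[of j] s mono[of j "Suc j"] that by auto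
  qed
  have not_az: "\<not> interlaced d a z"
    using a_nth[of "Suc i"] z_nth[of i] i s by (auto simp: interlaced_def intro!: exI[of _ i])
  have colifts: "colifts n d N (can n d a x) (Mint n d x) (can n d x z) (Mint n d z)"
    if "N \<in> Mcat n d" for N :: "'k kmod"
  proof (rule colifts_madd[OF Mint_in_mod_A Mint_in_mod_A can_in_mHom[OF xz] S _ that[unfolded Mcat_def]])
    fix N :: "'k kmod" assume "N \<in> ?S"
    then obtain w where w: "w \<in> os n (d + 1)" "N = Mint n d w" by (elim imageE) simp
    consider "\<not> interlaced d x w" | "interlaced d a w" | "interlaced d x w" "\<not> interlaced d a w" by blast
    then show "colifts n d N (can n d a x) (Mint n d x) (can n d x z) (Mint n d z)"
      unfolding w(2)
    proof cases
      case 1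
      then show "colifts n d (Mint n d w) (can n d a x) (Mint n d x) (can n d x z) (Mint n d z :: 'k kmod)"
        by (rule colifts_none[OF d xos w(1)])
    next
      case 2
      then show "colifts n d (Mint n d w) (can n d a x) (Mint n d x) (can n d x z) (Mint n d z :: 'k kmod)"
        by (rule colifts_injective[OF d aos xos w(1) ax])
    next
      case 3
      have xw: "x ! j \<le> w ! j" if "j \<le> d" for j using 3(1) that by (simp add: interlaced_def)
      have wx: "w ! j \<le> x ! Suc j" if "j < d" for j using 3(1) that by (simp add: interlaced_def)
      obtain j where j: "j < d" "a ! Suc j < w ! j"
        using 3(2) xw ax unfolding interlaced_def not_le[symmetric] by (meson le_trans)
      then have "j = i" using a_nth[of "Suc j"] wx[of j] by (auto split: if_splits)
      then have si: "s \<le> w ! i" using j a_nth[of "Suc j"] by simp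
      have "interlaced d z w"
        unfolding interlaced_def
      proof (intro conjI allI impI)
        show "z ! j \<le> w ! j" if "j \<le> d" for j using z_nth[OF that] xw[OF that] si by auto
        show "w ! j \<le> z ! Suc j" if "j < d" for j
          using z_nth[of "Suc j"] wx[OF that] s that by (auto intro: le_trans)
      qed
      then show "colifts n d (Mint n d w) (can n d a x) (Mint n d x) (can n d x z) (Mint n d z :: 'k kmod)"
        by (rule colifts_surjective[OF d xos w(1) xz _ 3(1)])
    qed
  qed
  have mem: "Mint n d y \<in> Mcat n d" if "y \<in> os n (d + 1)" for y
    unfolding Mcat_def by (rule subsetD[OF madd_superset imageI[OF that]])
  obtain X and f :: "nat \<Rightarrow> 'k mor" where E: "d_exact n d (Mcat n d) X f"
    and T: "torsion_exact n d (madd n d (Mint n d ` I)) X f"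
    and X: "X 0 \<in> madd n d (Mint n d ` I)" "X 1 = Mint n d z"
    using torsion_class_sequence[OF TC mem[OF zos]] .
  note seq = torsion_sequence[OF E T Mcat d]
  have f: "f 0 \<in> mHom n d (X 0) (X 1)" using seq(2)[of 0] by simp
  have X0: "X 0 \<in> Mcat n d" using seq(1)[of 0] by simp
  let ?g = "can n d x z :: 'k mor"
  have "Mint n d x \<in> madd n d (Mint n d ` I :: 'k kmod set)" by (rule subsetD[OF madd_superset imageI[OF x]])
  moreover have g: "?g \<in> mHom n d (Mint n d x) (X 1)" unfolding X(2) by (rule can_in_mHom[OF xz])
  ultimately have "f 1 \<odot> ?g = 0" by (rule seq(7))
  then obtain u where u: "u \<in> mHom n d (Mint n d x) (X 0)" "?g = f 0 \<odot> u"
    using seq(5)[OF mem[OF xos]] g unfolding lifts_def by blast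
  have "f 0 \<odot> (u \<odot> can n d a x) = ?g \<odot> can n d a x" by (simp add: u(2))
  also have "\<dots> = 0" using not_az by (simp add: can_comp[OF d aos zos ax xz])
  finally have "u \<odot> can n d a x = 0" by (rule seq(4)[OF mem[OF aos] mcomp_in[OF can_in_mHom[OF ax] u(1)]])
  then obtain u' where u': "u' \<in> mHom n d (Mint n d z) (X 0)" "u = u' \<odot> ?g"
    using colifts[OF X0] u(1) unfolding colifts_def by blast
  have "f 0 \<odot> u' = 0"
    using composites_through_madd[OF d I zos _ X(1) u'(1)] f X(2) notI by (simp add: z_def)
  then have "f 0 \<odot> (u' \<odot> ?g) = 0" using mcomp_nest[of "f 0" u' 0 ?g] by simp
  then have "?g = 0" using u(2)[unfolded u'(2)] by (rule trans[rotated])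
  then show False using can_nonzero[OF xos xz] by blast
qed

text \<open>
  The coordinates are raised one at a time from the last to the first, which keeps the
  intermediate tuples non-decreasing.
\<close>

lemma quotient_closed_of_torsion_class:
  assumes d: "d \<ge> 1" and I: "I \<subseteq> os n (d + 1)"
    and TC: "d_torsion_class n d (Mcat n d :: 'k::field kmod set) (madd n d (Mint n d ` I))"
  shows "quotient_closed n d I"
  unfolding quotient_closed_def
proof (intro ballI impI)
  fix x z assume x: "x \<in> os n (d + 1)" and z: "z \<in> os n (d + 1)" and xz: "x \<preceq> z" "x ! d = z ! d" and xI: "x \<in> I"
  have len: "length x = Suc d" "length z = Suc d" using x z by (simp_all add: os_iff)
  define y where "y k = take k x @ drop k z" for k
  have y_nth: "y k ! j = (if j < k then x ! j else z ! j)" if "j \<le> d" "k \<le> d" for k j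
    using that len by (simp add: y_def nth_append)
  have y_len: "length (y k) = Suc d" if "k \<le> d" for k using that len by (simp add: y_def)
  have "y k \<in> I" if "k \<le> d" for k
    using that
  proof (induction k rule: inc_induct)
    case base
    have "y d = x" using len xz(2) y_len y_nth by (intro nth_equalityI) (auto simp: less_Suc_eq)
    then show ?case using xI by simp
  next
    case (step k)
    have upd: "y k = (y (Suc k))[k := z ! k]"
      using step.hyps y_len by (intro nth_equalityI) (auto simp: y_nth nth_list_update less_Suc_eq_le)
    have le: "x ! k \<le> z ! k" using xz(1) step.hyps len by (simp add: ple_iff)
    show ?case
    proof (cases "x ! k = z ! k")
      case True
      then have "y k = y (Suc k)"
        using step.hyps y_len by (intro nth_equalityI) (auto simp: y_nth less_Suc_eq_le less_Suc_eq)
      then show ?thesis using step by simp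
    next
      case False
      have "z ! k \<le> z ! Suc k" using z step.hyps by (simp add: os_iff)
      then show ?thesis
        unfolding upd using False le step.hyps
        by (intro raise_coordinate[OF d I TC step.IH]) (auto simp: y_nth)
    qed
  qed
  from this[of 0] show "z \<in> I" by (simp add: y_def)
qed

lemma ple_of_choice:
  assumes "x \<in> os n (d + 1)" "y \<in> os n (d + 1)" "\<And>i. i \<le> d \<Longrightarrow> x ! i \<le> y ! i"
  shows "x \<preceq> y"
  using assms by (simp add: ple_iff os_iff)

text \<open>
  The maps \<open>\<phi>\<close> and \<open>\<psi>\<close> compare the staircase sequence with another sequence \<open>X\<close> that is exact under
  \<open>Hom(-, N)\<close>.  Both extend to the next position by exactness.  The composite \<open>\<psi>' \<odot> \<phi>'\<close> is a
  scalar, and it is 1 because it fixes the nonzero map arriving from the previous position.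
\<close>

lemma comparison_step:
  fixes X :: "nat \<Rightarrow> 'k::field kmod"
  assumes d: "d \<ge> 1" and st: "staircase n d a b" and m: "m < d"
    and f: "f (Suc m) \<in> mHom n d (X (Suc m)) (X (Suc (Suc m)))"
    and seq: "\<And>N. N \<in> Mcat n d \<Longrightarrow> colifts n d N (f m) (X (Suc m)) (f (Suc m)) (X (Suc (Suc m)))"
    and XM: "X (Suc (Suc m)) \<in> Mcat n d"
    and \<phi>: "\<phi> \<in> mHom n d (Mint n d (mixed d a b (Suc m))) (X (Suc m))"
    and \<psi>: "\<psi> \<in> mHom n d (X (Suc m)) (Mint n d (mixed d a b (Suc m)))"
    and \<psi>\<phi>: "\<psi> \<odot> \<phi> = mid n d (Mint n d (mixed d a b (Suc m)))"
    and f\<phi>: "f (Suc m) \<odot> (\<phi> \<odot> mixed_can n d a b m) = 0"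
    and can\<psi>: "mixed_can n d a b (Suc m) \<odot> (\<psi> \<odot> f m) = 0"
  obtains \<phi>' \<psi>' where "\<phi>' \<in> mHom n d (Mint n d (mixed d a b (Suc (Suc m)))) (X (Suc (Suc m)))"
    "\<psi>' \<in> mHom n d (X (Suc (Suc m))) (Mint n d (mixed d a b (Suc (Suc m))))"
    "\<psi>' \<odot> \<phi>' = mid n d (Mint n d (mixed d a b (Suc (Suc m))))"
    "f (Suc m) \<odot> \<phi> = \<phi>' \<odot> mixed_can n d a b (Suc m)"
    "mixed_can n d a b (Suc m) \<odot> \<psi> = \<psi>' \<odot> f (Suc m)"
proof -
  let ?S = "Mint n d ` os n (d + 1) :: 'k kmod set"
  let ?V = "\<lambda>k. Mint n d (mixed d a b k) :: 'k kmod" and ?g = "mixed_can n d a b :: nat \<Rightarrow> 'k mor"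
  have S: "?S \<subseteq> mod_A n d" using Mint_in_mod_A by blast
  note os = mixed_os[OF st]
  have g: "?g k \<in> mHom n d (?V k) (?V (Suc k))" for k by (rule mixed_can_in[OF st])
  have colifts: "colifts n d N (?g m) (?V (Suc m)) (?g (Suc m)) (?V (Suc (Suc m)))" if "N \<in> Mcat n d" for N
  proof (rule colifts_madd[OF Mint_in_mod_A Mint_in_mod_A g S _ that[unfolded Mcat_def]])
    fix N assume "N \<in> ?S"
    then obtain w where w: "w \<in> os n (d + 1)" "N = Mint n d w" by blast
    show "colifts n d N (?g m) (?V (Suc m)) (?g (Suc m)) (?V (Suc (Suc m)))"
      unfolding w(2) by (rule mixed_colifts[OF d st w(1) less_imp_le[OF m]])
  qed
  have "(f (Suc m) \<odot> \<phi>) \<odot> ?g m = 0" using f\<phi> by simp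
  then obtain \<phi>' where \<phi>': "\<phi>' \<in> mHom n d (?V (Suc (Suc m))) (X (Suc (Suc m)))"
    "f (Suc m) \<odot> \<phi> = \<phi>' \<odot> ?g (Suc m)"
    using colifts[OF XM] mcomp_in[OF \<phi> f] unfolding colifts_def by blast
  have "?V (Suc (Suc m)) \<in> Mcat n d"
    unfolding Mcat_def by (rule subsetD[OF madd_superset imageI[OF os]])
  moreover have "(?g (Suc m) \<odot> \<psi>) \<odot> f m = 0" using can\<psi> by simp
  ultimately obtain \<psi>' where \<psi>': "\<psi>' \<in> mHom n d (X (Suc (Suc m))) (?V (Suc (Suc m)))"
    "?g (Suc m) \<odot> \<psi> = \<psi>' \<odot> f (Suc m)"
    using seq mcomp_in[OF \<psi> g] unfolding colifts_def by blast
  have "\<psi>' \<odot> \<phi>' \<in> mHom n d (?V (Suc (Suc m))) (?V (Suc (Suc m)))" by (rule mcomp_in[OF \<phi>'(1) \<psi>'(1)])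
  then obtain c where c: "\<psi>' \<odot> \<phi>' = mscale c (mid n d (?V (Suc (Suc m))))"
    using scalar_end_Mint[OF d os] unfolding scalar_end_def by blast
  note A = arrow[OF Mint_in_mod_A Mint_in_mod_A g]
  have "?g (Suc m) = ?g (Suc m) \<odot> (\<psi> \<odot> \<phi>)" by (simp add: \<psi>\<phi> A)
  also have "\<dots> = \<psi>' \<odot> (\<phi>' \<odot> ?g (Suc m))" using mcomp_nest[OF \<psi>'(2)] \<phi>'(2) by simp
  also have "\<dots> = mscale c (?g (Suc m))" using mcomp_nest[OF c] A by simp
  finally have "mscale (1 - c) (?g (Suc m)) = 0"
    by (simp add: mscale_def fun_eq_iff kseq.scale_left_diff_distrib)
  moreover have "?g (Suc m) \<noteq> 0"
    using can_nonzero[OF os mixed_step[OF st]] m by (simp add: mixed_can_def)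
  ultimately have "c = 1" by (simp add: mscale_zero_iff)
  then show thesis using that[OF \<phi>'(1) \<psi>'(1) _ \<phi>'(2) \<psi>'(2)] c by simp
qed

text \<open>
  Otherwise \<open>a\<close> is a longest truncation in \<open>I\<close>, so that the torsion part of the module at position 1
  and \<open>M\<^sub>a\<close> have the same image in it.  The comparison maps then make the staircase a retract of the torsion
  sequence \<open>X\<close> from position 1 on.  The composite \<open>M\<^sub>z \<rightarrow> M\<^sub>b \<rightarrow> X\<^sub>d\<^sub>+\<^sub>1\<close> lifts to \<open>X\<^sub>d\<close> by the torsion
  property (and is zero if \<open>d = 1\<close>); going back to the staircase, \<open>M\<^sub>z \<rightarrow> M\<^sub>b\<close> lifts to position \<open>d\<close>, where
  the first entry is \<open>a\<^sub>0 < z\<^sub>0\<close>, so that \<open>M\<^sub>z\<close> has only the zero map to it.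
\<close>

lemma extension_last:
  assumes d: "d \<ge> 1" and I: "I \<subseteq> os n (d + 1)"
    and TC: "d_torsion_class n d (Mcat n d :: 'k::field kmod set) (madd n d (Mint n d ` I))"
    and st: "staircase n d a b" and a: "a \<in> I" and z: "z \<in> I"
    and zb: "interlaced d z b" and az: "a ! 0 < z ! 0"
  shows "\<exists>t. a ! d < t \<and> t \<le> b ! d \<and> a[d := t] \<in> I"
proof (rule ccontr)
  assume not: "\<not> ?thesis"
  let ?S = "Mint n d ` os n (d + 1) :: 'k kmod set"
  let ?T = "Mint n d ` I :: 'k kmod set"
  let ?V = "\<lambda>k. Mint n d (mixed d a b k) :: 'k kmod" and ?g = "mixed_can n d a b :: nat \<Rightarrow> 'k mor"
  have Q: "quotient_closed n d I" by (rule quotient_closed_of_torsion_class[OF d I TC])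
  have S: "?S \<subseteq> mod_A n d" using Mint_in_mod_A by blast
  have Mcat: "subcat n d (Mcat n d :: 'k kmod set)" unfolding Mcat_def by (rule subcat_madd[OF S])
  note os = mixed_os[OF st]
  have VM: "?V k \<in> Mcat n d" for k
    unfolding Mcat_def by (rule subsetD[OF madd_superset imageI[OF os]])
  have g: "?g k \<in> mHom n d (?V k) (?V (Suc k))" for k by (rule mixed_can_in[OF st])
  obtain X and f :: "nat \<Rightarrow> 'k mor" where E: "d_exact n d (Mcat n d) X f"
    and T: "torsion_exact n d (madd n d ?T) X f" and X: "X 0 \<in> madd n d ?T" "X 1 = ?V 1"
    using torsion_class_sequence[OF TC VM] .
  note seq = torsion_sequence[OF E T Mcat d]
  \<comment> \<open>Maps from torsion modules to position 1 factor through \<open>M\<^sub>a\<close>.\<close>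
  have g1: "?g 1 \<odot> h = 0" if h: "h \<in> mHom n d (X 0) (?V 1)" for h
  proof -
    have "lifts n d (X 0) (?V 0) (?g 0) (?V 1) 0"
    proof (rule lifts_madd[OF Mint_in_mod_A Mint_in_mod_A _ _ _ X(1)])
      show "?g 0 \<in> mHom n d (?V 0) (?V 1)" using g[of 0] by simp
      show "?T \<subseteq> mod_A n d" using Mint_in_mod_A by blast
      fix N assume "N \<in> ?T"
      then obtain w where w: "w \<in> I" "N = Mint n d w" by blast
      have wos: "w \<in> os n (d + 1)" using w I by blast
      show "lifts n d N (?V 0) (?g 0) (?V 1) 0"
      proof (cases "interlaced d w (mixed d a b 1)")
        case True
        have "\<not> interlaced d w (mixed d a b (Suc 1))"
          using truncation_approx[OF d Q I st _ w(1) True] not by (auto simp: numeral_2_eq_2)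
        then have "interlaced d w (mixed d a b 0)" using mixed_lift(2)[OF st True] by simp
        then show ?thesis
          unfolding w(2) using lifts_surjective[OF d wos os _ mixed_step[OF st, of 0]] True
          by (simp add: mixed_can_def)
      next
        case False
        show ?thesis
          unfolding w(2) by (rule lifts_none[OF d wos os False Mint_in_mod_A]) (use g[of 0] in simp)
      qed
    qed
    then obtain h' where "h = ?g 0 \<odot> h'" using h unfolding lifts_def by auto
    then show ?thesis using mcomp_nest[OF mixed_can_comp[OF d st, of 0]] by simp
  qed
  have "mixed d a b 0 = a" using st by (simp add: mixed_def staircase_def os_iff)
  then have V0: "?V 0 \<in> madd n d ?T" using subsetD[OF madd_superset imageI[OF a]] by simp
  have f1: "f 1 \<odot> ?g 0 = 0" using seq(7)[OF V0] g[of 0] X(2) by simp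
  have "\<exists>\<phi> \<psi>. \<phi> \<in> mHom n d (?V (Suc m)) (X (Suc m)) \<and> \<psi> \<in> mHom n d (X (Suc m)) (?V (Suc m)) \<and>
      \<psi> \<odot> \<phi> = mid n d (?V (Suc m)) \<and>
      (m < d \<longrightarrow> f (Suc m) \<odot> (\<phi> \<odot> ?g m) = 0 \<and> ?g (Suc m) \<odot> (\<psi> \<odot> f m) = 0) \<and>
      (m > 0 \<longrightarrow> (\<exists>\<psi>'\<in>mHom n d (X m) (?V m). \<psi> \<odot> f m = ?g m \<odot> \<psi>'))" if "m \<le> d" for m
    using that
  proof (induction m)
    case 0
    have "mid n d (?V 1) \<in> mHom n d (?V 1) (X 1)" "mid n d (?V 1) \<in> mHom n d (X 1) (?V 1)"
      unfolding X(2) by (rule mid_in[OF Mint_in_mod_A])+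
    moreover have "mid n d (?V 1) \<odot> mid n d (?V 1) = mid n d (?V 1)"
      by (rule mid_right[OF mid_in[OF Mint_in_mod_A]])
    moreover have "mid n d (?V 1) \<odot> ?g 0 = ?g 0"
      using mid_left[OF lands_mHom[OF Mint_in_mod_A g[of 0]]] by simp
    moreover have f0: "f 0 \<in> mHom n d (X 0) (?V 1)" using seq(2)[of 0] X(2) by simp
    moreover have "mid n d (?V 1) \<odot> f 0 = f 0" using mid_left[OF lands_mHom[OF Mint_in_mod_A f0]] .
    ultimately show ?case
      using f1 g1[OF f0] by (intro exI[of _ "mid n d (?V 1)"]) simp
  next
    case (Suc m)
    then have m: "m < d" by simp
    obtain \<phi> \<psi> where IH: "\<phi> \<in> mHom n d (?V (Suc m)) (X (Suc m))" "\<psi> \<in> mHom n d (X (Suc m)) (?V (Suc m))"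
      "\<psi> \<odot> \<phi> = mid n d (?V (Suc m))" "f (Suc m) \<odot> (\<phi> \<odot> ?g m) = 0" "?g (Suc m) \<odot> (\<psi> \<odot> f m) = 0"
      using Suc.IH[OF less_imp_le[OF m]] m by blast
    obtain \<phi>' \<psi>' where new: "\<phi>' \<in> mHom n d (?V (Suc (Suc m))) (X (Suc (Suc m)))"
      "\<psi>' \<in> mHom n d (X (Suc (Suc m))) (?V (Suc (Suc m)))" "\<psi>' \<odot> \<phi>' = mid n d (?V (Suc (Suc m)))"
      "f (Suc m) \<odot> \<phi> = \<phi>' \<odot> ?g (Suc m)" "?g (Suc m) \<odot> \<psi> = \<psi>' \<odot> f (Suc m)"
      using comparison_step[OF d st m seq(2) seq(6)[OF _ m] seq(1) IH] m by auto
    have "f (Suc (Suc m)) \<odot> (\<phi>' \<odot> ?g (Suc m)) = 0" if "Suc m < d"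
      using mcomp_nest[OF seq(3)[OF that], of \<phi>] new(4) by simp
    moreover have "?g (Suc (Suc m)) \<odot> (\<psi>' \<odot> f (Suc m)) = 0"
      using mcomp_nest[OF mixed_can_comp[OF d st, of "Suc m"], of \<psi>] new(5) by simp
    ultimately show ?case
      using new(1-3) new(5)[symmetric] IH(2)
      by blast
  qed
  from this[of d] obtain \<phi> \<psi> \<psi>' where \<phi>: "\<phi> \<in> mHom n d (?V (Suc d)) (X (Suc d))"
    and \<psi>\<phi>: "\<psi> \<odot> \<phi> = mid n d (?V (Suc d))"
    and \<psi>': "\<psi>' \<in> mHom n d (X d) (?V d)" "\<psi> \<odot> f d = ?g d \<odot> \<psi>'" and \<psi>: "\<psi> \<in> mHom n d (X (Suc d)) (?V (Suc d))"
    using d by auto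
  have zos: "z \<in> os n (d + 1)" using z I by blast
  have b: "mixed d a b (Suc d) = b" by (simp add: mixed_def)
  define h where "h = (can n d z b :: 'k mor)"
  have h: "h \<in> mHom n d (Mint n d z) (?V (Suc d))" unfolding b h_def by (rule can_in_mHom[OF zb])
  have Uz: "Mint n d z \<in> madd n d ?T" by (rule subsetD[OF madd_superset imageI[OF z]])
  have h_eq: "h = \<psi> \<odot> (\<phi> \<odot> h)"
    using mcomp_nest[OF \<psi>\<phi>, of h] mid_left[OF lands_mHom[OF Mint_in_mod_A h]] by simp
  have last: "if d = 1 then \<phi> \<odot> h = 0 else \<exists>h'\<in>mHom n d (Mint n d z) (X d). \<phi> \<odot> h = f d \<odot> h'"
    using seq(8)[OF Uz, of "\<phi> \<odot> h"] mcomp_in[OF h \<phi>] by simp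
  have "h = 0"
  proof (cases "d = 1")
    case True
    then show ?thesis using h_eq last mcomp_right_zero[OF \<psi>] by simp
  next
    case False
    then obtain h' where h': "h' \<in> mHom n d (Mint n d z) (X d)" "\<phi> \<odot> h = f d \<odot> h'" using last by auto
    have "\<not> interlaced d z (mixed d a b d)"
      using az by (auto simp: interlaced_def mixed_nth[OF st] intro!: exI[of _ 0])
    then have "\<psi>' \<odot> h' = 0" using hom_Mint[OF d zos os mcomp_in[OF h'(1) \<psi>'(1)]] by simp
    then have "?g d \<odot> (\<psi>' \<odot> h') = 0" using mcomp_right_zero[OF g[of d]] by simp
    then show ?thesis using h_eq h'(2) mcomp_nest[OF \<psi>'(2), of h'] by simp
  qed
  then show False using can_nonzero[OF zos zb] unfolding h_def by blast
qed

text \<open>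
  If \<open>y\<^sub>d = x\<^sub>d\<close>, the claim follows from \<open>x \<preceq> y\<close>.  Otherwise \<open>y\<^sub>d = z\<^sub>d\<close>, and then \<open>y\<close> is above
  \<open>(x\<^sub>0, \<dots>, x\<^sub>d\<^sub>-\<^sub>1, z\<^sub>d)\<close>, so that it suffices to treat this tuple.
\<close>

lemma extension_closed_of_torsion_class:
  assumes d: "d \<ge> 1" and I: "I \<subseteq> os n (d + 1)"
    and TC: "d_torsion_class n d (Mcat n d :: 'k::field kmod set) (madd n d (Mint n d ` I))"
  shows "extension_closed n d I"
  unfolding extension_closed_def
proof (intro ballI impI)
  fix x z y assume x: "x \<in> os n (d + 1)" and z: "z \<in> os n (d + 1)" and y: "y \<in> os n (d + 1)"
    and xz: "map int x \<leadsto> tau (map int z)" and xI: "x \<in> I" and zI: "z \<in> I"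
    and choice: "\<forall>i\<le>d. y ! i \<in> {x ! i, z ! i}"
  have Q: "quotient_closed n d I" by (rule quotient_closed_of_torsion_class[OF d I TC])
  have lt: "x ! i < z ! i" if "i \<le> d" for i using xz that unfolding squig_tau_iff[OF x z] by blast
  have le: "z ! i \<le> Suc (x ! Suc i)" if "i < d" for i using xz that unfolding squig_tau_iff[OF x z] by blast
  have len: "length x = Suc d" "length z = Suc d" using x z by (simp_all add: os_iff)
  have mono: "x ! i \<le> x ! j" if "i \<le> j" "j \<le> d" for i j using x that by (simp add: os_iff)
  have zn: "z ! d < n" using z by (simp add: os_iff)
  have xy: "x ! i \<le> y ! i" if "i \<le> d" for i using choice lt[OF that] that by (auto dest: spec[of _ i])
  have key: "x[d := z ! d] \<in> I"
  proof (rule ccontr)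
    assume not: "x[d := z ! d] \<notin> I"
    let ?D = "{t. t \<le> z ! d \<and> x[d := t] \<in> I}"
    have fin: "finite ?D" by simp
    have xD: "x ! d \<in> ?D" using xI lt[of d] by simp
    define t where "t = Max ?D"
    have tD: "t \<in> ?D" unfolding t_def using Max_in[OF fin] xD by blast
    have max: "s \<le> t" if "s \<in> ?D" for s using Max_ge[OF fin that] by (simp add: t_def)
    have xt: "x ! d \<le> t" by (rule max[OF xD])
    have tz: "t < z ! d" using tD not by (cases "t = z ! d") auto
    define a where "a = x[d := t]"
    have a_nth: "a ! i = (if i = d then t else x ! i)" if "i \<le> d" for i
      using that len by (simp add: a_def nth_list_update)
    have aI: "a \<in> I" using tD by (simp add: a_def)
    obtain b where st: "staircase n d a b" and bd: "b ! d = z ! d"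
      using staircase_exists[OF d, of a n "z ! d"] aI I tz zn a_nth[of d] by auto
    have "interlaced d z b"
      unfolding interlaced_def
    proof (intro conjI allI impI)
      fix i assume i: "i \<le> d"
      show "z ! i \<le> b ! i"
        using le[of i] staircaseD(4)[OF st, of i] a_nth[of "Suc i"] xt bd i
        by (cases "i = d") (auto intro: le_trans split: if_splits)
    next
      fix i assume i: "i < d"
      show "b ! i \<le> z ! Suc i"
        using staircaseD(4)[OF st i] a_nth[of "Suc i"] lt[of "Suc i"] tz i by (auto split: if_splits)
    qed
    moreover have "a ! 0 < z ! 0" using a_nth[of 0] lt[of 0] d by simp
    ultimately obtain s where "t < s" "s \<le> z ! d" "x[d := s] \<in> I"
      using extension_last[OF d I TC st aI zI] a_nth[of d] bd by (auto simp: a_def)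
    then show False using max[of s] by simp
  qed
  consider "y ! d = x ! d" | "y ! d = z ! d" using choice by auto
  then show "y \<in> I"
  proof cases
    case 1
    then show ?thesis using Q x y ple_of_choice[OF x y xy] xI unfolding quotient_closed_def by metis
  next
    case 2
    have os: "x[d := z ! d] \<in> os n (d + 1)" using key I by blast
    have "x[d := z ! d] ! i \<le> y ! i" if "i \<le> d" for i
      using xy[OF that] 2 len that by (auto simp: nth_list_update)
    then have "x[d := z ! d] \<preceq> y" by (rule ple_of_choice[OF os y])
    moreover have "x[d := z ! d] ! d = y ! d" using 2 len by simp
    ultimately show ?thesis using Q os y key unfolding quotient_closed_def by blast
  qed
qed

theorem theorem5p13:
  fixes n d :: nat and I :: "nat list set"
  assumes "n \<ge> 1" and "d \<ge> 1" and "I \<subseteq> os n (d + 1)"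
  shows "d_torsion_class n d (Mcat n d :: 'k::field kmod set) (madd n d (Mint n d ` I)) \<longleftrightarrow>
    (\<forall>x\<in>os n (d + 1). \<forall>z\<in>os n (d + 1).
       (x \<preceq> z \<and> x ! d = z ! d \<longrightarrow> x \<in> I \<longrightarrow> z \<in> I) \<and>
       (map int x \<leadsto> tau (map int z) \<and> x \<in> I \<and> z \<in> I \<longrightarrow>
          (\<forall>y\<in>os n (d + 1). (\<forall>i\<le>d. y ! i \<in> {x ! i, z ! i}) \<longrightarrow> y \<in> I)))"
    (is "?torsion \<longleftrightarrow> ?closed")
proof -
  have "?closed \<longleftrightarrow> quotient_closed n d I \<and> extension_closed n d I"
    unfolding quotient_closed_def extension_closed_def by blast
  then show ?thesis
    using torsion_class_of_closed[OF assms(2) _ _ assms(3)]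
      quotient_closed_of_torsion_class[OF assms(2,3)] extension_closed_of_torsion_class[OF assms(2,3)]
    by blast
qed

end
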